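(* Let $G=N\rtimes H$ be a locally compact group which is the semi-direct product of a closed normal subgroup $N$ and a closed subgroup $H$. Let $(\mathrm{Prof}(G),\alpha_G)$, $(\mathrm{Prof}(N),\alpha_N)$, $(\mathrm{Prof}(H),\alpha_H)$ be profinite completions of $G$, $N$, $H$. Let $\psi_N:\mathrm{Prof}(N)\to\overline{\alpha_G(N)}$ and $\psi_H:\mathrm{Prof}(H)\to\overline{\alpha_G(H)}$ be the continuous homomorphisms such that $\psi_N\circ\alpha_N=\alpha_G|_N$ and $\psi_H\circ\alpha_H=\alpha_G|_H$. Set $$D:=\bigcap_{\sigma\in\widehat{N}_{\mathrm{finite}}^{H-\mathrm{per}}}\ker(\mathrm{Prof}(\sigma)).$$ Then: (i) $\ker\psi_N=D$, and so $\psi_N$ induces a topological isomorphism $\overline{\psi_N}:\mathrm{Prof}(N)/D\to\overline{\alpha_G(N)}$. (ii) $\psi_H:\mathrm{Prof}(H)\to\overline{\alpha_G(H)}$ is a topological isomorphism. (iii) The action of $H$ by automorphisms on $\mathrm{Prof}(N)$ induces an action of $\mathrm{Prof}(H)$ by automorphisms on $\mathrm{Prof}(N)/D$ (that is, $D$ is $H$-invariant and there is a continuous action of $\mathrm{Prof}(H)$ on $\mathrm{Prof}(N)/D$ by automorphisms for which $\alpha_H(h)$ acts, for every $h\in H$, as the automorphism of $\mathrm{Prof}(N)/D$ induced by $h$), and the maps $\overline{\psi_N}$ and $\psi_H$ give rise to an isomorphism of topological groups $$(\mathrm{Prof}(N)/D)\rtimes\mathrm{Prof}(H)\to\mathrm{Prof}(G),\qquad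 (xD,y)\mapsto\psi_N(x)\psi_H(y).$$
   Context: A profinite completion of a topological group $G$ is a pair $(\mathrm{Prof}(G),\alpha_G)$ consisting of a profinite group $\mathrm{Prof}(G)$ and a continuous homomorphism $\alpha_G:G\to\mathrm{Prof}(G)$ with dense image such that for every profinite group $L$ and every continuous homomorphism $\alpha:G\to L$ there exists a continuous homomorphism $\alpha':\mathrm{Prof}(G)\to L$ with $\alpha=\alpha'\circ\alpha_G$. It exists and is unique up to isomorphism. $\overline{X}$ denotes the closure of a subset $X$ of $\mathrm{Prof}(G)$. $G=N\rtimes H$ is a semi-direct product of topological groups, with $H$ acting on $N$ by conjugation. $\widehat{N}_{\mathrm{finite}}$ is the set of equivalence classes (modulo unitary equivalence) of irreducible finite dimensional (continuous) unitary representations $\sigma:N\to U(n)$, $n\ge1$, with finite image $\sigma(N)$. For such $\sigma$, $\mathrm{Prof}(\sigma)$ is the unique continuous unitary representation of $\mathrm{Prof}(N)$ with $\mathrm{Prof}(\sigma)\circ\alpha_N=\sigma$. The group $H$ acts on $\widehat{N}_{\mathrm{finite}}$ by $\sigma\mapsto\sigma^h$, where $\sigma^h(n)=\sigma(h^{-1}nh)$ for $n\in N$. $\widehat{N}_{\mathrm{finite}}^{H-\mathrm{per}}$ is the set of $\sigma\in\widehat{N}_{\mathrm{finite}}$ whose $H$-orbit is finite. By the universal property, $H$ acts by automorphisms on $\mathrm{Prof}(N)$: $h\in H$ acts as the unique continuous automorphism sending $\alpha_N(n)$ to $\alpha_N(hnh^{-1})$ for all $n\in N$. *)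

theory Defs
  imports
    "HOL-Analysis.Product_Topology"
    "HOL-Analysis.T1_Spaces"
    "HOL-Analysis.Abstract_Topological_Spaces"
    "HOL-Algebra.Coset"
    "HOL-Algebra.Bij"
    "HOL-Algebra.Group_Action"
    "Jordan_Normal_Form.Schur_Decomposition"
    "Jordan_Normal_Form.VS_Connect"
begin

section \<open>Topological groups\<close>

definition topological_group :: "'a monoid \<Rightarrow> 'a topology \<Rightarrow> bool" where
  "topological_group G T \<longleftrightarrow>
     group G \<and> topspace T = carrier G \<and>
     continuous_map (prod_topology T T) T (\<lambda>(x, y). x \<otimes>\<^bsub>G\<^esub> y) \<and>
     continuous_map T T (\<lambda>x. inv\<^bsub>G\<^esub> x)"

definition locally_compact_group :: "'a monoid \<Rightarrow> 'a topology \<Rightarrow> bool" where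
  "locally_compact_group G T \<longleftrightarrow>
     topological_group G T \<and> Hausdorff_space T \<and> locally_compact_space T"

definition totally_disconnected_space :: "'a topology \<Rightarrow> bool" where
  "totally_disconnected_space T \<longleftrightarrow>
     (\<forall>S x y. connectedin T S \<and> x \<in> S \<and> y \<in> S \<longrightarrow> x = y)"

definition profinite_group :: "'a monoid \<Rightarrow> 'a topology \<Rightarrow> bool" where
  "profinite_group G T \<longleftrightarrow>
     topological_group G T \<and> compact_space T \<and> Hausdorff_space T \<and>
     totally_disconnected_space T"

definition continuous_hom ::
  "'a monoid \<Rightarrow> 'a topology \<Rightarrow> 'b monoid \<Rightarrow> 'b topology \<Rightarrow> ('a \<Rightarrow> 'b) \<Rightarrow> bool" where
  "continuous_hom G T L S f \<longleftrightarrow> f \<in> hom G L \<and> continuous_map T S f"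

definition topological_iso ::
  "'a monoid \<Rightarrow> 'a topology \<Rightarrow> 'b monoid \<Rightarrow> 'b topology \<Rightarrow> ('a \<Rightarrow> 'b) \<Rightarrow> bool" where
  "topological_iso G T L S f \<longleftrightarrow> f \<in> iso G L \<and> homeomorphic_map T S f"

abbreviation subgrp :: "'a monoid \<Rightarrow> 'a set \<Rightarrow> 'a monoid" where
  "subgrp G K \<equiv> G\<lparr>carrier := K\<rparr>"

text \<open>
  The topology on the group \<open>G Mod D\<close> is the quotient topology: a set of cosets is open iff
  the union of these cosets is open in the topology of \<open>G\<close>.
\<close>

definition quotient_topology :: "'a monoid \<Rightarrow> 'a topology \<Rightarrow> 'a set \<Rightarrow> 'a set topology" where
  "quotient_topology G T D =
     topology (\<lambda>U. U \<subseteq> (\<lambda>x. D #>\<^bsub>G\<^esub> x) ` topspace T \<and>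
                   openin T {x \<in> topspace T. D #>\<^bsub>G\<^esub> x \<in> U})"

lemma quotient_map_quotient_topology:
  "quotient_map T (quotient_topology G T D) (\<lambda>x. D #>\<^bsub>G\<^esub> x)"
proof -
  let ?q = "\<lambda>x. D #>\<^bsub>G\<^esub> x"
  have int: "{x \<in> topspace T. ?q x \<in> A \<inter> B}
      = {x \<in> topspace T. ?q x \<in> A} \<inter> {x \<in> topspace T. ?q x \<in> B}" for A B
    by auto
  have un: "{x \<in> topspace T. ?q x \<in> \<Union>K} = (\<Union>A\<in>K. {x \<in> topspace T. ?q x \<in> A})" for K
    by auto
  have "istopology (\<lambda>U. U \<subseteq> ?q ` topspace T \<and> openin T {x \<in> topspace T. ?q x \<in> U})"
    unfolding istopology_def int un by (auto intro: openin_Int)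
  then have op: "openin (quotient_topology G T D) U \<longleftrightarrow>
      U \<subseteq> ?q ` topspace T \<and> openin T {x \<in> topspace T. ?q x \<in> U}" for U
    by (simp add: quotient_topology_def)
  have "{x \<in> topspace T. ?q x \<in> ?q ` topspace T} = topspace T"
    by auto
  then have "openin (quotient_topology G T D) (?q ` topspace T)"
    by (simp add: op)
  then have "topspace (quotient_topology G T D) = ?q ` topspace T"
    by (metis op openin_subset openin_topspace subset_antisym)
  then show ?thesis
    by (auto simp: quotient_map_def op)
qed

text \<open>
  \<open>G\<close> is the topological (internal) semi-direct product of \<open>N\<close> and \<open>H\<close>. The topology of \<open>G\<close> is
  the product topology of \<open>N \<times> H\<close>; the homeomorphism condition is not implied by the algebraic
  conditions.
\<close>

definition topological_semidirect :: "'a monoid \<Rightarrow> 'a topology \<Rightarrow> 'a set \<Rightarrow> 'a set \<Rightarrow> bool" where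
  "topological_semidirect G T N H \<longleftrightarrow>
     N \<lhd> G \<and> closedin T N \<and> subgroup H G \<and> closedin T H \<and>
     N <#>\<^bsub>G\<^esub> H = carrier G \<and> N \<inter> H = {\<one>\<^bsub>G\<^esub>} \<and>
     homeomorphic_map (prod_topology (subtopology T N) (subtopology T H)) T
       (\<lambda>(n, h). n \<otimes>\<^bsub>G\<^esub> h)"

definition semidirect_product ::
  "'a monoid \<Rightarrow> 'b monoid \<Rightarrow> ('b \<Rightarrow> 'a \<Rightarrow> 'a) \<Rightarrow> ('a \<times> 'b) monoid" where
  "semidirect_product N H \<phi> =
     \<lparr> carrier = carrier N \<times> carrier H,
       monoid.mult = (\<lambda>(n, h) (n', h'). (n \<otimes>\<^bsub>N\<^esub> \<phi> h n', h \<otimes>\<^bsub>H\<^esub> h')),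
       one = (\<one>\<^bsub>N\<^esub>, \<one>\<^bsub>H\<^esub>) \<rparr>"

definition continuous_action_by_automorphisms ::
  "'b monoid \<Rightarrow> 'b topology \<Rightarrow> 'a monoid \<Rightarrow> 'a topology \<Rightarrow> ('b \<Rightarrow> 'a \<Rightarrow> 'a) \<Rightarrow> bool" where
  "continuous_action_by_automorphisms H S N T \<phi> \<longleftrightarrow>
     \<phi> \<in> hom H (AutoGroup N) \<and>
     continuous_map (prod_topology S T) T (\<lambda>(h, x). \<phi> h x)"

text \<open>The map on the cosets of a normal subgroup that is induced by a map constant on cosets.\<close>

definition induced_map :: "('a \<Rightarrow> 'b) \<Rightarrow> 'a set \<Rightarrow> 'b" where
  "induced_map f C = the_elem (f ` C)"

section \<open>Profinite completions\<close>

text \<open>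
  A definition cannot quantify over all types. The test groups \<open>L\<close> in the universal property have
  their elements in \<open>'a set set\<close>, where \<open>'a\<close> is the type of the elements of \<open>G\<close>. This is no
  restriction: \<open>profinite_completion_universal\<close> below derives the universal property for test
  groups over an arbitrary type, because the closure of the image of \<open>G\<close> in a Hausdorff space
  embeds into \<open>'a set set\<close>.
\<close>

definition profinite_completion ::
  "'a monoid \<Rightarrow> 'a topology \<Rightarrow> 'p monoid \<Rightarrow> 'p topology \<Rightarrow> ('a \<Rightarrow> 'p) \<Rightarrow> bool" where
  "profinite_completion G T P S \<alpha> \<longleftrightarrow>
     profinite_group P S \<and> continuous_hom G T P S \<alpha> \<and>
     S closure_of (\<alpha> ` carrier G) = carrier P \<and>
     (\<forall>(L :: 'a set set monoid) R f.
        profinite_group L R \<and> continuous_hom G T L R f \<longrightarrow>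
        (\<exists>f'. continuous_hom P S L R f' \<and> (\<forall>x \<in> carrier G. f x = f' (\<alpha> x))))"

lemma topological_group_subgrp:
  assumes "topological_group G T" "subgroup K G"
  shows "topological_group (subgrp G K) (subtopology T K)"
proof -
  interpret group G using assms(1) by (simp add: topological_group_def)
  have top: "topspace T = carrier G" using assms(1) by (simp add: topological_group_def)
  have K: "K \<subseteq> carrier G" by (rule subgroup.subset[OF assms(2)])
  have ts: "topspace (subtopology T K) = K" using K top by auto
  have "continuous_map (subtopology (prod_topology T T) (K \<times> K)) T (\<lambda>(x, y). x \<otimes>\<^bsub>G\<^esub> y)"
    using assms(1) by (auto simp: topological_group_def intro: continuous_map_from_subtopology)
  then have m: "continuous_map (prod_topology (subtopology T K) (subtopology T K)) (subtopology T K)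
      (\<lambda>(x, y). x \<otimes>\<^bsub>G\<^esub> y)"
    unfolding subtopology_Times[symmetric]
    by (auto simp: continuous_map_in_subtopology subgroup.m_closed[OF assms(2)])
  have "continuous_map (subtopology T K) T (\<lambda>x. inv\<^bsub>G\<^esub> x)"
    using assms(1) by (auto simp: topological_group_def intro: continuous_map_from_subtopology)
  then have "continuous_map (subtopology T K) (subtopology T K) (\<lambda>x. inv\<^bsub>G\<^esub> x)"
    using K top by (auto simp: continuous_map_in_subtopology subgroup.m_inv_closed[OF assms(2)])
  then have i: "continuous_map (subtopology T K) (subtopology T K) (\<lambda>x. inv\<^bsub>subgrp G K\<^esub> x)"
    by (rule continuous_map_eq) (use ts m_inv_consistent[OF assms(2)] in auto)
  show ?thesis
    using m i ts subgroup_imp_group[OF assms(2)] by (simp add: topological_group_def)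
qed

lemma subgroup_closure_of:
  assumes "topological_group G T" "subgroup K G"
  shows "subgroup (T closure_of K) G"
proof -
  interpret group G using assms(1) by (simp add: topological_group_def)
  have top: "topspace T = carrier G" using assms(1) by (simp add: topological_group_def)
  have K: "K \<subseteq> carrier G" by (rule subgroup.subset[OF assms(2)])
  have KC: "K \<subseteq> T closure_of K" using K top by (simp add: closure_of_subset)
  let ?m = "\<lambda>(x, y). x \<otimes>\<^bsub>G\<^esub> y" and ?i = "\<lambda>x. inv\<^bsub>G\<^esub> x"
  have "?m ` (prod_topology T T closure_of (K \<times> K)) \<subseteq> T closure_of (?m ` (K \<times> K))"
    using assms(1) by (intro continuous_map_image_closure_subset) (simp add: topological_group_def)
  also have "\<dots> \<subseteq> T closure_of K"
    by (rule closure_of_mono) (use subgroup.m_closed[OF assms(2)] in auto)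
  finally have m: "?m ` ((T closure_of K) \<times> (T closure_of K)) \<subseteq> T closure_of K"
    by (simp add: closure_of_Times)
  have "?i ` (T closure_of K) \<subseteq> T closure_of (?i ` K)"
    using assms(1) by (intro continuous_map_image_closure_subset) (simp add: topological_group_def)
  also have "\<dots> \<subseteq> T closure_of K"
    by (rule closure_of_mono) (use subgroup.m_inv_closed[OF assms(2)] in auto)
  finally have i: "?i ` (T closure_of K) \<subseteq> T closure_of K" .
  show ?thesis
  proof (rule subgroupI)
    show "T closure_of K \<subseteq> carrier G" using closure_of_subset_topspace[of T K] top by simp
    show "T closure_of K \<noteq> {}" using KC subgroup.one_closed[OF assms(2)] by auto
  qed (use m i in auto)
qed

lemma profinite_group_closed_subgroup:
  assumes "profinite_group G T" "subgroup K G" "closedin T K"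
  shows "profinite_group (subgrp G K) (subtopology T K)"
proof -
  have "compact_space (subtopology T K)"
    using assms by (simp add: profinite_group_def closedin_compact_space compact_space_subtopology)
  moreover have "totally_disconnected_space (subtopology T K)"
    using assms(1) unfolding profinite_group_def totally_disconnected_space_def
    by (metis connectedin_subtopology)
  ultimately show ?thesis
    using assms by (simp add: profinite_group_def topological_group_subgrp Hausdorff_space_subtopology)
qed

lemma profinite_group_transport:
  fixes \<phi> :: "'a \<Rightarrow> 'b"
  assumes "profinite_group G T" "inj_on \<phi> (carrier G)"
  obtains M :: "'b monoid" and S where
    "profinite_group M S" "\<phi> \<in> iso G M" "homeomorphic_map T S \<phi>"
proof -
  define \<psi> where "\<psi> = inv_into (carrier G) \<phi>"
  define M where "M = \<lparr>carrier = \<phi> ` carrier G, monoid.mult = (\<lambda>a b. \<phi> (\<psi> a \<otimes>\<^bsub>G\<^esub> \<psi> b)),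
    one = \<phi> \<one>\<^bsub>G\<^esub>\<rparr>"
  define S where "S = pullback_topology (\<phi> ` carrier G) \<psi> T"
  have tg: "topological_group G T" using assms(1) by (simp add: profinite_group_def)
  interpret group G using tg by (simp add: topological_group_def)
  have top: "topspace T = carrier G" using tg by (simp add: topological_group_def)
  have \<psi>\<phi>: "\<psi> (\<phi> x) = x" if "x \<in> carrier G" for x
    using that assms(2) by (simp add: \<psi>_def)
  have cM: "carrier M = \<phi> ` carrier G" by (simp add: M_def)
  have hom: "\<phi> \<in> hom G M" by (auto simp: hom_def M_def \<psi>\<phi>)
  have iso: "\<phi> \<in> iso G M"
    using hom assms(2) by (simp add: iso_def bij_betw_def cM)
  have oneM: "\<one>\<^bsub>M\<^esub> = \<phi> \<one>\<^bsub>G\<^esub>" by (simp add: M_def)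
  have grp: "group M"
    using iso_imp_img_group[OF iso] oneM by (simp add: M_def)
  have multM: "a \<otimes>\<^bsub>M\<^esub> b = \<phi> (\<psi> a \<otimes>\<^bsub>G\<^esub> \<psi> b)" for a b by (simp add: M_def)
  interpret gh: group_hom G M \<phi>
    using group_axioms grp hom by (simp add: group_hom_def group_hom_axioms_def)
  have topS: "topspace S = \<phi> ` carrier G"
    by (auto simp: S_def topspace_pullback_topology top \<psi>\<phi>)
  have "continuous_map S T \<psi>"
    unfolding S_def by (rule continuous_map_pullback[where g = id, simplified]) simp
  moreover have "continuous_map T S \<phi>"
    unfolding S_def
  proof (rule continuous_map_pullback')
    show "continuous_map T T (\<psi> \<circ> \<phi>)"
      by (rule continuous_map_eq[OF continuous_map_id]) (auto simp: top \<psi>\<phi>)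
  qed (auto simp: top)
  ultimately have hms: "homeomorphic_maps T S \<phi> \<psi>"
    by (auto simp: homeomorphic_maps_def top topS \<psi>\<phi>)
  then have hm: "homeomorphic_map T S \<phi>" by (rule homeomorphic_maps_imp_map)
  have c\<phi>: "continuous_map T S \<phi>" and c\<psi>: "continuous_map S T \<psi>"
    using hms by (auto simp: homeomorphic_maps_def)
  have mm: "continuous_map (prod_topology S S) (prod_topology T T) (\<lambda>p. (\<psi> (fst p), \<psi> (snd p)))"
    using continuous_map_compose[OF continuous_map_fst c\<psi>]
      continuous_map_compose[OF continuous_map_snd c\<psi>]
    by (auto simp: continuous_map_paired o_def)
  have mG: "continuous_map (prod_topology T T) T (\<lambda>(x, y). x \<otimes>\<^bsub>G\<^esub> y)"
    using tg by (simp add: topological_group_def)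
  have "continuous_map (prod_topology S S) S
      (\<phi> \<circ> ((\<lambda>(x, y). x \<otimes>\<^bsub>G\<^esub> y) \<circ> (\<lambda>p. (\<psi> (fst p), \<psi> (snd p)))))"
    by (rule continuous_map_compose[OF continuous_map_compose[OF mm mG] c\<phi>])
  then have m: "continuous_map (prod_topology S S) S (\<lambda>(x, y). x \<otimes>\<^bsub>M\<^esub> y)"
    by (simp only: multM o_def case_prod_unfold fst_conv snd_conv)
  have "continuous_map T T (\<lambda>x. inv\<^bsub>G\<^esub> x)"
    using tg by (simp add: topological_group_def)
  from continuous_map_compose[OF continuous_map_compose[OF c\<psi> this] c\<phi>]
  have i: "continuous_map S S (\<lambda>x. inv\<^bsub>M\<^esub> x)"
  proof (rule continuous_map_eq)
    fix y assume "y \<in> topspace S"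
    then obtain x where "x \<in> carrier G" "y = \<phi> x" using topS by blast
    then show "(\<phi> \<circ> ((\<lambda>x. inv\<^bsub>G\<^esub> x) \<circ> \<psi>)) y = inv\<^bsub>M\<^esub> y"
      by (simp add: \<psi>\<phi> gh.hom_inv)
  qed
  have tgM: "topological_group M S"
    using grp m i by (simp add: topological_group_def topS cM)
  have hs: "T homeomorphic_space S" using hm by (rule homeomorphic_map_imp_homeomorphic_space)
  have td: "totally_disconnected_space S"
    unfolding totally_disconnected_space_def
  proof (intro allI impI, elim conjE)
    fix C x y assume C: "connectedin S C" "x \<in> C" "y \<in> C"
    have sub: "C \<subseteq> \<phi> ` carrier G" using connectedin_subset_topspace[OF C(1)] topS by simp
    have "connectedin T (\<psi> ` C)" using C(1) c\<psi> by (rule connectedin_continuous_map_image[rotated])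
    then have "\<psi> x = \<psi> y"
      using assms(1) C(2,3) unfolding profinite_group_def totally_disconnected_space_def by blast
    then show "x = y" using sub C(2,3) \<psi>\<phi> by (metis imageE subsetD)
  qed
  have "profinite_group M S"
    using assms(1) tgM td homeomorphic_compact_space[OF hs] homeomorphic_Hausdorff_space[OF hs]
    by (simp add: profinite_group_def)
  with iso hm that show thesis by blast
qed

theorem profinite_completion_universal:
  fixes L :: "'l monoid"
  assumes G: "topological_group G T" and P: "profinite_completion G T P S \<alpha>"
    and L: "profinite_group L R" and f: "continuous_hom G T L R f"
  shows "\<exists>f'. continuous_hom P S L R f' \<and> (\<forall>x \<in> carrier G. f x = f' (\<alpha> x))"
proof -
  have tgL: "topological_group L R" and HL: "Hausdorff_space R"
    using L by (auto simp: profinite_group_def)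
  have topL: "topspace R = carrier L" and gL: "group L" and gG: "group G"
    using tgL G by (auto simp: topological_group_def)
  interpret gh: group_hom G L f
    using gL gG f by (simp add: group_hom_def group_hom_axioms_def continuous_hom_def)
  define K where "K = R closure_of (f ` carrier G)"
  have fK: "f ` carrier G \<subseteq> K"
    unfolding K_def by (rule closure_of_subset) (auto simp: topL)
  have sK: "subgroup K L"
    unfolding K_def by (rule subgroup_closure_of[OF tgL gh.img_is_subgroup])
  have KL: "K \<subseteq> carrier L" using sK by (rule subgroup.subset)
  have pK: "profinite_group (subgrp L K) (subtopology R K)"
    by (rule profinite_group_closed_subgroup[OF L sK]) (simp add: K_def)
  define \<phi> where
    "\<phi> y = {A. \<exists>V. openin R V \<and> y \<in> V \<and> A = {g \<in> carrier G. f g \<in> V}}" for y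
  have "inj_on \<phi> K"
  proof (rule inj_onI, rule ccontr)
    fix x y assume xy: "x \<in> K" "y \<in> K" "\<phi> x = \<phi> y" "x \<noteq> y"
    then obtain V W where V: "openin R V" "openin R W" "x \<in> V" "y \<in> W" "disjnt V W"
      using HL KL topL unfolding Hausdorff_space_def by (metis subsetD)
    have "{g \<in> carrier G. f g \<in> V} \<in> \<phi> y" using V xy(3) unfolding \<phi>_def by blast
    then obtain V' where V': "openin R V'" "y \<in> V'"
        "{g \<in> carrier G. f g \<in> V} = {g \<in> carrier G. f g \<in> V'}"
      unfolding \<phi>_def by blast
    have "openin R (V' \<inter> W)" "y \<in> V' \<inter> W" using V V' by auto
    then obtain g where "g \<in> carrier G" "f g \<in> V' \<inter> W"
      using xy(2) unfolding K_def in_closure_of by blast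
    with V'(3) V(5) show False unfolding disjnt_iff by blast
  qed
  then have "inj_on \<phi> (carrier (subgrp L K))" by simp
  then obtain M :: "'a set set monoid" and Q where M: "profinite_group M Q"
      "\<phi> \<in> iso (subgrp L K) M" "homeomorphic_map (subtopology R K) Q \<phi>"
    using profinite_group_transport[OF pK] by blast
  from M(3) obtain \<psi> where \<psi>: "homeomorphic_maps (subtopology R K) Q \<phi> \<psi>"
    by (auto simp: homeomorphic_map_maps)
  have ts: "topspace (subtopology R K) = K" using KL topL by auto
  have \<psi>\<phi>: "\<psi> (\<phi> x) = x" if "x \<in> K" for x
    using \<psi> that ts unfolding homeomorphic_maps_def by blast
  have cK: "continuous_map T (subtopology R K) f"
    using f fK G
    by (auto simp: continuous_hom_def continuous_map_in_subtopology topological_group_def)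
  have "continuous_map T Q (\<phi> \<circ> f)"
    using \<psi> by (intro continuous_map_compose[OF cK]) (simp add: homeomorphic_maps_def)
  moreover have "\<phi> \<circ> f \<in> hom G M"
  proof (rule homI)
    fix x y assume xy: "x \<in> carrier G" "y \<in> carrier G"
    show "(\<phi> \<circ> f) x \<in> carrier M"
      using M(2) fK xy by (auto simp: iso_def hom_def)
    have "f x \<in> K" "f y \<in> K" using fK xy by auto
    then show "(\<phi> \<circ> f) (x \<otimes>\<^bsub>G\<^esub> y) = (\<phi> \<circ> f) x \<otimes>\<^bsub>M\<^esub> (\<phi> \<circ> f) y"
      using M(2) xy by (simp add: iso_def hom_def)
  qed
  ultimately have "continuous_hom G T M Q (\<phi> \<circ> f)" by (simp add: continuous_hom_def)
  then obtain f' where f': "continuous_hom P S M Q f'" "\<forall>x \<in> carrier G. (\<phi> \<circ> f) x = f' (\<alpha> x)"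
    using P M(1) unfolding profinite_completion_def by blast
  have cMK: "carrier M = \<phi> ` K" using M(2) by (auto simp: iso_def bij_betw_def)
  have "continuous_map S (subtopology R K) (\<psi> \<circ> f')"
    by (rule continuous_map_compose[of _ Q])
      (use f'(1) \<psi> in \<open>simp_all add: continuous_hom_def homeomorphic_maps_def\<close>)
  then have "continuous_map S R (\<psi> \<circ> f')"
    by (simp add: continuous_map_in_subtopology)
  moreover have "\<psi> \<circ> f' \<in> hom P L"
  proof (rule homI)
    have sub: "f' x \<in> \<phi> ` K" if "x \<in> carrier P" for x
      using f'(1) that cMK by (auto simp: continuous_hom_def hom_def)
    fix x y assume xy: "x \<in> carrier P" "y \<in> carrier P"
    obtain a b where ab: "a \<in> K" "b \<in> K" "f' x = \<phi> a" "f' y = \<phi> b"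
      using sub[OF xy(1)] sub[OF xy(2)] by (elim imageE)
    show "(\<psi> \<circ> f') x \<in> carrier L" using ab KL \<psi>\<phi>[OF ab(1)] by (simp add: subsetD)
    have "f' (x \<otimes>\<^bsub>P\<^esub> y) = \<phi> a \<otimes>\<^bsub>M\<^esub> \<phi> b"
      using f'(1) xy ab by (simp add: continuous_hom_def hom_def)
    also have "\<dots> = \<phi> (a \<otimes>\<^bsub>L\<^esub> b)" using M(2) ab by (simp add: iso_def hom_def)
    finally show "(\<psi> \<circ> f') (x \<otimes>\<^bsub>P\<^esub> y) = (\<psi> \<circ> f') x \<otimes>\<^bsub>L\<^esub> (\<psi> \<circ> f') y"
      using ab(3,4) \<psi>\<phi>[OF ab(1)] \<psi>\<phi>[OF ab(2)] \<psi>\<phi>[OF subgroup.m_closed[OF sK ab(1,2)]]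
      by simp
  qed
  moreover have "\<forall>x \<in> carrier G. f x = (\<psi> \<circ> f') (\<alpha> x)"
  proof
    fix x assume x: "x \<in> carrier G"
    then have "f x = \<psi> (\<phi> (f x))" using \<psi>\<phi> fK by (simp add: image_subset_iff)
    then show "f x = (\<psi> \<circ> f') (\<alpha> x)" using f'(2) x by simp
  qed
  ultimately show ?thesis unfolding continuous_hom_def by blast
qed

text \<open>The automorphism by which \<open>h\<close> acts on the profinite completion \<open>P\<close> of \<open>N \<lhd> G\<close>.\<close>

definition prof_action ::
  "'a monoid \<Rightarrow> 'a set \<Rightarrow> 'p monoid \<Rightarrow> 'p topology \<Rightarrow> ('a \<Rightarrow> 'p) \<Rightarrow> 'a \<Rightarrow> 'p \<Rightarrow> 'p" where
  "prof_action G N P S \<alpha> h =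
     (THE \<theta>. \<theta> \<in> auto P \<and> continuous_map S S \<theta> \<and>
             (\<forall>n \<in> N. \<theta> (\<alpha> n) = \<alpha> (h \<otimes>\<^bsub>G\<^esub> n \<otimes>\<^bsub>G\<^esub> inv\<^bsub>G\<^esub> h)))"

section \<open>Finite dimensional unitary representations\<close>

definition unitary_group :: "nat \<Rightarrow> complex mat monoid" where
  "unitary_group n =
     \<lparr> carrier = {A \<in> carrier_mat n n. A * mat_adjoint A = 1\<^sub>m n \<and> mat_adjoint A * A = 1\<^sub>m n},
       monoid.mult = (*), one = 1\<^sub>m n \<rparr>"

text \<open>
  Representations are functions that are \<open>undefined\<close> outside the group. The topology of \<open>U(n)\<close> is
  that of \<open>n\<^sup>2\<close> complex matrix entries, so continuity is continuity of all matrix coefficients.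
\<close>

definition unitary_rep ::
  "'a monoid \<Rightarrow> 'a topology \<Rightarrow> nat \<Rightarrow> ('a \<Rightarrow> complex mat) \<Rightarrow> bool" where
  "unitary_rep G T n \<sigma> \<longleftrightarrow>
     1 \<le> n \<and> \<sigma> \<in> hom G (unitary_group n) \<and> \<sigma> \<in> extensional (carrier G) \<and>
     (\<forall>i<n. \<forall>j<n. continuous_map T euclidean (\<lambda>g. \<sigma> g $$ (i, j)))"

definition irreducible_rep :: "'a monoid \<Rightarrow> nat \<Rightarrow> ('a \<Rightarrow> complex mat) \<Rightarrow> bool" where
  "irreducible_rep G n \<sigma> \<longleftrightarrow>
     (\<forall>W. VectorSpace.subspace class_ring W (module_vec TYPE(complex) n) \<and>
          (\<forall>g \<in> carrier G. \<forall>w \<in> W. \<sigma> g *\<^sub>v w \<in> W) \<longrightarrow>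
          W = {0\<^sub>v n} \<or> W = carrier_vec n)"

definition finite_irreps ::
  "'a monoid \<Rightarrow> 'a topology \<Rightarrow> (nat \<times> ('a \<Rightarrow> complex mat)) set" where
  "finite_irreps G T =
     {(n, \<sigma>). unitary_rep G T n \<sigma> \<and> irreducible_rep G n \<sigma> \<and> finite (\<sigma> ` carrier G)}"

definition unitary_equivalence ::
  "'a monoid \<Rightarrow> 'a topology \<Rightarrow>
    ((nat \<times> ('a \<Rightarrow> complex mat)) \<times> (nat \<times> ('a \<Rightarrow> complex mat))) set" where
  "unitary_equivalence G T =
     {((n, \<sigma>), (m, \<tau>)). (n, \<sigma>) \<in> finite_irreps G T \<and> (m, \<tau>) \<in> finite_irreps G T \<and> n = m \<and>
        (\<exists>U \<in> carrier (unitary_group n). \<forall>g \<in> carrier G. \<tau> g = U * \<sigma> g * mat_adjoint U)}"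

definition finite_dual ::
  "'a monoid \<Rightarrow> 'a topology \<Rightarrow> (nat \<times> ('a \<Rightarrow> complex mat)) set set" where
  "finite_dual G T = finite_irreps G T // unitary_equivalence G T"

definition conj_rep ::
  "'a monoid \<Rightarrow> 'a set \<Rightarrow> 'a \<Rightarrow> nat \<times> ('a \<Rightarrow> complex mat) \<Rightarrow> nat \<times> ('a \<Rightarrow> complex mat)" where
  "conj_rep G N h = (\<lambda>(n, \<sigma>). (n, \<lambda>x\<in>N. \<sigma> (inv\<^bsub>G\<^esub> h \<otimes>\<^bsub>G\<^esub> x \<otimes>\<^bsub>G\<^esub> h)))"

definition conj_class ::
  "'a monoid \<Rightarrow> 'a set \<Rightarrow> 'a \<Rightarrow>
    (nat \<times> ('a \<Rightarrow> complex mat)) set \<Rightarrow> (nat \<times> ('a \<Rightarrow> complex mat)) set" where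
  "conj_class G N h c = conj_rep G N h ` c"

definition periodic_finite_dual ::
  "'a monoid \<Rightarrow> 'a topology \<Rightarrow> 'a set \<Rightarrow> 'a set \<Rightarrow> (nat \<times> ('a \<Rightarrow> complex mat)) set set" where
  "periodic_finite_dual G T N H =
     {c \<in> finite_dual (subgrp G N) (subtopology T N).
        finite (orbit (subgrp G H) (conj_class G N) c)}"

definition prof_rep ::
  "'a monoid \<Rightarrow> 'p monoid \<Rightarrow> 'p topology \<Rightarrow> ('a \<Rightarrow> 'p) \<Rightarrow>
    nat \<Rightarrow> ('a \<Rightarrow> complex mat) \<Rightarrow> 'p \<Rightarrow> complex mat" where
  "prof_rep G P S \<alpha> n \<sigma> =
     (THE \<rho>. unitary_rep P S n \<rho> \<and> (\<forall>x \<in> carrier G. \<rho> (\<alpha> x) = \<sigma> x))"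

text \<open>
  The kernel of \<open>Prof(\<sigma>)\<close> depends only on the class of \<open>\<sigma>\<close>; the intersection runs over all
  representatives of all classes with a finite \<open>H\<close>-orbit.
\<close>

definition periodic_kernel ::
  "'a monoid \<Rightarrow> 'a topology \<Rightarrow> 'a set \<Rightarrow> 'a set \<Rightarrow>
    'p monoid \<Rightarrow> 'p topology \<Rightarrow> ('a \<Rightarrow> 'p) \<Rightarrow> 'p set" where
  "periodic_kernel G T N H P S \<alpha> =
     (\<Inter>c \<in> periodic_finite_dual G T N H. \<Inter>(n, \<sigma>) \<in> c.
        kernel P (unitary_group n) (prof_rep (subgrp G N) P S \<alpha> n \<sigma>))"

end

theory Submission
  imports Defs
begin

text \<open>
  Write \<open>K\<close> for the kernel of \<open>\<psi>N\<close>. Apart from the equality \<open>K = D\<close> the theorem is formal. The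
  projection of \<open>G\<close> onto \<open>H\<close> along \<open>N\<close> is a continuous homomorphism, so it induces a continuous
  homomorphism \<open>p\<close> from \<open>PG\<close> to \<open>PH\<close>. By density \<open>p\<close> is a left inverse of \<open>\<psi>H\<close> and is trivial on the
  closure of \<open>\<alpha>G ` N\<close>. Hence \<open>\<psi>H\<close> is injective and the closures of \<open>\<alpha>G ` N\<close> and \<open>\<alpha>G ` H\<close> meet
  trivially; their product is compact and contains the dense subgroup \<open>\<alpha>G ` G\<close>, so it is all of \<open>PG\<close>.
  Thus \<open>PG\<close> is the internal semi-direct product of the two closures, and the action of \<open>PH\<close> on
  \<open>PN / K\<close> is conjugation in \<open>PG\<close>, transported along the isomorphisms of \<open>PN / K\<close> and \<open>PH\<close> with the
  closures. All bijections that occur are continuous maps from compact to Hausdorff spaces, hence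
  homeomorphisms (\<open>compact_first_isomorphism\<close>, \<open>semidirect_product_of_complements\<close>).

  The equality \<open>K = D\<close> compares the finite quotients of \<open>N\<close> that extend to finite quotients of \<open>G\<close>
  with the periodic representations.

  For \<open>K \<subseteq> D\<close>, let \<open>\<sigma>\<close> have a class with a finite \<open>H\<close>-orbit. Equivalent representations have the same
  kernel, so \<open>ker \<sigma>\<close> has only finitely many conjugates under \<open>H\<close>. Their intersection \<open>B\<close> is open and
  of finite index in \<open>N\<close> and is normal in \<open>G\<close>. Therefore \<open>B H\<close> is an open subgroup of finite index in
  \<open>G\<close>, and it meets \<open>N\<close> in \<open>B \<subseteq> ker \<sigma>\<close> (\<open>open_finite_index_subgroup_of_periodic_rep\<close>). The
  permutation action of \<open>G\<close> on the cosets of \<open>B H\<close> is a finite quotient; it factors through \<open>PG\<close>, and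
  an element of \<open>N\<close> that it kills lies in \<open>ker \<sigma>\<close>. By density, \<open>Prof(\<sigma>)\<close> is trivial on \<open>K\<close>
  (\<open>kernel_in_prof_rep_kernel\<close>).

  For \<open>D \<subseteq> K\<close>, let \<open>\<psi>N x \<noteq> 1\<close>. Some open subgroup of the profinite group \<open>PG\<close> omits \<open>\<psi>N x\<close>, and the
  action on its cosets is a homomorphism \<open>q\<close> to a finite group with \<open>q (\<psi>N x) \<noteq> 1\<close>. The image of \<open>N\<close>
  in this group has an irreducible unitary representation \<open>\<pi>\<close> that does not kill \<open>q (\<psi>N x)\<close>
  (\<open>finite_group_separating_irrep\<close>). Its pull-back to \<open>N\<close> has a finite \<open>H\<close>-orbit, because
  conjugation by \<open>h\<close> changes it in a way that depends only on the image of \<open>h\<close> in the finite group;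
  and its extension to \<open>PN\<close> is \<open>\<pi> \<circ> q \<circ> \<psi>N\<close>, which is non-trivial at \<open>x\<close>
  (\<open>prof_rep_detects_non_kernel\<close>).
\<close>

section \<open>Finite quotients of topological groups\<close>

locale topological_grp = group G for G (structure) +
  fixes T :: "'a topology"
  assumes topological_group: "topological_group G T"
begin

lemma topspace [simp]: "topspace T = carrier G"
  using topological_group by (simp add: topological_group_def)

lemma continuous_map_mult:
  assumes "continuous_map X T f" "continuous_map X T g"
  shows "continuous_map X T (\<lambda>x. f x \<otimes> g x)"
proof -
  have "continuous_map X (prod_topology T T) (\<lambda>x. (f x, g x))"
    using assms by (simp add: continuous_map_pairedI)
  moreover have "continuous_map (prod_topology T T) T (\<lambda>(x, y). x \<otimes> y)"
    using topological_group by (simp add: topological_group_def)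
  ultimately have "continuous_map X T ((\<lambda>(x, y). x \<otimes> y) \<circ> (\<lambda>x. (f x, g x)))"
    by (rule continuous_map_compose)
  then show ?thesis by (simp add: o_def)
qed

lemma continuous_map_inv:
  assumes "continuous_map X T f"
  shows "continuous_map X T (\<lambda>x. inv f x)"
proof -
  have "continuous_map T T (\<lambda>x. inv x)"
    using topological_group by (simp add: topological_group_def)
  then show ?thesis
    using continuous_map_compose[OF assms] by (simp add: o_def)
qed

lemma continuous_map_conj:
  assumes "continuous_map X T f" "continuous_map X T g"
  shows "continuous_map X T (\<lambda>x. f x \<otimes> g x \<otimes> inv (f x))"
  by (intro continuous_map_mult continuous_map_inv assms)

lemma openin_translate:
  assumes U: "openin T U" and a: "a \<in> carrier G"
  shows "openin T (U #> a)"
proof -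
  have "continuous_map T T (\<lambda>x. x \<otimes> inv a)"
    using a by (intro continuous_map_mult continuous_map_id[unfolded id_def]) simp_all
  then have "openin T {x \<in> carrier G. x \<otimes> inv a \<in> U}"
    using openin_continuous_map_preimage[OF _ U] by fastforce
  moreover have "{x \<in> carrier G. x \<otimes> inv a \<in> U} = U #> a"
  proof -
    have "x = (x \<otimes> inv a) \<otimes> a" if "x \<in> carrier G" for x
      using that a by (simp add: m_assoc)
    moreover have "u \<in> carrier G \<and> u \<otimes> a \<otimes> inv a = u" if "u \<in> U" for u
      using that a openin_subset[OF U] by (auto simp: m_assoc)
    ultimately show ?thesis
      using a by (auto simp: r_coset_def)
  qed
  ultimately show ?thesis by simp
qed

text \<open>
  The cosets of an open subgroup form an open partition of the group, and an open partition of a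
  compact space is finite.
\<close>

lemma finite_index_if_compact:
  assumes "compact_space T" "subgroup V G" "openin T V"
  shows "finite (rcosets V)"
proof -
  have un: "\<Union>(rcosets V) = carrier G"
    using assms(2) by (rule rcosets_part_G)
  have "\<forall>C \<in> rcosets V. openin T C"
    using openin_translate[OF assms(3)] by (auto simp: RCOSETS_def)
  then obtain \<F> where F: "finite \<F>" "\<F> \<subseteq> rcosets V" "carrier G \<subseteq> \<Union>\<F>"
    using assms(1) un unfolding compact_space_alt topspace by (metis order_refl)
  have "C \<in> \<F>" if C: "C \<in> rcosets V" for C
  proof -
    obtain x where x: "x \<in> C"
      using subgroup.rcosets_non_empty[OF assms(2) C] by blast
    then have "x \<in> carrier G" using C un by blast
    then obtain C' where C': "C' \<in> \<F>" "x \<in> C'" using F(3) by blast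
    then have "C = C'"
      using pairwiseD[OF rcos_disjoint[OF assms(2)] C, of C'] F(2) x by (auto simp: disjnt_iff)
    then show ?thesis using C' by simp
  qed
  then show ?thesis using F(1) by (meson finite_subset subsetI)
qed

text \<open>
  This is how an open subgroup of finite index yields a finite quotient: the group permutes the
  cosets. An element that fixes every coset fixes \<open>V\<close> itself, so it lies in \<open>V\<close>. The kernel is
  the intersection of the finitely many stabilisers \<open>a\<inverse> V a\<close>, hence open, and a homomorphism with
  open kernel is continuous for the discrete topology.
\<close>

lemma finite_coset_action:
  assumes V: "subgroup V G" "openin T V" and fin: "finite (rcosets V)"
  obtains f where
    "continuous_hom G T (BijGroup (rcosets V)) (discrete_topology (carrier (BijGroup (rcosets V)))) f"
    "\<And>g. g \<in> carrier G \<Longrightarrow> f g = \<one>\<^bsub>BijGroup (rcosets V)\<^esub> \<Longrightarrow> g \<in> V"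
proof -
  \<comment> \<open>The inverse turns the right translation of right cosets into a left action.\<close>
  define f where "f g = (\<lambda>C \<in> rcosets V. C #> inv g)" for g
  let ?B = "BijGroup (rcosets V)"
  have car: "C \<subseteq> carrier G" if "C \<in> rcosets V" for C
    using that subgroup.rcosets_carrier[OF V(1) is_group] by blast
  have tr: "C #> g \<in> rcosets V" if "C \<in> rcosets V" "g \<in> carrier G" for C g
    using that subgroup.subset[OF V(1)]
    by (auto simp: RCOSETS_def coset_mult_assoc intro!: bexI[of _ "_ \<otimes> g"])
  have bij: "f g \<in> Bij (rcosets V)" if g: "g \<in> carrier G" for g
  proof -
    have "bij_betw (f g) (rcosets V) (rcosets V)"
      by (rule bij_betw_byWitness[where f' = "\<lambda>C. C #> g"])
        (use g car tr in \<open>auto simp: f_def coset_mult_assoc\<close>)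
    then show ?thesis by (simp add: Bij_def f_def)
  qed
  have hom: "f \<in> hom G ?B"
  proof (rule homI)
    fix x y assume xy: "x \<in> carrier G" "y \<in> carrier G"
    show "f x \<in> carrier ?B" using bij xy by (simp add: BijGroup_def)
    have "f (x \<otimes> y) = compose (rcosets V) (f x) (f y)"
      using xy car tr
      by (intro ext) (simp add: f_def compose_def coset_mult_assoc inv_mult_group)
    then show "f (x \<otimes> y) = f x \<otimes>\<^bsub>?B\<^esub> f y"
      using bij xy by (simp add: BijGroup_def)
  qed
  interpret gh: group_hom G ?B f
    using hom group_BijGroup by (simp add: group_hom_def group_hom_axioms_def is_group)
  define K where "K = {g \<in> carrier G. f g = \<one>\<^bsub>?B\<^esub>}"
  have sK: "subgroup K G" using gh.subgroup_kernel by (simp add: K_def kernel_def)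
  have ker: "g \<in> V" if g: "g \<in> carrier G" and "f g = \<one>\<^bsub>?B\<^esub>" for g
  proof -
    have VV: "V \<in> rcosets V" by (rule subgroup.subgroup_in_rcosets[OF V(1) is_group])
    have "V #> inv g = V"
      using that(2) VV by (simp add: f_def BijGroup_def restrict_def fun_eq_iff) metis
    then show ?thesis
      using g V(1) by (metis coset_join1 inv_closed inv_inv subgroup.m_inv_closed subgroup.subset)
  qed
  have Keq: "K = carrier G \<inter> (\<Inter>C \<in> rcosets V. {g \<in> carrier G. C #> inv g = C})"
    by (auto simp: K_def f_def BijGroup_def restrict_def fun_eq_iff)
  have opC: "openin T {g \<in> carrier G. C #> inv g = C}" if C: "C \<in> rcosets V" for C
  proof -
    obtain a where a: "a \<in> carrier G" "C = V #> a" using C by (auto simp: RCOSETS_def)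
    have "continuous_map T T (\<lambda>g. a \<otimes> g \<otimes> inv a)"
      using a(1) by (intro continuous_map_mult continuous_map_id[unfolded id_def]) simp_all
    then have "openin T {g \<in> carrier G. a \<otimes> g \<otimes> inv a \<in> V}"
      using openin_continuous_map_preimage[OF _ V(2)] by fastforce
    moreover have "C #> inv g = C \<longleftrightarrow> a \<otimes> g \<otimes> inv a \<in> V" if g: "g \<in> carrier G" for g
    proof -
      have "C #> inv g = C \<longleftrightarrow> V #> (a \<otimes> inv g) = V #> a"
        using a g subgroup.subset[OF V(1)] by (simp add: coset_mult_assoc)
      also have "\<dots> \<longleftrightarrow> V #> (a \<otimes> inv (a \<otimes> inv g)) = V"
        using a g subgroup.subset[OF V(1)]
        by (metis coset_mult_inv1 coset_mult_inv2 inv_closed m_closed)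
      also have "a \<otimes> inv (a \<otimes> inv g) = a \<otimes> g \<otimes> inv a"
        using a g by (simp add: inv_mult_group m_assoc)
      also have "V #> (a \<otimes> g \<otimes> inv a) = V \<longleftrightarrow> a \<otimes> g \<otimes> inv a \<in> V"
        using a g V(1) by (metis coset_join1 coset_join2 inv_closed m_closed subgroup.subset)
      finally show ?thesis .
    qed
    ultimately show ?thesis by (simp cong: conj_cong)
  qed
  have "openin T (\<Inter>C \<in> rcosets V. {g \<in> carrier G. C #> inv g = C})"
    using subgroup.subgroup_in_rcosets[OF V(1) is_group] opC
    by (intro openin_Inter) (auto simp: fin)
  then have opK: "openin T K"
    unfolding Keq using openin_topspace[of T] by (intro openin_Int) simp_all
  have "continuous_map T (discrete_topology (carrier ?B)) f"
    unfolding continuous_map_def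
  proof (intro conjI allI impI)
    show "f \<in> topspace T \<rightarrow> topspace (discrete_topology (carrier ?B))"
      using hom by (auto simp: hom_def)
    fix U assume "openin (discrete_topology (carrier ?B)) U"
    have "openin T (\<Union>x \<in> {x \<in> carrier G. f x \<in> U}. K #> x)"
      using openin_translate[OF opK] by blast
    moreover have "(\<Union>x \<in> {x \<in> carrier G. f x \<in> U}. K #> x) = {x \<in> carrier G. f x \<in> U}"
    proof
      show "(\<Union>x \<in> {x \<in> carrier G. f x \<in> U}. K #> x) \<subseteq> {x \<in> carrier G. f x \<in> U}"
        by (auto simp: r_coset_def K_def)
      have "x \<in> K #> x" if "x \<in> carrier G" for x using sK that by (rule rcos_self[rotated])
      then show "{x \<in> carrier G. f x \<in> U} \<subseteq> (\<Union>x \<in> {x \<in> carrier G. f x \<in> U}. K #> x)"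
        by blast
    qed
    ultimately show "openin T {x \<in> topspace T. f x \<in> U}" by simp
  qed
  with hom ker show thesis by (auto simp: continuous_hom_def intro!: that)
qed

end

lemma finite_BijGroup: "finite S \<Longrightarrow> finite (carrier (BijGroup S))"
proof -
  assume "finite S"
  then have "finite (S \<rightarrow>\<^sub>E S)" by (simp add: finite_PiE)
  moreover have "carrier (BijGroup S) \<subseteq> S \<rightarrow>\<^sub>E S"
    by (auto simp: BijGroup_def Bij_def PiE_def bij_betw_def)
  ultimately show ?thesis by (rule rev_finite_subset)
qed

lemma profinite_group_discrete:
  assumes "group F" "finite (carrier F)"
  shows "profinite_group F (discrete_topology (carrier F))"
proof -
  interpret group F by fact
  have "totally_disconnected_space (discrete_topology (carrier F))"
    unfolding totally_disconnected_space_def connectedin_discrete_topology by auto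
  moreover have "topological_group F (discrete_topology (carrier F))"
    by (auto simp: topological_group_def is_group continuous_map_from_discrete_topology
      simp flip: prod_topology_discrete_topology)
  ultimately show ?thesis
    using assms by (simp add: profinite_group_def compact_space_discrete_topology)
qed

context topological_grp begin

text \<open>
  In a compact Hausdorff space the components are the quasi-components, so total disconnectedness
  gives a clopen set \<open>U\<close> that contains \<open>\<one>\<close> but not \<open>y\<close>. The elements \<open>v\<close> for which both \<open>v\<close> and its
  inverse translate \<open>U\<close> into itself form a subgroup contained in \<open>U\<close>. It is open because \<open>U\<close> is
  compact: the complement of \<open>M\<close> is the projection along \<open>U\<close> of a closed set.
\<close>

lemma profinite_open_subgroup:
  assumes P: "profinite_group G T" and y: "y \<in> carrier G" "y \<noteq> \<one>"
  obtains V where "subgroup V G" "openin T V" "y \<notin> V"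
proof -
  have cpt: "compact_space T" and haus: "Hausdorff_space T" and td: "totally_disconnected_space T"
    using P by (auto simp: profinite_group_def)
  have "\<not> connected_component_of T \<one> y"
    using td y unfolding connected_component_of_def totally_disconnected_space_def by metis
  then have "\<not> quasi_component_of T \<one> y"
    using cpt haus by (simp add: quasi_eq_connected_component_of)
  then obtain U where U: "\<one> \<in> U" "closedin T U" "openin T U" "y \<notin> U"
    using y by (auto simp: quasi_component_of)
  have Uc: "U \<subseteq> carrier G" using openin_subset[OF U(3)] by simp
  define M where "M = {v \<in> carrier G. \<forall>u\<in>U. u \<otimes> v \<in> U}"
  have opM: "openin T M"
  proof -
    let ?X = "prod_topology (subtopology T U) T"
    have cU: "compact_space (subtopology T U)"
      using cpt U(2) by (simp add: closedin_compact_space compact_space_subtopology)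
    have "continuous_map ?X T (\<lambda>p. fst p \<otimes> snd p)"
      by (intro continuous_map_mult continuous_map_snd continuous_map_into_fulltopology
          [OF continuous_map_fst])
    then have "closedin ?X {p \<in> topspace ?X. fst p \<otimes> snd p \<in> carrier G - U}"
      using U(3) by (intro closedin_continuous_map_preimage[of _ T]) (auto simp: openin_closedin_eq)
    then have "closedin T (snd ` {p \<in> topspace ?X. fst p \<otimes> snd p \<in> carrier G - U})"
      using closed_map_snd[OF cU, of T] unfolding closed_map_def by blast
    moreover have "M = carrier G - snd ` {p \<in> topspace ?X. fst p \<otimes> snd p \<in> carrier G - U}"
      using Uc by (force simp: M_def image_iff)
    ultimately show ?thesis using openin_topspace[of T] by (simp add: openin_diff)
  qed
  define V where "V = {v \<in> M. inv v \<in> M}"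
  have "openin T V"
  proof -
    have "continuous_map T T (\<lambda>x. inv x)"
      by (intro continuous_map_inv continuous_map_id[unfolded id_def])
    then have "openin T {x \<in> carrier G. inv x \<in> M}"
      using openin_continuous_map_preimage[OF _ opM] by fastforce
    then have "openin T (M \<inter> {x \<in> carrier G. inv x \<in> M})" using opM by blast
    moreover have "M \<inter> {x \<in> carrier G. inv x \<in> M} = V" by (auto simp: V_def M_def)
    ultimately show ?thesis by simp
  qed
  moreover have "subgroup V G"
  proof (rule subgroupI)
    show "V \<subseteq> carrier G" by (auto simp: V_def M_def)
    show "V \<noteq> {}" using Uc by (force simp: V_def M_def intro!: exI[of _ \<one>])
    show "inv a \<in> V" if "a \<in> V" for a using that by (auto simp: V_def M_def)
    fix a b assume ab: "a \<in> V" "b \<in> V"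
    have MM: "x \<otimes> z \<in> M" if "x \<in> M" "z \<in> M" for x z
      using that Uc by (auto simp: M_def subset_iff simp flip: m_assoc)
    show "a \<otimes> b \<in> V"
      using ab MM[of a b] MM[of "inv b" "inv a"]
      by (auto simp: V_def inv_mult_group M_def)
  qed
  moreover have "y \<notin> V"
    using U(1,4) y(1) by (force simp: V_def M_def)
  ultimately show thesis using that by blast
qed

end

section \<open>Compact groups and their semi-direct products\<close>

lemma topological_grpI: "topological_group G T \<Longrightarrow> topological_grp G T"
  by (simp add: topological_grp_def topological_grp_axioms_def topological_group_def)

lemma continuous_maps_agree_if_dense:
  assumes "Hausdorff_space R" "S closure_of A = carrier P"
    and "continuous_map S R f" "continuous_map S R f'" "\<And>x. x \<in> A \<Longrightarrow> f x = f' x" "x \<in> carrier P"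
  shows "f x = f' x"
  using forall_in_closure_of_eq[of x S A R f f'] assms by blast

lemma compact_image_of_closure:
  assumes "compact_space S" "Hausdorff_space R" "continuous_map S R f"
    and A: "A \<subseteq> topspace S" "S closure_of A = topspace S"
  shows "f ` topspace S = R closure_of (f ` A)"
proof
  show "f ` topspace S \<subseteq> R closure_of (f ` A)"
    using continuous_map_image_closure_subset[OF assms(3), of A] A by simp
  have "compactin R (f ` topspace S)"
    using assms(1,3) by (meson compact_space_def image_compactin)
  then have "closedin R (f ` topspace S)"
    using assms(2) by (rule compactin_imp_closedin[rotated])
  then show "R closure_of (f ` A) \<subseteq> f ` topspace S"
    using A(1) by (intro closure_of_minimal) auto
qed

text \<open>
  A continuous surjection from a compact space to a Hausdorff space is a closed map, hence a
  quotient map. It therefore induces a homeomorphism on the quotient by its fibres.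
\<close>

lemma compact_first_isomorphism:
  assumes P: "topological_group P S" "compact_space S" and L: "topological_group L R" "Hausdorff_space R"
    and f: "continuous_hom P S L R f" "f ` carrier P = carrier L"
  defines "K \<equiv> kernel P L f"
  shows "K \<lhd> P"
    and "x \<in> carrier P \<Longrightarrow> induced_map f (K #>\<^bsub>P\<^esub> x) = f x"
    and "topological_iso (P Mod K) (quotient_topology P S K) L R (induced_map f)"
proof -
  interpret P: topological_grp P S by (rule topological_grpI) fact
  interpret L: topological_grp L R by (rule topological_grpI) fact
  interpret group_hom P L f
    using f by (simp add: group_hom_def group_hom_axioms_def continuous_hom_def P.is_group L.is_group)
  show "K \<lhd> P" unfolding K_def by (rule normal_kernel)
  have ind: "induced_map f (K #>\<^bsub>P\<^esub> x) = f x" if x: "x \<in> carrier P" for x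
  proof -
    have "f ` (K #>\<^bsub>P\<^esub> x) = {f x}"
      using x P.one_closed by (force simp: K_def kernel_def r_coset_def intro!: bexI[of _ "\<one>\<^bsub>P\<^esub>"])
    then show ?thesis by (simp add: induced_map_def)
  qed
  then show "x \<in> carrier P \<Longrightarrow> induced_map f (K #>\<^bsub>P\<^esub> x) = f x" .
  have ind_eq: "induced_map f = (\<lambda>C. the_elem (f ` C))" by (simp add: induced_map_def fun_eq_iff)
  have iso: "induced_map f \<in> iso (P Mod K) L"
    unfolding ind_eq K_def by (rule FactGroup_iso_set[OF f(2)])
  let ?q = "\<lambda>x. K #>\<^bsub>P\<^esub> x" and ?Q = "quotient_topology P S K"
  have q: "quotient_map S ?Q ?q" by (rule quotient_map_quotient_topology)
  have tQ: "topspace ?Q = carrier (P Mod K)"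
    using quotient_imp_surjective_map[OF q] by (auto simp: carrier_FactGroup)
  have cf: "continuous_map S R f" using f(1) by (simp add: continuous_hom_def)
  have "quotient_map S R f"
    using cf continuous_imp_closed_map[OF cf P(2) L(2)] f(2)
    by (intro continuous_closed_imp_quotient_map) simp_all
  then have "quotient_map S R (induced_map f \<circ> ?q)"
    by (rule quotient_map_eq) (simp add: ind)
  then have "quotient_map ?Q R (induced_map f)"
    using quotient_map_compose_eq[OF q] by blast
  moreover have "inj_on (induced_map f) (topspace ?Q)"
    using iso tQ by (simp add: iso_def bij_betw_def)
  ultimately show "topological_iso (P Mod K) ?Q L R (induced_map f)"
    using iso by (simp add: topological_iso_def homeomorphic_map_def)
qed

text \<open>
  The action is conjugation in \<open>P\<close>, transported along the isomorphism \<open>a\<close> from \<open>Q\<close> onto the normal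
  subgroup \<open>A\<close> and the isomorphism \<open>b\<close> from \<open>R\<close> onto its complement \<open>B\<close>.
\<close>

lemma semidirect_product_of_complements:
  assumes P: "topological_group P S" "Hausdorff_space S"
    and A: "A \<lhd> P" and B: "subgroup B P" and AB: "A <#>\<^bsub>P\<^esub> B = carrier P" "A \<inter> B = {\<one>\<^bsub>P\<^esub>}"
    and Q: "compact_space TQ" "group Q" "topspace TQ = carrier Q"
    and R: "compact_space TR" "group R" "topspace TR = carrier R"
    and a: "topological_iso Q TQ (subgrp P A) (subtopology S A) a"
    and b: "topological_iso R TR (subgrp P B) (subtopology S B) b"
  obtains \<Phi> where "continuous_action_by_automorphisms R TR Q TQ \<Phi>"
    "\<And>y C. y \<in> carrier R \<Longrightarrow> C \<in> carrier Q \<Longrightarrow> \<Phi> y C \<in> carrier Q"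
    "\<And>y C. y \<in> carrier R \<Longrightarrow> C \<in> carrier Q \<Longrightarrow>
      a (\<Phi> y C) = b y \<otimes>\<^bsub>P\<^esub> a C \<otimes>\<^bsub>P\<^esub> inv\<^bsub>P\<^esub> (b y)"
    "topological_iso (semidirect_product Q R \<Phi>) (prod_topology TQ TR) P S
      (\<lambda>(C, y). a C \<otimes>\<^bsub>P\<^esub> b y)"
proof -
  interpret P: topological_grp P S by (rule topological_grpI) fact
  interpret Q: group Q by fact
  interpret R: group R by fact
  interpret A: normal A P by fact
  have aiso: "a \<in> iso Q (subgrp P A)" and ahom: "homeomorphic_map TQ (subtopology S A) a"
    using a by (auto simp: topological_iso_def)
  have biso: "b \<in> iso R (subgrp P B)" and bhom: "homeomorphic_map TR (subtopology S B) b"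
    using b by (auto simp: topological_iso_def)
  have ac: "a C \<in> A" if "C \<in> carrier Q" for C using aiso that by (auto simp: iso_def hom_def)
  have bc: "b y \<in> B" if "y \<in> carrier R" for y using biso that by (auto simp: iso_def hom_def)
  have AP: "x \<in> carrier P" if "x \<in> A" for x using that A.subset by blast
  have BP: "x \<in> carrier P" if "x \<in> B" for x using that subgroup.subset[OF B] by blast
  have am: "a (C \<otimes>\<^bsub>Q\<^esub> C') = a C \<otimes>\<^bsub>P\<^esub> a C'" if "C \<in> carrier Q" "C' \<in> carrier Q" for C C'
    using aiso that by (auto simp: iso_def hom_def)
  have bm: "b (y \<otimes>\<^bsub>R\<^esub> y') = b y \<otimes>\<^bsub>P\<^esub> b y'" if "y \<in> carrier R" "y' \<in> carrier R" for y y'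
    using biso that by (auto simp: iso_def hom_def)
  have ainj: "C = C'" if "a C = a C'" "C \<in> carrier Q" "C' \<in> carrier Q" for C C'
    using aiso that by (auto simp: iso_def bij_betw_def inj_on_def)
  have binj: "y = y'" if "b y = b y'" "y \<in> carrier R" "y' \<in> carrier R" for y y'
    using biso that by (auto simp: iso_def bij_betw_def inj_on_def)
  have aimg: "a ` carrier Q = A" and bimg: "b ` carrier R = B"
    using aiso biso by (auto simp: iso_def bij_betw_def)
  have acont: "continuous_map TQ S a" and bcont: "continuous_map TR S b"
    using homeomorphic_imp_continuous_map[OF ahom] homeomorphic_imp_continuous_map[OF bhom]
    by (auto simp: continuous_map_in_subtopology)
  obtain a' where "homeomorphic_maps TQ (subtopology S A) a a'"
    using ahom by (auto simp: homeomorphic_map_maps)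
  then have a'cont: "continuous_map (subtopology S A) TQ a'"
    and aa': "\<And>x. x \<in> A \<Longrightarrow> a (a' x) = x" and a'a: "\<And>C. C \<in> carrier Q \<Longrightarrow> a' (a C) = C"
    using AP Q(3) by (auto simp: homeomorphic_maps_def)
  have a'c: "a' x \<in> carrier Q" if "x \<in> A" for x using that aimg a'a by force
  \<comment> \<open>The restriction to the carrier makes \<open>\<Phi> y\<close> an extensional map, as \<open>AutoGroup\<close> requires.\<close>
  define \<Phi> where "\<Phi> y = (\<lambda>C \<in> carrier Q. a' (b y \<otimes>\<^bsub>P\<^esub> a C \<otimes>\<^bsub>P\<^esub> inv\<^bsub>P\<^esub> (b y)))" for y
  have conj: "b y \<otimes>\<^bsub>P\<^esub> a C \<otimes>\<^bsub>P\<^esub> inv\<^bsub>P\<^esub> (b y) \<in> A" if "y \<in> carrier R" "C \<in> carrier Q" for y C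
    using that ac bc BP by (intro A.inv_op_closed2) auto
  have \<Phi>c: "\<Phi> y C \<in> carrier Q" if "y \<in> carrier R" "C \<in> carrier Q" for y C
    using that conj a'c by (simp add: \<Phi>_def)
  have a\<Phi>: "a (\<Phi> y C) = b y \<otimes>\<^bsub>P\<^esub> a C \<otimes>\<^bsub>P\<^esub> inv\<^bsub>P\<^esub> (b y)"
    if "y \<in> carrier R" "C \<in> carrier Q" for y C
    using that conj aa' by (simp add: \<Phi>_def)
  have \<Phi>m: "\<Phi> y (C \<otimes>\<^bsub>Q\<^esub> C') = \<Phi> y C \<otimes>\<^bsub>Q\<^esub> \<Phi> y C'"
    if "y \<in> carrier R" "C \<in> carrier Q" "C' \<in> carrier Q" for y C C'
  proof (rule ainj)
    have c: "b y \<in> carrier P" "a C \<in> carrier P" "a C' \<in> carrier P"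
      using that bc ac AP BP by auto
    have "inv\<^bsub>P\<^esub> (b y) \<otimes>\<^bsub>P\<^esub> (b y \<otimes>\<^bsub>P\<^esub> (a C' \<otimes>\<^bsub>P\<^esub> inv\<^bsub>P\<^esub> (b y))) = a C' \<otimes>\<^bsub>P\<^esub> inv\<^bsub>P\<^esub> (b y)"
      using c by (simp flip: P.m_assoc)
    then show "a (\<Phi> y (C \<otimes>\<^bsub>Q\<^esub> C')) = a (\<Phi> y C \<otimes>\<^bsub>Q\<^esub> \<Phi> y C')"
      using that c by (simp add: a\<Phi> am \<Phi>c P.m_assoc)
  qed (use that \<Phi>c in auto)
  have \<Phi>\<Phi>: "\<Phi> (y \<otimes>\<^bsub>R\<^esub> y') C = \<Phi> y (\<Phi> y' C)"
    if "y \<in> carrier R" "y' \<in> carrier R" "C \<in> carrier Q" for y y' C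
  proof (rule ainj)
    have c: "b y \<in> carrier P" "b y' \<in> carrier P" "a C \<in> carrier P"
      using that bc ac AP BP by auto
    show "a (\<Phi> (y \<otimes>\<^bsub>R\<^esub> y') C) = a (\<Phi> y (\<Phi> y' C))"
      using that c by (simp add: a\<Phi> bm \<Phi>c P.m_assoc P.inv_mult_group)
  qed (use that \<Phi>c in auto)
  have \<Phi>1: "\<Phi> \<one>\<^bsub>R\<^esub> C = C" if "C \<in> carrier Q" for C
  proof (rule ainj)
    have "b \<one>\<^bsub>R\<^esub> \<otimes>\<^bsub>P\<^esub> b \<one>\<^bsub>R\<^esub> = b \<one>\<^bsub>R\<^esub>" using bm[of "\<one>\<^bsub>R\<^esub>" "\<one>\<^bsub>R\<^esub>"] by simp
    then have "b \<one>\<^bsub>R\<^esub> = \<one>\<^bsub>P\<^esub>" using bc[OF R.one_closed] BP by simp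
    then show "a (\<Phi> \<one>\<^bsub>R\<^esub> C) = a C" using that ac AP by (simp add: a\<Phi>)
  qed (use that \<Phi>c in auto)
  have \<Phi>auto: "\<Phi> y \<in> auto Q" if y: "y \<in> carrier R" for y
  proof -
    have "bij_betw (\<Phi> y) (carrier Q) (carrier Q)"
      by (rule bij_betw_byWitness[where f' = "\<Phi> (inv\<^bsub>R\<^esub> y)"])
        (use y \<Phi>c \<Phi>1 in \<open>auto simp flip: \<Phi>\<Phi>\<close>)
    then show ?thesis
      using y \<Phi>c \<Phi>m by (auto simp: auto_def Bij_def hom_def \<Phi>_def)
  qed
  have "\<Phi> \<in> hom R (AutoGroup Q)"
  proof (rule homI)
    fix y y' assume y: "y \<in> carrier R" "y' \<in> carrier R"
    show "\<Phi> y \<in> carrier (AutoGroup Q)" using \<Phi>auto y by (simp add: AutoGroup_def)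
    have "\<Phi> (y \<otimes>\<^bsub>R\<^esub> y') C = compose (carrier Q) (\<Phi> y) (\<Phi> y') C" for C
      by (cases "C \<in> carrier Q") (use y in \<open>auto simp: \<Phi>\<Phi> compose_def\<close>, simp add: \<Phi>_def)
    then show "\<Phi> (y \<otimes>\<^bsub>R\<^esub> y') = \<Phi> y \<otimes>\<^bsub>AutoGroup Q\<^esub> \<Phi> y'"
      using \<Phi>auto[OF y(1)] \<Phi>auto[OF y(2)] by (auto simp: AutoGroup_def BijGroup_def auto_def)
  qed
  moreover have "continuous_map (prod_topology TR TQ) TQ (\<lambda>(y, C). \<Phi> y C)"
  proof -
    let ?X = "prod_topology TR TQ"
    have "continuous_map ?X S (\<lambda>p. b (fst p))" "continuous_map ?X S (\<lambda>p. a (snd p))"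
      using continuous_map_compose[OF continuous_map_fst bcont]
        continuous_map_compose[OF continuous_map_snd acont] by (simp_all add: o_def)
    then have "continuous_map ?X S (\<lambda>p. b (fst p) \<otimes>\<^bsub>P\<^esub> a (snd p) \<otimes>\<^bsub>P\<^esub> inv\<^bsub>P\<^esub> (b (fst p)))"
      by (rule P.continuous_map_conj)
    then have "continuous_map ?X (subtopology S A)
        (\<lambda>p. b (fst p) \<otimes>\<^bsub>P\<^esub> a (snd p) \<otimes>\<^bsub>P\<^esub> inv\<^bsub>P\<^esub> (b (fst p)))"
      using conj by (auto simp: continuous_map_in_subtopology Q(3) R(3))
    from continuous_map_compose[OF this a'cont] show ?thesis
      by (rule continuous_map_eq) (auto simp: \<Phi>_def Q(3) R(3))
  qed
  ultimately have act: "continuous_action_by_automorphisms R TR Q TQ \<Phi>"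
    by (simp add: continuous_action_by_automorphisms_def)
  let ?m = "\<lambda>(C, y). a C \<otimes>\<^bsub>P\<^esub> b y"
  let ?X = "prod_topology TQ TR"
  have img: "?m ` (carrier Q \<times> carrier R) = carrier P"
  proof -
    have "?m ` (carrier Q \<times> carrier R) = A <#>\<^bsub>P\<^esub> B"
      unfolding set_mult_def aimg[symmetric] bimg[symmetric] by auto
    then show ?thesis by (simp add: AB)
  qed
  have inj: "inj_on ?m (carrier Q \<times> carrier R)"
  proof (rule inj_onI, clarsimp)
    fix C y C' y' assume *: "C \<in> carrier Q" "y \<in> carrier R" "C' \<in> carrier Q" "y' \<in> carrier R"
      "a C \<otimes>\<^bsub>P\<^esub> b y = a C' \<otimes>\<^bsub>P\<^esub> b y'"
    have c: "a C \<in> carrier P" "a C' \<in> carrier P" "b y \<in> carrier P" "b y' \<in> carrier P"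
      using * ac bc AP BP by auto
    have eq: "inv\<^bsub>P\<^esub> (a C') \<otimes>\<^bsub>P\<^esub> a C = b y' \<otimes>\<^bsub>P\<^esub> inv\<^bsub>P\<^esub> (b y)"
      using c *(5) by (metis P.inv_closed P.inv_solve_left P.inv_solve_right P.m_assoc P.m_closed)
    have "inv\<^bsub>P\<^esub> (a C') \<otimes>\<^bsub>P\<^esub> a C \<in> A" using ac * by (simp add: A.m_closed)
    moreover have "b y' \<otimes>\<^bsub>P\<^esub> inv\<^bsub>P\<^esub> (b y) \<in> B"
      using bc * by (simp add: subgroup.m_closed[OF B] subgroup.m_inv_closed[OF B])
    ultimately have "inv\<^bsub>P\<^esub> (a C') \<otimes>\<^bsub>P\<^esub> a C = \<one>\<^bsub>P\<^esub>" "b y' \<otimes>\<^bsub>P\<^esub> inv\<^bsub>P\<^esub> (b y) = \<one>\<^bsub>P\<^esub>"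
      using eq AB(2) by auto
    then have "a C = a C'" "b y = b y'"
      using c by (metis P.inv_closed P.inv_equality P.inv_inv)+
    then show "C = C' \<and> y = y'" using * ainj binj by blast
  qed
  have hom: "?m \<in> hom (semidirect_product Q R \<Phi>) P"
  proof (rule homI)
    fix p p' assume "p \<in> carrier (semidirect_product Q R \<Phi>)" "p' \<in> carrier (semidirect_product Q R \<Phi>)"
    then obtain C y C' y' where p: "p = (C, y)" "p' = (C', y')"
      and *: "C \<in> carrier Q" "y \<in> carrier R" "C' \<in> carrier Q" "y' \<in> carrier R"
      by (auto simp: semidirect_product_def)
    have c: "a C \<in> carrier P" "a C' \<in> carrier P" "b y \<in> carrier P" "b y' \<in> carrier P"
      using * ac bc AP BP by auto
    have "inv\<^bsub>P\<^esub> (b y) \<otimes>\<^bsub>P\<^esub> (b y \<otimes>\<^bsub>P\<^esub> b y') = b y'"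
      using c by (simp flip: P.m_assoc)
    then show "?m (p \<otimes>\<^bsub>semidirect_product Q R \<Phi>\<^esub> p') = ?m p \<otimes>\<^bsub>P\<^esub> ?m p'"
      using * c by (simp add: p semidirect_product_def am bm a\<Phi> \<Phi>c P.m_assoc)
  next
    fix p assume "p \<in> carrier (semidirect_product Q R \<Phi>)"
    then show "?m p \<in> carrier P" using ac bc AP BP by (auto simp: semidirect_product_def)
  qed
  have "continuous_map ?X S ?m"
  proof -
    have "continuous_map ?X S (\<lambda>p. a (fst p))" "continuous_map ?X S (\<lambda>p. b (snd p))"
      using continuous_map_compose[OF continuous_map_fst acont]
        continuous_map_compose[OF continuous_map_snd bcont] by (simp_all add: o_def)
    from P.continuous_map_mult[OF this] show ?thesis by (simp add: case_prod_unfold)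
  qed
  then have "homeomorphic_map ?X S ?m"
    using Q(1,3) R(1,3) P(2) img inj
    by (intro continuous_imp_homeomorphic_map) (simp_all add: compact_space_prod_topology)
  moreover have "?m \<in> iso (semidirect_product Q R \<Phi>) P"
    using hom img inj by (simp add: iso_def bij_betw_def semidirect_product_def)
  ultimately have "topological_iso (semidirect_product Q R \<Phi>) ?X P S ?m"
    by (simp add: topological_iso_def)
  with act \<Phi>c a\<Phi> that show thesis by blast
qed

section \<open>Compressing a unitary representation to an invariant subspace\<close>

lemma mat_adjoint_carrier [simp]: "A \<in> carrier_mat n m \<Longrightarrow> mat_adjoint A \<in> carrier_mat m n"
  by (auto simp: mat_adjoint_def)

lemma mat_adjoint_index:
  assumes "A \<in> carrier_mat n m" "i < m" "j < n"
  shows "mat_adjoint A $$ (i, j) = cnj (A $$ (j, i))"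
  using assms by (auto simp: mat_adjoint_def mat_of_rows_def)

lemma mat_mult_index:
  assumes "A \<in> carrier_mat n m" "B \<in> carrier_mat m k" "i < n" "j < k"
  shows "(A * B) $$ (i, j) = (\<Sum>r<m. A $$ (i, r) * B $$ (r, j))"
  using assms by (auto simp: scalar_prod_def atLeast0LessThan)

lemma mat_vec_index:
  assumes "A \<in> carrier_mat n m" "v \<in> carrier_vec m" "i < n"
  shows "(A *\<^sub>v v) $ i = (\<Sum>r<m. A $$ (i, r) * v $ r)"
  using assms by (auto simp: scalar_prod_def atLeast0LessThan)

lemma mat_adjoint_mult:
  fixes A :: "complex mat"
  assumes A: "A \<in> carrier_mat n m" and B: "B \<in> carrier_mat m k"
  shows "mat_adjoint (A * B) = mat_adjoint B * mat_adjoint A"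
proof (rule eq_matI)
  have AB: "A * B \<in> carrier_mat n k" using A B by simp
  show "dim_row (mat_adjoint (A * B)) = dim_row (mat_adjoint B * mat_adjoint A)"
    "dim_col (mat_adjoint (A * B)) = dim_col (mat_adjoint B * mat_adjoint A)"
    using A B by (auto simp: mat_adjoint_def)
  fix i j assume "i < dim_row (mat_adjoint B * mat_adjoint A)"
    "j < dim_col (mat_adjoint B * mat_adjoint A)"
  then have ij: "i < k" "j < n" using A B by (auto simp: mat_adjoint_def)
  have "mat_adjoint (A * B) $$ (i, j) = cnj (\<Sum>r<m. A $$ (j, r) * B $$ (r, i))"
    by (simp only: mat_adjoint_index[OF AB ij] mat_mult_index[OF A B ij(2) ij(1)])
  also have "\<dots> = (\<Sum>r<m. mat_adjoint B $$ (i, r) * mat_adjoint A $$ (r, j))"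
    using ij by (simp add: mat_adjoint_index[OF A] mat_adjoint_index[OF B] mult.commute)
  also have "\<dots> = (mat_adjoint B * mat_adjoint A) $$ (i, j)"
    by (rule mat_mult_index[symmetric]) (use A B ij in auto)
  finally show "mat_adjoint (A * B) $$ (i, j) = (mat_adjoint B * mat_adjoint A) $$ (i, j)" .
qed

lemma mat_adjoint_adjoint:
  fixes A :: "complex mat"
  assumes A: "A \<in> carrier_mat n m"
  shows "mat_adjoint (mat_adjoint A) = A"
proof (rule eq_matI)
  fix i j assume "i < dim_row A" "j < dim_col A"
  then show "mat_adjoint (mat_adjoint A) $$ (i, j) = A $$ (i, j)"
    using A by (simp add: mat_adjoint_index[OF mat_adjoint_carrier[OF A]] mat_adjoint_index[OF A])
qed (use A in \<open>auto simp: mat_adjoint_def\<close>)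

lemma mat_adjoint_one: "mat_adjoint (1\<^sub>m n :: complex mat) = 1\<^sub>m n"
  by (rule eq_matI)
    (auto simp: mat_adjoint_index[of _ n n] simp: mat_adjoint_def mat_of_rows_def)

lemma cscalar_prod_mat_adjoint:
  fixes A :: "complex mat"
  assumes A: "A \<in> carrier_mat n m" and v: "v \<in> carrier_vec m" and w: "w \<in> carrier_vec n"
  shows "(A *\<^sub>v v) \<bullet>c w = v \<bullet>c (mat_adjoint A *\<^sub>v w)"
proof -
  have "(A *\<^sub>v v) \<bullet>c w = (\<Sum>i<n. (\<Sum>j<m. A $$ (i, j) * v $ j) * cnj (w $ i))"
    using A v w by (simp add: scalar_prod_def atLeast0LessThan)
  also have "\<dots> = (\<Sum>i<n. \<Sum>j<m. A $$ (i, j) * v $ j * cnj (w $ i))"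
    by (simp add: sum_distrib_right)
  also have "\<dots> = (\<Sum>j<m. \<Sum>i<n. A $$ (i, j) * v $ j * cnj (w $ i))"
    by (rule sum.swap)
  also have "\<dots> = (\<Sum>j<m. v $ j * cnj (\<Sum>i<n. mat_adjoint A $$ (j, i) * w $ i))"
    by (simp add: mat_adjoint_index[OF A] sum_distrib_left ac_simps)
  also have "\<dots> = (\<Sum>j<m. v $ j * cnj ((mat_adjoint A *\<^sub>v w) $ j))"
    using mat_vec_index[OF mat_adjoint_carrier[OF A] w] by simp
  also have "\<dots> = v \<bullet>c (mat_adjoint A *\<^sub>v w)"
    using A v w by (simp add: scalar_prod_def atLeast0LessThan mat_adjoint_def)
  finally show ?thesis .
qed

lemma mat_eq_if_mult_vec_eq:
  fixes A B :: "'a::comm_ring_1 mat"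
  assumes A: "A \<in> carrier_mat n m" and B: "B \<in> carrier_mat n m"
    and eq: "\<And>v. v \<in> carrier_vec m \<Longrightarrow> A *\<^sub>v v = B *\<^sub>v v"
  shows "A = B"
proof (rule eq_matI)
  fix i j assume "i < dim_row B" "j < dim_col B"
  then have ij: "i < n" "j < m" using B by auto
  have "(C *\<^sub>v unit_vec m j) $ i = C $$ (i, j)" if "C \<in> carrier_mat n m" for C :: "'a mat"
    using that ij by simp
  then show "A $$ (i, j) = B $$ (i, j)" using eq[of "unit_vec m j"] A B by (metis unit_vec_carrier)
qed (use A B in auto)

text \<open>
  Padding \<open>B\<close> with zero rows would otherwise give a square matrix with a left inverse but with a
  zero row.
\<close>

lemma isometry_columns_le:
  fixes B :: "complex mat"
  assumes B: "B \<in> carrier_mat n k" and iso: "mat_adjoint B * B = 1\<^sub>m k"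
  shows "k \<le> n"
proof (rule ccontr)
  assume "\<not> k \<le> n"
  then have nk: "n < k" by simp
  define S where "S = mat k k (\<lambda>(i, j). if i < n then B $$ (i, j) else 0)"
  have S: "S \<in> carrier_mat k k" by (simp add: S_def)
  have "mat_adjoint S * S = 1\<^sub>m k"
  proof (rule eq_matI)
    fix i j assume "i < dim_row (1\<^sub>m k :: complex mat)" "j < dim_col (1\<^sub>m k :: complex mat)"
    then have ij: "i < k" "j < k" by auto
    have "(mat_adjoint S * S) $$ (i, j) = (\<Sum>r<k. cnj (S $$ (r, i)) * S $$ (r, j))"
      using ij by (simp add: mat_mult_index[OF mat_adjoint_carrier[OF S] S ij] mat_adjoint_index[OF S])
    also have "\<dots> = (\<Sum>r<n. cnj (B $$ (r, i)) * B $$ (r, j))"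
      using ij nk by (intro sum.mono_neutral_cong_right) (auto simp: S_def)
    also have "\<dots> = (mat_adjoint B * B) $$ (i, j)"
      using ij by (simp add: mat_mult_index[OF mat_adjoint_carrier[OF B] B ij] mat_adjoint_index[OF B])
    finally show "(mat_adjoint S * S) $$ (i, j) = 1\<^sub>m k $$ (i, j)" by (simp add: iso)
  qed (use S in \<open>auto simp: mat_adjoint_def\<close>)
  then have "S * mat_adjoint S = 1\<^sub>m k"
    using mat_mult_left_right_inverse[OF mat_adjoint_carrier[OF S] S] by simp
  then have "(S * mat_adjoint S) $$ (n, n) = 1" using nk by simp
  moreover have "(S * mat_adjoint S) $$ (n, n) = 0"
    unfolding mat_mult_index[OF S mat_adjoint_carrier[OF S] nk nk]
    using nk by (intro sum.neutral) (simp add: S_def)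
  ultimately show False by simp
qed

text \<open>
  One step of the Gram-Schmidt process: the normalised vector \<open>v\<close> becomes the last column.
\<close>

lemma isometry_append:
  fixes B :: "complex mat"
  assumes B: "B \<in> carrier_mat n k" and iso: "mat_adjoint B * B = 1\<^sub>m k"
    and v: "v \<in> carrier_vec n" "v \<noteq> 0\<^sub>v n" and orth: "mat_adjoint B *\<^sub>v v = 0\<^sub>v k"
  obtains B' c where "B' \<in> carrier_mat n (Suc k)" "mat_adjoint B' * B' = 1\<^sub>m (Suc k)"
    "\<And>x. x \<in> carrier_vec (Suc k) \<Longrightarrow>
      B' *\<^sub>v x = B *\<^sub>v vec k (\<lambda>i. x $ i) + (x $ k * c) \<cdot>\<^sub>v v"
proof -
  define s where "s = (\<Sum>r<n. (cmod (v $ r))\<^sup>2)"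
  have "s \<noteq> 0"
  proof
    assume "s = 0"
    then have "\<forall>r\<in>{..<n}. (cmod (v $ r))\<^sup>2 = 0"
      unfolding s_def by (subst (asm) sum_nonneg_eq_0_iff) auto
    then have "v = 0\<^sub>v n" using v(1) by (intro eq_vecI) auto
    with v(2) show False by simp
  qed
  moreover have "s \<ge> 0" unfolding s_def by (simp add: sum_nonneg)
  ultimately have s: "s > 0" by simp
  define c where "c = complex_of_real (1 / sqrt s)"
  have c: "cnj c * c * of_real s = 1"
    using s by (simp add: c_def flip: of_real_mult)
  define B' where "B' = mat n (Suc k) (\<lambda>(i, j). if j < k then B $$ (i, j) else c * v $ i)"
  have B': "B' \<in> carrier_mat n (Suc k)" by (simp add: B'_def)
  have o: "(\<Sum>r<n. cnj (B $$ (r, i)) * v $ r) = 0" if i: "i < k" for i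
  proof -
    have "(mat_adjoint B *\<^sub>v v) $ i = (\<Sum>r<n. cnj (B $$ (r, i)) * v $ r)"
      using i by (simp add: mat_vec_index[OF mat_adjoint_carrier[OF B] v(1) i] mat_adjoint_index[OF B])
    then show ?thesis using orth i by simp
  qed
  have o': "(\<Sum>r<n. cnj (v $ r) * B $$ (r, i)) = 0" if i: "i < k" for i
  proof -
    have "(\<Sum>r<n. cnj (v $ r) * B $$ (r, i)) = cnj (\<Sum>r<n. cnj (B $$ (r, i)) * v $ r)"
      by (simp add: mult.commute)
    then show ?thesis using o[OF i] by simp
  qed
  have "mat_adjoint B' * B' = 1\<^sub>m (Suc k)"
  proof (rule eq_matI)
    fix i j assume "i < dim_row (1\<^sub>m (Suc k) :: complex mat)" "j < dim_col (1\<^sub>m (Suc k) :: complex mat)"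
    then have ij: "i < Suc k" "j < Suc k" by auto
    have "(mat_adjoint B' * B') $$ (i, j) = (\<Sum>r<n. cnj (B' $$ (r, i)) * B' $$ (r, j))"
      using ij by (simp add: mat_mult_index[OF mat_adjoint_carrier[OF B'] B' ij] mat_adjoint_index[OF B'])
    also have "\<dots> = 1\<^sub>m (Suc k) $$ (i, j)"
    proof (cases "i < k")
      case i: True
      show ?thesis
      proof (cases "j < k")
        case j: True
        have "(\<Sum>r<n. cnj (B' $$ (r, i)) * B' $$ (r, j)) = (mat_adjoint B * B) $$ (i, j)"
          using i j by (simp add: mat_mult_index[OF mat_adjoint_carrier[OF B] B] mat_adjoint_index[OF B] B'_def)
        then show ?thesis using i j by (simp add: iso)
      next
        case False
        have "(\<Sum>r<n. cnj (B' $$ (r, i)) * B' $$ (r, j)) = c * (\<Sum>r<n. cnj (B $$ (r, i)) * v $ r)"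
          using i ij False by (simp add: B'_def sum_distrib_left ac_simps)
        then show ?thesis using o[OF i] i ij False by simp
      qed
    next
      case i: False
      show ?thesis
      proof (cases "j < k")
        case j: True
        have "(\<Sum>r<n. cnj (B' $$ (r, i)) * B' $$ (r, j)) = cnj c * (\<Sum>r<n. cnj (v $ r) * B $$ (r, j))"
          using i ij j by (simp add: B'_def sum_distrib_left ac_simps)
        then show ?thesis using o'[OF j] i ij j by simp
      next
        case False
        have "(\<Sum>r<n. cnj (B' $$ (r, i)) * B' $$ (r, j))
            = cnj c * c * (\<Sum>r<n. v $ r * cnj (v $ r))"
          using i ij False by (simp add: B'_def sum_distrib_left ac_simps)
        also have "(\<Sum>r<n. v $ r * cnj (v $ r)) = of_real s"
          by (simp add: s_def complex_norm_square[symmetric])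
        finally show ?thesis using c i ij False by simp
      qed
    qed
    finally show "(mat_adjoint B' * B') $$ (i, j) = 1\<^sub>m (Suc k) $$ (i, j)" .
  qed (use B' in \<open>auto simp: mat_adjoint_def\<close>)
  moreover have "B' *\<^sub>v x = B *\<^sub>v vec k (\<lambda>i. x $ i) + (x $ k * c) \<cdot>\<^sub>v v"
    if x: "x \<in> carrier_vec (Suc k)" for x
  proof (rule eq_vecI)
    fix i assume "i < dim_vec (B *\<^sub>v vec k (\<lambda>i. x $ i) + (x $ k * c) \<cdot>\<^sub>v v)"
    then have i: "i < n" using v by simp
    have "(B' *\<^sub>v x) $ i = (\<Sum>r<Suc k. B' $$ (i, r) * x $ r)"
      by (rule mat_vec_index[OF B' x i])
    also have "\<dots> = (\<Sum>r<k. B $$ (i, r) * x $ r) + c * v $ i * x $ k"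
      using i by (simp add: B'_def)
    also have "(\<Sum>r<k. B $$ (i, r) * x $ r) = (B *\<^sub>v vec k (\<lambda>i. x $ i)) $ i"
      by (subst mat_vec_index[OF B _ i]) auto
    finally show "(B' *\<^sub>v x) $ i = (B *\<^sub>v vec k (\<lambda>i. x $ i) + (x $ k * c) \<cdot>\<^sub>v v) $ i"
      using i v B by simp
  qed (use B' B v in auto)
  ultimately show thesis using B' that by blast
qed

text \<open>
  Every subspace has an orthonormal basis, written as the columns of \<open>B\<close>: take an isometry into \<open>W\<close>
  with as many columns as possible. If \<open>w \<in> W\<close> were not in its range, the component of \<open>w\<close> orthogonal
  to the range would provide a further column.
\<close>

lemma isometry_onto_subspace:
  fixes W :: "complex vec set"
  assumes W: "W \<subseteq> carrier_vec n" "0\<^sub>v n \<in> W" "\<And>v w. v \<in> W \<Longrightarrow> w \<in> W \<Longrightarrow> v + w \<in> W"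
    "\<And>c v. v \<in> W \<Longrightarrow> c \<cdot>\<^sub>v v \<in> W"
  obtains k B where "k \<le> n" "B \<in> carrier_mat n k" "mat_adjoint B * B = 1\<^sub>m k"
    "\<And>x. x \<in> carrier_vec k \<Longrightarrow> B *\<^sub>v x \<in> W"
    "\<And>w. w \<in> W \<Longrightarrow> B *\<^sub>v (mat_adjoint B *\<^sub>v w) = w"
proof -
  define P where "P k \<longleftrightarrow> (\<exists>B \<in> carrier_mat n k. mat_adjoint B * B = 1\<^sub>m k \<and>
    (\<forall>x \<in> carrier_vec k. B *\<^sub>v x \<in> W))" for k
  have P0: "P 0"
  proof -
    have "mat n 0 f *\<^sub>v x = 0\<^sub>v n" if "x \<in> carrier_vec 0" for f :: "nat \<times> nat \<Rightarrow> complex" and x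
      using that by (intro eq_vecI) (auto simp: scalar_prod_def)
    moreover have "mat_adjoint (mat n 0 f) * mat n 0 f = 1\<^sub>m 0" for f :: "nat \<times> nat \<Rightarrow> complex"
      by (rule eq_matI) (auto simp: mat_adjoint_def)
    ultimately show ?thesis unfolding P_def using W(2)
      by (intro bexI[of _ "mat n 0 (\<lambda>_. 0)"]) auto
  qed
  have bound: "k \<le> n" if "P k" for k
    using that isometry_columns_le unfolding P_def by blast
  define k where "k = (GREATEST k. P k)"
  have Pk: "P k" unfolding k_def by (rule GreatestI_nat[where P = P, OF P0 bound])
  have max: "l \<le> k" if "P l" for l
    unfolding k_def by (rule Greatest_le_nat[where P = P, OF that bound])
  obtain B where B: "B \<in> carrier_mat n k" "mat_adjoint B * B = 1\<^sub>m k"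
      "\<And>x. x \<in> carrier_vec k \<Longrightarrow> B *\<^sub>v x \<in> W"
    using Pk unfolding P_def by blast
  have Ba: "mat_adjoint B \<in> carrier_mat k n" using B(1) by simp
  have "B *\<^sub>v (mat_adjoint B *\<^sub>v w) = w" if w: "w \<in> W" for w
  proof (rule ccontr)
    assume ne: "B *\<^sub>v (mat_adjoint B *\<^sub>v w) \<noteq> w"
    have wc: "w \<in> carrier_vec n" using w W(1) by blast
    define p where "p = B *\<^sub>v (mat_adjoint B *\<^sub>v w)"
    have pW: "p \<in> W" unfolding p_def by (rule B(3)) (use Ba wc in auto)
    have pc: "p \<in> carrier_vec n" using pW W(1) by blast
    define v where "v = w + (- 1) \<cdot>\<^sub>v p"
    have vW: "v \<in> W" unfolding v_def by (intro W(3,4) w pW)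
    have vc: "v \<in> carrier_vec n" using vW W(1) by blast
    have v0: "v \<noteq> 0\<^sub>v n"
    proof
      assume "v = 0\<^sub>v n"
      then have "w $ i - p $ i = 0" if "i < n" for i
        using that wc pc by (metis (no_types, lifting) v_def index_add_vec(1) index_smult_vec(1)
            index_zero_vec(1) carrier_vecD smult_carrier_vec mult_minus1 uminus_add_conv_diff add.commute)
      then have "p = w" using wc pc by (intro eq_vecI) auto
      then show False using ne p_def by simp
    qed
    have "mat_adjoint B *\<^sub>v p = mat_adjoint B *\<^sub>v w"
      unfolding p_def using B(2) Ba B(1) wc
      by (metis assoc_mult_mat_vec mult_mat_vec_carrier one_mult_mat_vec)
    moreover have "mat_adjoint B *\<^sub>v v = mat_adjoint B *\<^sub>v w + (- 1) \<cdot>\<^sub>v (mat_adjoint B *\<^sub>v p)"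
      unfolding v_def using Ba wc pc
      by (simp add: mult_add_distrib_mat_vec mult_mat_vec del: mult_minus1)
    ultimately have "mat_adjoint B *\<^sub>v v = 0\<^sub>v k"
      using Ba wc by (intro eq_vecI) auto
    then obtain B' c where B': "B' \<in> carrier_mat n (Suc k)" "mat_adjoint B' * B' = 1\<^sub>m (Suc k)"
      "\<And>x. x \<in> carrier_vec (Suc k) \<Longrightarrow>
        B' *\<^sub>v x = B *\<^sub>v vec k (\<lambda>i. x $ i) + (x $ k * c) \<cdot>\<^sub>v v"
      using isometry_append[OF B(1,2) vc v0] by blast
    have "P (Suc k)"
      unfolding P_def using B'(1,2) by (intro bexI[of _ B']) (auto simp: B'(3) intro!: W(3,4) B(3) vW)
    then show False using max by fastforce
  qed
  with B bound[OF Pk] that show thesis by blast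
qed

lemma unitary_groupI:
  assumes "A \<in> carrier_mat n n" "mat_adjoint A * A = 1\<^sub>m n"
  shows "A \<in> carrier (unitary_group n)"
  using assms mat_mult_left_right_inverse[OF mat_adjoint_carrier[OF assms(1)] assms(1,2)]
  by (simp add: unitary_group_def)

lemma unitary_groupD:
  assumes "A \<in> carrier (unitary_group n)"
  shows "A \<in> carrier_mat n n" "mat_adjoint A * A = 1\<^sub>m n" "A * mat_adjoint A = 1\<^sub>m n"
  using assms by (auto simp: unitary_group_def)

lemma unitary_group_simps [simp]:
  "A \<otimes>\<^bsub>unitary_group n\<^esub> B = A * B" "\<one>\<^bsub>unitary_group n\<^esub> = 1\<^sub>m n"
  by (auto simp: unitary_group_def)

lemma group_unitary_group: "group (unitary_group n)"
proof (rule groupI)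
  fix A B C assume A: "A \<in> carrier (unitary_group n)" and B: "B \<in> carrier (unitary_group n)"
    and C: "C \<in> carrier (unitary_group n)"
  note A = unitary_groupD[OF A] and B = unitary_groupD[OF B] and C = unitary_groupD[OF C]
  have "mat_adjoint (A * B) * (A * B) = mat_adjoint B * (mat_adjoint A * A) * B"
    using A(1) B(1) by (simp add: mat_adjoint_mult[OF A(1) B(1)] mat_adjoint_carrier[OF A(1)]
        mat_adjoint_carrier[OF B(1)] assoc_mult_mat[of _ n n _ n _ n] mult_carrier_mat[of _ n n _ n])
  also have "\<dots> = 1\<^sub>m n"
    using A B by (simp add: right_mult_one_mat[OF mat_adjoint_carrier[OF B(1)]])
  finally show "A \<otimes>\<^bsub>unitary_group n\<^esub> B \<in> carrier (unitary_group n)"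
    using A(1) B(1) by (simp add: unitary_groupI)
  show "A \<otimes>\<^bsub>unitary_group n\<^esub> B \<otimes>\<^bsub>unitary_group n\<^esub> C
      = A \<otimes>\<^bsub>unitary_group n\<^esub> (B \<otimes>\<^bsub>unitary_group n\<^esub> C)"
    using A(1) B(1) C(1) by simp
  show "\<one>\<^bsub>unitary_group n\<^esub> \<otimes>\<^bsub>unitary_group n\<^esub> A = A" using A(1) by simp
  show "\<exists>B\<in>carrier (unitary_group n). B \<otimes>\<^bsub>unitary_group n\<^esub> A = \<one>\<^bsub>unitary_group n\<^esub>"
    using A mat_adjoint_adjoint[OF A(1)]
    by (intro bexI[of _ "mat_adjoint A"]) (auto simp: unitary_group_def mat_adjoint_carrier[OF A(1)])
next
  show "\<one>\<^bsub>unitary_group n\<^esub> \<in> carrier (unitary_group n)"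
    by (simp add: unitary_groupI mat_adjoint_one)
qed

lemma unitary_group_inv:
  assumes "U \<in> carrier (unitary_group n)"
  shows "inv\<^bsub>unitary_group n\<^esub> U = mat_adjoint U" "mat_adjoint U \<in> carrier (unitary_group n)"
proof -
  interpret group "unitary_group n" by (rule group_unitary_group)
  note U = unitary_groupD[OF assms]
  show c: "mat_adjoint U \<in> carrier (unitary_group n)"
    using U mat_adjoint_adjoint[OF U(1)] mat_adjoint_carrier[OF U(1)] by (simp add: unitary_group_def)
  show "inv\<^bsub>unitary_group n\<^esub> U = mat_adjoint U"
    using assms c U(2) by (intro inv_equality) auto
qed

lemma unitary_hom_inv:
  assumes "group F" "\<pi> \<in> hom F (unitary_group n)" "g \<in> carrier F"
  shows "mat_adjoint (\<pi> g) = \<pi> (inv\<^bsub>F\<^esub> g)"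
proof -
  interpret group_hom F "unitary_group n" \<pi>
    using assms group_unitary_group by (simp add: group_hom_def group_hom_axioms_def)
  show ?thesis using assms(3) unitary_group_inv(1)[of "\<pi> g" n] by simp
qed

text \<open>
  The restriction of \<open>\<pi>\<close> to an invariant subspace, in the orthonormal basis given by the columns of \<open>B\<close>;
  the hypothesis \<open>inv\<close> says that the range of \<open>B\<close> is invariant.
\<close>

lemma unitary_hom_compress:
  assumes F: "group F" and \<pi>: "\<pi> \<in> hom F (unitary_group n)"
    and B: "B \<in> carrier_mat n k" "mat_adjoint B * B = 1\<^sub>m k"
    and inv: "\<And>g. g \<in> carrier F \<Longrightarrow> B * (mat_adjoint B * (\<pi> g * B)) = \<pi> g * B"
  shows "(\<lambda>g. mat_adjoint B * (\<pi> g * B)) \<in> hom F (unitary_group k)"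
proof -
  interpret group_hom F "unitary_group n" \<pi>
    using F \<pi> group_unitary_group by (simp add: group_hom_def group_hom_axioms_def)
  let ?\<rho> = "\<lambda>g. mat_adjoint B * (\<pi> g * B)"
  have Ba: "mat_adjoint B \<in> carrier_mat k n" using B(1) by simp
  have \<pi>c: "\<pi> g \<in> carrier_mat n n" if "g \<in> carrier F" for g
    using that hom_closed unitary_groupD(1) by blast
  have \<rho>c: "?\<rho> g \<in> carrier_mat k k" if "g \<in> carrier F" for g
    using that \<pi>c Ba B(1) by (meson mult_carrier_mat)
  have mult: "?\<rho> (g \<otimes>\<^bsub>F\<^esub> h) = ?\<rho> g * ?\<rho> h" if gh: "g \<in> carrier F" "h \<in> carrier F" for g h
  proof -
    note cs = \<pi>c[OF gh(1)] \<pi>c[OF gh(2)] Ba B(1)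
    have "?\<rho> g * ?\<rho> h = mat_adjoint B * (\<pi> g * (B * (mat_adjoint B * (\<pi> h * B))))"
    proof -
      have "?\<rho> g * ?\<rho> h = mat_adjoint B * ((\<pi> g * B) * ?\<rho> h)"
        using cs \<rho>c[OF gh(2)] by (intro assoc_mult_mat[of _ k n _ k _ k]) auto
      also have "(\<pi> g * B) * ?\<rho> h = \<pi> g * (B * ?\<rho> h)"
        using cs \<rho>c[OF gh(2)] by (intro assoc_mult_mat[of _ n n _ k _ k]) auto
      finally show ?thesis .
    qed
    also have "\<dots> = mat_adjoint B * (\<pi> g * (\<pi> h * B))" by (simp only: inv[OF gh(2)])
    also have "\<dots> = mat_adjoint B * ((\<pi> g * \<pi> h) * B)"
      using cs by (simp add: assoc_mult_mat[of _ n n _ n])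
    also have "\<pi> g * \<pi> h = \<pi> (g \<otimes>\<^bsub>F\<^esub> h)" using gh by simp
    finally show ?thesis by simp
  qed
  have one: "?\<rho> \<one>\<^bsub>F\<^esub> = 1\<^sub>m k" using B by simp
  have "?\<rho> g \<in> carrier (unitary_group k)" if g: "g \<in> carrier F" for g
  proof (rule unitary_groupI[OF \<rho>c[OF g]])
    note cs = \<pi>c[OF g] Ba B(1)
    have "mat_adjoint (?\<rho> g) = mat_adjoint (\<pi> g * B) * mat_adjoint (mat_adjoint B)"
      by (rule mat_adjoint_mult[OF Ba, of _ k]) (use cs in \<open>auto intro: mult_carrier_mat\<close>)
    also have "\<dots> = (mat_adjoint B * mat_adjoint (\<pi> g)) * B"
      using cs by (simp add: mat_adjoint_mult[of _ n n _ k] mat_adjoint_adjoint[of _ n k])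
    also have "\<dots> = mat_adjoint B * (mat_adjoint (\<pi> g) * B)"
      using cs by (intro assoc_mult_mat[of _ k n _ n _ k]) simp_all
    also have "\<dots> = ?\<rho> (inv\<^bsub>F\<^esub> g)" by (simp only: unitary_hom_inv[OF F \<pi> g])
    finally have "mat_adjoint (?\<rho> g) * ?\<rho> g = ?\<rho> (inv\<^bsub>F\<^esub> g \<otimes>\<^bsub>F\<^esub> g)"
      using g mult[of "inv\<^bsub>F\<^esub> g" g] by (simp only: G.inv_closed)
    then show "mat_adjoint (?\<rho> g) * ?\<rho> g = 1\<^sub>m k" using g one by simp
  qed
  then show ?thesis using mult by (intro homI) simp_all
qed

section \<open>Irreducible unitary representations of a finite group separate points\<close>

text \<open>
  The regular representation by permutation matrices.
\<close>

lemma finite_group_faithful_unitary: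
  assumes F: "group F" and fin: "finite (carrier F)"
  obtains n \<pi> where "\<pi> \<in> hom F (unitary_group n)"
    "\<And>g. g \<in> carrier F \<Longrightarrow> g \<noteq> \<one>\<^bsub>F\<^esub> \<Longrightarrow> \<pi> g \<noteq> 1\<^sub>m n"
proof -
  interpret group F by fact
  define n where "n = card (carrier F)"
  obtain e where e: "bij_betw e {..<n} (carrier F)"
    using ex_bij_betw_nat_finite[OF fin] by (auto simp: n_def atLeast0LessThan)
  have ec: "e i \<in> carrier F" if "i < n" for i using e that by (auto simp: bij_betw_def)
  have inj: "e i = e j \<longleftrightarrow> i = j" if "i < n" "j < n" for i j
    using e that by (auto simp: bij_betw_def inj_on_def)
  have surj: "\<exists>i<n. e i = x" if "x \<in> carrier F" for x
    using e that unfolding bij_betw_def by (metis imageE lessThan_iff)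
  define \<pi> :: "_ \<Rightarrow> complex mat" where "\<pi> g = mat n n (\<lambda>(i, j). if e i = g \<otimes>\<^bsub>F\<^esub> e j then 1 else 0)" for g
  have \<pi>c: "\<pi> g \<in> carrier_mat n n" for g by (simp add: \<pi>_def)
  have one: "\<pi> \<one>\<^bsub>F\<^esub> = 1\<^sub>m n"
    by (rule eq_matI) (auto simp: \<pi>_def ec inj)
  have mult: "\<pi> (g \<otimes>\<^bsub>F\<^esub> h) = \<pi> g * \<pi> h" if gh: "g \<in> carrier F" "h \<in> carrier F" for g h
  proof (rule eq_matI)
    fix i j assume "i < dim_row (\<pi> g * \<pi> h)" "j < dim_col (\<pi> g * \<pi> h)"
    then have ij: "i < n" "j < n" by (auto simp: \<pi>_def)
    obtain l where l: "l < n" "e l = h \<otimes>\<^bsub>F\<^esub> e j" using surj[of "h \<otimes>\<^bsub>F\<^esub> e j"] gh ec[OF ij(2)] by auto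
    have "(\<pi> g * \<pi> h) $$ (i, j) = (\<Sum>r<n. \<pi> g $$ (i, r) * \<pi> h $$ (r, j))"
      by (rule mat_mult_index[OF \<pi>c \<pi>c ij])
    also have "\<dots> = (\<Sum>r<n. if r = l then \<pi> g $$ (i, l) else 0)"
      using ij l by (intro sum.cong) (auto simp: \<pi>_def inj simp flip: l(2))
    also have "\<dots> = \<pi> g $$ (i, l)" using l by simp
    also have "\<dots> = \<pi> (g \<otimes>\<^bsub>F\<^esub> h) $$ (i, j)"
      using ij l gh ec[OF ij(2)] by (simp add: \<pi>_def m_assoc)
    finally show "\<pi> (g \<otimes>\<^bsub>F\<^esub> h) $$ (i, j) = (\<pi> g * \<pi> h) $$ (i, j)" by simp
  qed (auto simp: \<pi>_def)
  have "\<pi> g \<in> carrier (unitary_group n)" if g: "g \<in> carrier F" for g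
  proof (rule unitary_groupI[OF \<pi>c])
    have "mat_adjoint (\<pi> g) = \<pi> (inv\<^bsub>F\<^esub> g)"
    proof (rule eq_matI)
      fix i j assume "i < dim_row (\<pi> (inv\<^bsub>F\<^esub> g))" "j < dim_col (\<pi> (inv\<^bsub>F\<^esub> g))"
      then have ij: "i < n" "j < n" by (auto simp: \<pi>_def)
      have "e j = g \<otimes>\<^bsub>F\<^esub> e i \<longleftrightarrow> e i = inv\<^bsub>F\<^esub> g \<otimes>\<^bsub>F\<^esub> e j"
        using ij ec g by (metis inv_closed inv_inv inv_solve_left)
      then show "mat_adjoint (\<pi> g) $$ (i, j) = \<pi> (inv\<^bsub>F\<^esub> g) $$ (i, j)"
        using ij by (simp add: mat_adjoint_index[OF \<pi>c]) (simp add: \<pi>_def)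
    qed (auto simp: \<pi>_def mat_adjoint_def)
    then show "mat_adjoint (\<pi> g) * \<pi> g = 1\<^sub>m n"
      using g mult[of "inv\<^bsub>F\<^esub> g" g] one by simp
  qed
  then have "\<pi> \<in> hom F (unitary_group n)" using mult by (intro homI) simp_all
  moreover have "\<pi> g \<noteq> 1\<^sub>m n" if g: "g \<in> carrier F" "g \<noteq> \<one>\<^bsub>F\<^esub>" for g
  proof
    assume eq: "\<pi> g = 1\<^sub>m n"
    obtain i where i: "i < n" "e i = \<one>\<^bsub>F\<^esub>" using surj[of "\<one>\<^bsub>F\<^esub>"] by auto
    have "\<pi> g $$ (i, i) = 1" using eq i by simp
    then show False using i g by (auto simp: \<pi>_def split: if_splits)
  qed
  ultimately show thesis by (rule that)
qed

text \<open>
  Among all unitary representations that do not kill \<open>g\<close>, one of least dimension is irreducible.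
  If \<open>W\<close> were a proper non-zero invariant subspace, then \<open>W\<close> and its orthogonal complement would both
  be invariant and of smaller dimension. By minimality \<open>g\<close> would act trivially on both, hence on
  their sum, which is the whole space.
\<close>

theorem finite_group_separating_irrep:
  assumes F: "group F" and fin: "finite (carrier F)" and g: "g \<in> carrier F" "g \<noteq> \<one>\<^bsub>F\<^esub>"
  obtains n \<pi> where "1 \<le> n" "\<pi> \<in> hom F (unitary_group n)" "irreducible_rep F n \<pi>" "\<pi> g \<noteq> 1\<^sub>m n"
proof -
  define P where "P n \<longleftrightarrow> (\<exists>\<pi> \<in> hom F (unitary_group n). \<pi> g \<noteq> 1\<^sub>m n)" for n
  define n where "n = (LEAST n. P n)"
  have "\<exists>n. P n" using finite_group_faithful_unitary[OF F fin] g unfolding P_def by metis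
  then have "P n" unfolding n_def by (rule LeastI_ex)
  then obtain \<pi> where \<pi>: "\<pi> \<in> hom F (unitary_group n)" "\<pi> g \<noteq> 1\<^sub>m n" unfolding P_def by blast
  have min: "\<rho> g = 1\<^sub>m k" if "\<rho> \<in> hom F (unitary_group k)" "k < n" for \<rho> k
    using that not_less_Least[of k P] unfolding n_def P_def by blast
  interpret group_hom F "unitary_group n" \<pi>
    using F \<pi> group_unitary_group by (simp add: group_hom_def group_hom_axioms_def)
  have \<pi>c: "\<pi> x \<in> carrier_mat n n" if "x \<in> carrier F" for x
    using that hom_closed unitary_groupD(1) by blast
  have n1: "1 \<le> n"
  proof (rule ccontr)
    assume "\<not> 1 \<le> n"
    then have "\<pi> g = 1\<^sub>m n" using \<pi>c[OF g(1)] by (intro eq_matI) auto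
    with \<pi>(2) show False by simp
  qed
  \<comment> \<open>By minimality of \<open>n\<close>, the element \<open>g\<close> fixes every invariant subspace of dimension \<open>k < n\<close>
    pointwise. The subspace is given as the range \<open>W\<close> of an isometry \<open>B\<close>.\<close>
  have fix_range: "\<pi> g *\<^sub>v (B *\<^sub>v x) = B *\<^sub>v x"
    if B: "B \<in> carrier_mat n k" "mat_adjoint B * B = 1\<^sub>m k" and k: "k < n"
      and BW: "\<And>x. x \<in> carrier_vec k \<Longrightarrow> B *\<^sub>v x \<in> W"
      and WB: "\<And>w. w \<in> W \<Longrightarrow> B *\<^sub>v (mat_adjoint B *\<^sub>v w) = w"
      and W: "\<And>x w. x \<in> carrier F \<Longrightarrow> w \<in> W \<Longrightarrow> \<pi> x *\<^sub>v w \<in> W"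
      and x: "x \<in> carrier_vec k" for B k W x
  proof -
    have Ba: "mat_adjoint B \<in> carrier_mat k n" using B(1) by simp
    have inv: "B * (mat_adjoint B * (\<pi> h * B)) = \<pi> h * B" if h: "h \<in> carrier F" for h
    proof (rule mat_eq_if_mult_vec_eq)
      fix v :: "complex vec" assume v: "v \<in> carrier_vec k"
      note cs = \<pi>c[OF h] Ba B(1) v
      have "(B * (mat_adjoint B * (\<pi> h * B))) *\<^sub>v v = B *\<^sub>v (mat_adjoint B *\<^sub>v (\<pi> h *\<^sub>v (B *\<^sub>v v)))"
        using cs by (simp add: assoc_mult_mat_vec[of _ n k _ k] assoc_mult_mat_vec[of _ k n _ k]
            assoc_mult_mat_vec[of _ n n _ k] mult_carrier_mat[of _ n n _ k] mult_carrier_mat[of _ k n _ k])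
      also have "\<dots> = \<pi> h *\<^sub>v (B *\<^sub>v v)" by (rule WB[OF W[OF h BW[OF v]]])
      also have "\<dots> = (\<pi> h * B) *\<^sub>v v" using cs by (simp add: assoc_mult_mat_vec[of _ n n _ k])
      finally show "(B * (mat_adjoint B * (\<pi> h * B))) *\<^sub>v v = (\<pi> h * B) *\<^sub>v v" .
    qed (use \<pi>c[OF h] Ba B(1) in \<open>auto intro!: mult_carrier_mat\<close>)
    have "mat_adjoint B * (\<pi> g * B) = 1\<^sub>m k"
      by (rule min[OF unitary_hom_compress[OF F \<pi>(1) B inv] k])
    then have "\<pi> g * B = B" using inv[OF g(1)] B(1) by simp
    then show ?thesis using \<pi>c[OF g(1)] B(1) x by (metis assoc_mult_mat_vec)
  qed
  have "irreducible_rep F n \<pi>"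
    unfolding irreducible_rep_def
  proof (intro allI impI, elim conjE)
    fix W :: "complex vec set"
    assume sub: "VectorSpace.subspace class_ring W (module_vec TYPE(complex) n)"
      and inv: "\<forall>g\<in>carrier F. \<forall>w\<in>W. \<pi> g *\<^sub>v w \<in> W"
    have W: "W \<subseteq> carrier_vec n" "0\<^sub>v n \<in> W" "\<And>v w. v \<in> W \<Longrightarrow> w \<in> W \<Longrightarrow> v + w \<in> W"
        "\<And>c v. v \<in> W \<Longrightarrow> c \<cdot>\<^sub>v v \<in> W"
      using sub unfolding VectorSpace.subspace_def LinearCombinations.submodule_def
      by (auto simp: module_vec_simps)
    show "W = {0\<^sub>v n} \<or> W = carrier_vec n"
    proof (rule ccontr)
      assume proper: "\<not> (W = {0\<^sub>v n} \<or> W = carrier_vec n)"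
      define W' where "W' = {v \<in> carrier_vec n. \<forall>w \<in> W. v \<bullet>c w = 0}"
      have W': "W' \<subseteq> carrier_vec n" "0\<^sub>v n \<in> W'" "\<And>v w. v \<in> W' \<Longrightarrow> w \<in> W' \<Longrightarrow> v + w \<in> W'"
        "\<And>c v. v \<in> W' \<Longrightarrow> c \<cdot>\<^sub>v v \<in> W'"
        using W(1) by (auto simp: W'_def subset_iff add_scalar_prod_distrib[of _ n])
      have inv': "\<pi> x *\<^sub>v v \<in> W'" if x: "x \<in> carrier F" and v: "v \<in> W'" for x v
      proof -
        have "(\<pi> x *\<^sub>v v) \<bullet>c w = 0" if w: "w \<in> W" for w
        proof -
          have "(\<pi> x *\<^sub>v v) \<bullet>c w = v \<bullet>c (mat_adjoint (\<pi> x) *\<^sub>v w)"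
            using cscalar_prod_mat_adjoint[OF \<pi>c[OF x], of v w] v w W(1) by (auto simp: W'_def)
          moreover have "mat_adjoint (\<pi> x) *\<^sub>v w \<in> W"
            unfolding unitary_hom_inv[OF F \<pi>(1) x] using inv G.inv_closed[OF x] w by blast
          ultimately show ?thesis using v by (simp add: W'_def)
        qed
        then show ?thesis using v \<pi>c[OF x] by (simp add: W'_def)
      qed
      obtain k B where B: "k \<le> n" "B \<in> carrier_mat n k" "mat_adjoint B * B = 1\<^sub>m k"
        "\<And>x. x \<in> carrier_vec k \<Longrightarrow> B *\<^sub>v x \<in> W"
        "\<And>w. w \<in> W \<Longrightarrow> B *\<^sub>v (mat_adjoint B *\<^sub>v w) = w"
        using isometry_onto_subspace[OF W] by blast
      obtain l C where C: "l \<le> n" "C \<in> carrier_mat n l" "mat_adjoint C * C = 1\<^sub>m l"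
        "\<And>x. x \<in> carrier_vec l \<Longrightarrow> C *\<^sub>v x \<in> W'"
        "\<And>w. w \<in> W' \<Longrightarrow> C *\<^sub>v (mat_adjoint C *\<^sub>v w) = w"
        using isometry_onto_subspace[OF W'] by blast
      \<comment> \<open>An isometry with \<open>n\<close> columns is onto, so \<open>k\<close> and \<open>l\<close> are less than \<open>n\<close>.\<close>
      have full: "v \<in> U"
        if A: "A \<in> carrier_mat n n" "mat_adjoint A * A = 1\<^sub>m n"
          and AU: "\<And>x. x \<in> carrier_vec n \<Longrightarrow> A *\<^sub>v x \<in> U" and v: "v \<in> carrier_vec n" for A U v
      proof -
        have Aa: "mat_adjoint A \<in> carrier_mat n n" using A(1) by simp
        have "A *\<^sub>v (mat_adjoint A *\<^sub>v v) = v"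
          using mat_mult_left_right_inverse[OF Aa A] A(1) Aa v
          by (metis assoc_mult_mat_vec one_mult_mat_vec)
        then show ?thesis using AU[of "mat_adjoint A *\<^sub>v v"] Aa v by simp
      qed
      have "k \<noteq> n" using full[of B W] B(2-4) W(1) proper by blast
      then have k: "k < n" using B(1) by simp
      have "l \<noteq> n"
      proof
        assume "l = n"
        then have W'all: "v \<in> W'" if "v \<in> carrier_vec n" for v
          using full[of C W'] C(2-4) that by blast
        have "w = 0\<^sub>v n" if w: "w \<in> W" for w
        proof -
          have "w \<bullet>c w = 0" using W'all w W(1) by (auto simp: W'_def)
          then show ?thesis using w W(1) by (metis conjugate_square_eq_0_vec subsetD)
        qed
        then show False using W(2) proper by blast
      qed
      then have l: "l < n" using C(1) by simp
      have "\<pi> g = 1\<^sub>m n"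
      proof (rule mat_eq_if_mult_vec_eq[OF \<pi>c[OF g(1)]])
        fix v :: "complex vec" assume v: "v \<in> carrier_vec n"
        have Ba: "mat_adjoint B \<in> carrier_mat k n" using B(2) by simp
        have Ca: "mat_adjoint C \<in> carrier_mat l n" using C(2) by simp
        define p where "p = B *\<^sub>v (mat_adjoint B *\<^sub>v v)"
        have pc: "p \<in> carrier_vec n" 
          unfolding p_def using B(2) Ba v by (metis mult_mat_vec_carrier)
        define q where "q = v - p"
        have qc: "q \<in> carrier_vec n" using v pc by (simp add: q_def)
        have "q \<bullet>c w = 0" if w: "w \<in> W" for w
        proof -
          have wc: "w \<in> carrier_vec n" using w W(1) by blast
          have z: "mat_adjoint B *\<^sub>v w \<in> carrier_vec k" using Ba wc by simp
          have "p \<bullet>c w = (mat_adjoint B *\<^sub>v v) \<bullet>c (mat_adjoint B *\<^sub>v w)"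
            unfolding p_def using cscalar_prod_mat_adjoint[OF B(2) _ wc] Ba v by simp
          also have "\<dots> = v \<bullet>c (mat_adjoint (mat_adjoint B) *\<^sub>v (mat_adjoint B *\<^sub>v w))"
            by (rule cscalar_prod_mat_adjoint[OF Ba v z])
          also have "\<dots> = v \<bullet>c w" using B(5)[OF w] mat_adjoint_adjoint[OF B(2)] by simp
          finally show ?thesis
            unfolding q_def using v pc wc by (simp add: minus_scalar_prod_distrib[of _ n])
        qed
        then have qW: "q \<in> W'" using qc by (simp add: W'_def)
        have "\<pi> g *\<^sub>v p = p"
          unfolding p_def
          by (rule fix_range[OF B(2,3) k B(4,5), of "mat_adjoint B *\<^sub>v v"])
            (use inv Ba v in auto)
        moreover have "\<pi> g *\<^sub>v q = q"
          using fix_range[OF C(2,3) l C(4,5) inv', of "mat_adjoint C *\<^sub>v q"] C(5)[OF qW] Ca qc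
          by simp
        moreover have "v = p + q" unfolding q_def using v pc by (intro eq_vecI) auto
        ultimately show "\<pi> g *\<^sub>v v = 1\<^sub>m n *\<^sub>v v"
          using \<pi>c[OF g(1)] pc qc by (simp add: mult_add_distrib_mat_vec)
      qed simp
      with \<pi>(2) show False by simp
    qed
  qed
  with n1 \<pi> that show thesis by blast
qed

lemma irreducible_rep_dim_one: "irreducible_rep G 1 \<sigma>"
  unfolding irreducible_rep_def
proof (intro allI impI, elim conjE)
  fix W :: "complex vec set"
  assume "VectorSpace.subspace class_ring W (module_vec TYPE(complex) 1)"
  then have W: "W \<subseteq> carrier_vec 1" "0\<^sub>v 1 \<in> W" "\<And>c v. v \<in> W \<Longrightarrow> c \<cdot>\<^sub>v v \<in> W"
    unfolding VectorSpace.subspace_def LinearCombinations.submodule_def by (auto simp: module_vec_simps)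
  show "W = {0\<^sub>v 1} \<or> W = carrier_vec 1"
  proof (rule disjCI)
    assume "W \<noteq> carrier_vec 1"
    then obtain v where v: "v \<in> carrier_vec 1" "v \<notin> W" using W(1) by blast
    have "w = 0\<^sub>v 1" if w: "w \<in> W" for w
    proof (rule ccontr)
      assume "w \<noteq> 0\<^sub>v 1"
      then have "w $ 0 \<noteq> 0" using w W(1) by (auto intro!: eq_vecI)
      then have "v = (v $ 0 / w $ 0) \<cdot>\<^sub>v w" using w W(1) v by (intro eq_vecI) auto
      then show False using W(3)[OF w] v(2) by metis
    qed
    then show "W = {0\<^sub>v 1}" using W(2) by blast
  qed
qed

section \<open>Representations with finite image\<close>

lemma unitary_conj_eq_one_iff:
  assumes U: "U \<in> carrier (unitary_group n)" and A: "A \<in> carrier (unitary_group n)"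
  shows "U * A * mat_adjoint U = 1\<^sub>m n \<longleftrightarrow> A = 1\<^sub>m n"
proof -
  interpret group "unitary_group n" by (rule group_unitary_group)
  let ?UA = "U \<otimes>\<^bsub>unitary_group n\<^esub> A" and ?U' = "inv\<^bsub>unitary_group n\<^esub> U"
  have "?UA \<otimes>\<^bsub>unitary_group n\<^esub> ?U' = \<one>\<^bsub>unitary_group n\<^esub> \<longleftrightarrow> A = \<one>\<^bsub>unitary_group n\<^esub>"
  proof
    assume eq: "?UA \<otimes>\<^bsub>unitary_group n\<^esub> ?U' = \<one>\<^bsub>unitary_group n\<^esub>"
    have UA: "?UA \<in> carrier (unitary_group n)" using U A by (rule m_closed)
    have "?UA = inv\<^bsub>unitary_group n\<^esub> ?U'"
      using eq inv_closed[OF U] UA by (rule inv_equality[symmetric])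
    then have "?UA = U" using U by (simp only: inv_inv)
    then show "A = \<one>\<^bsub>unitary_group n\<^esub>" using U A l_cancel_one by blast
  next
    assume "A = \<one>\<^bsub>unitary_group n\<^esub>"
    then show "?UA \<otimes>\<^bsub>unitary_group n\<^esub> ?U' = \<one>\<^bsub>unitary_group n\<^esub>"
      using U by (simp only: r_one r_inv)
  qed
  then show ?thesis by (simp only: unitary_group_simps unitary_group_inv(1)[OF U])
qed

text \<open>
  Unitarily equivalent representations have the same kernel.
\<close>

lemma finite_dual_class:
  assumes c: "c \<in> finite_dual G T" and \<sigma>: "(n, \<sigma>) \<in> c"
  shows "(n, \<sigma>) \<in> finite_irreps G T"
    and "(m, \<tau>) \<in> c \<Longrightarrow> m = n"
    and "(m, \<tau>) \<in> c \<Longrightarrow> g \<in> carrier G \<Longrightarrow> \<tau> g = 1\<^sub>m n \<longleftrightarrow> \<sigma> g = 1\<^sub>m n"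
proof -
  obtain k \<rho> where c_eq: "c = unitary_equivalence G T `` {(k, \<rho>)}"
    using c by (auto simp: finite_dual_def elim: quotientE)
  have rep: "m = k \<and> (m, \<tau>) \<in> finite_irreps G T \<and> (\<forall>g \<in> carrier G. \<tau> g = 1\<^sub>m k \<longleftrightarrow> \<rho> g = 1\<^sub>m k)"
    if "(m, \<tau>) \<in> c" for m \<tau>
  proof -
    have eq: "(k, \<rho>) \<in> finite_irreps G T" "(m, \<tau>) \<in> finite_irreps G T" "m = k"
      and "\<exists>U \<in> carrier (unitary_group k). \<forall>g \<in> carrier G. \<tau> g = U * \<rho> g * mat_adjoint U"
      using that by (auto simp: c_eq unitary_equivalence_def)
    then obtain U where U: "U \<in> carrier (unitary_group k)"
      "\<And>g. g \<in> carrier G \<Longrightarrow> \<tau> g = U * \<rho> g * mat_adjoint U" by blast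
    have "\<rho> g \<in> carrier (unitary_group k)" if "g \<in> carrier G" for g
      using eq(1) that by (auto simp: finite_irreps_def unitary_rep_def hom_def)
    then show ?thesis using eq U unitary_conj_eq_one_iff[OF U(1)] by simp
  qed
  show "(n, \<sigma>) \<in> finite_irreps G T" "(m, \<tau>) \<in> c \<Longrightarrow> m = n"
    "(m, \<tau>) \<in> c \<Longrightarrow> g \<in> carrier G \<Longrightarrow> \<tau> g = 1\<^sub>m n \<longleftrightarrow> \<sigma> g = 1\<^sub>m n"
    using rep[OF \<sigma>] rep[of m \<tau>] by auto
qed

text \<open>
  A continuous map with finite image is locally constant. This is applied to each of the finitely
  many matrix entries, because continuity of a representation is defined by its entries.
\<close>

lemma openin_finite_rep_fibre:
  assumes ts: "topspace T = carrier G"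
    and \<sigma>: "unitary_rep G T n \<sigma>" and fin: "finite (\<sigma> ` carrier G)" and A: "A \<in> \<sigma> ` carrier G"
  shows "openin T {x \<in> carrier G. \<sigma> x = A}"
proof -
  have mc: "\<sigma> x \<in> carrier_mat n n" if "x \<in> carrier G" for x
    using that \<sigma> by (auto simp: unitary_rep_def unitary_group_def hom_def)
  have Ac: "A \<in> carrier_mat n n" using A mc by auto
  have "openin T {x \<in> carrier G. \<sigma> x $$ (i, j) = A $$ (i, j)}" if ij: "i < n" "j < n" for i j
  proof -
    define Z where "Z = (\<lambda>B. B $$ (i, j)) ` \<sigma> ` carrier G - {A $$ (i, j)}"
    have "finite Z" using fin by (simp add: Z_def)
    then have "openin euclidean (- Z)" by (simp add: finite_imp_closed open_Compl)
    moreover have "continuous_map T euclidean (\<lambda>x. \<sigma> x $$ (i, j))"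
      using \<sigma> ij by (simp add: unitary_rep_def)
    ultimately have "openin T {x \<in> topspace T. \<sigma> x $$ (i, j) \<in> - Z}"
      by (rule openin_continuous_map_preimage[rotated])
    moreover have "{x \<in> topspace T. \<sigma> x $$ (i, j) \<in> - Z} = {x \<in> carrier G. \<sigma> x $$ (i, j) = A $$ (i, j)}"
      by (auto simp: Z_def ts)
    ultimately show ?thesis by simp
  qed
  then have "openin T (topspace T \<inter> (\<Inter>(i, j) \<in> {..<n} \<times> {..<n}. {x \<in> carrier G. \<sigma> x $$ (i, j) = A $$ (i, j)}))"
    by (intro openin_Int_Inter) auto
  also have "topspace T \<inter> (\<Inter>(i, j) \<in> {..<n} \<times> {..<n}. {x \<in> carrier G. \<sigma> x $$ (i, j) = A $$ (i, j)})
      = {x \<in> carrier G. \<forall>i<n. \<forall>j<n. \<sigma> x $$ (i, j) = A $$ (i, j)}"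
    by (auto simp: ts)
  also have "\<dots> = {x \<in> carrier G. \<sigma> x = A}"
  proof -
    have "\<sigma> x = A \<longleftrightarrow> (\<forall>i<n. \<forall>j<n. \<sigma> x $$ (i, j) = A $$ (i, j))" if "x \<in> carrier G" for x
      using carrier_matD[OF mc[OF that]] carrier_matD[OF Ac] by (auto intro!: eq_matI)
    then show ?thesis by blast
  qed
  finally show ?thesis .
qed

lemma unitary_rep_of_finite_quotient:
  assumes G: "topological_group G T" and f: "continuous_hom G T E (discrete_topology (carrier E)) f"
    and \<pi>: "\<pi> \<in> hom E (unitary_group n)" and n: "1 \<le> n"
  shows "unitary_rep G T n (\<lambda>x \<in> carrier G. \<pi> (f x))"
  unfolding unitary_rep_def
proof (intro conjI allI impI)
  interpret topological_grp G T by (rule topological_grpI[OF G])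
  have fh: "f \<in> hom G E" and fc: "continuous_map T (discrete_topology (carrier E)) f"
    using f by (auto simp: continuous_hom_def)
  show "(\<lambda>x \<in> carrier G. \<pi> (f x)) \<in> hom G (unitary_group n)"
    using fh \<pi> by (auto simp: hom_def Pi_def)
  fix i j
  have "continuous_map (discrete_topology (carrier E)) euclidean (\<lambda>A. \<pi> A $$ (i, j))"
    by (simp add: continuous_map_from_discrete_topology)
  from continuous_map_compose[OF fc this]
  show "continuous_map T euclidean (\<lambda>g. (\<lambda>x \<in> carrier G. \<pi> (f x)) g $$ (i, j))"
    by (rule continuous_map_eq) simp
qed (use n in auto)

section \<open>Profinite completions\<close>

context
  fixes G :: "'g monoid" and T :: "'g topology" and P :: "'p monoid" and S :: "'p topology"
    and \<alpha> :: "'g \<Rightarrow> 'p"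
  assumes G: "topological_group G T" and P: "profinite_completion G T P S \<alpha>"
begin

lemma completion_topological_grp: "topological_grp P S"
  using P by (simp add: profinite_completion_def profinite_group_def topological_grpI)

lemma completion_profinite: "profinite_group P S"
  using P by (simp add: profinite_completion_def)

lemma completion_compact: "compact_space S" and completion_Hausdorff: "Hausdorff_space S"
  using completion_profinite by (simp_all add: profinite_group_def)

lemma completion_hom: "\<alpha> \<in> hom G P" and completion_continuous: "continuous_map T S \<alpha>"
  using P by (simp_all add: profinite_completion_def continuous_hom_def)

lemma completion_dense: "S closure_of (\<alpha> ` carrier G) = carrier P"
  using P by (simp add: profinite_completion_def)

lemma completion_group_hom: "group_hom G P \<alpha>"
  using G completion_hom completion_topological_grp
  by (simp add: group_hom_def group_hom_axioms_def topological_group_def topological_grp_def)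

lemma unitary_rep_of_completion_unique:
  assumes \<rho>: "unitary_rep P S n \<rho>" and \<rho>': "unitary_rep P S n \<rho>'"
    and eq: "\<And>x. x \<in> carrier G \<Longrightarrow> \<rho> (\<alpha> x) = \<rho>' (\<alpha> x)"
  shows "\<rho> = \<rho>'"
proof (rule extensionalityI[of _ "carrier P"])
  show "\<rho> \<in> extensional (carrier P)" "\<rho>' \<in> extensional (carrier P)"
    using \<rho> \<rho>' by (auto simp: unitary_rep_def)
  fix x assume x: "x \<in> carrier P"
  have c: "\<rho> x \<in> carrier_mat n n" "\<rho>' x \<in> carrier_mat n n"
    using \<rho> \<rho>' x by (auto simp: unitary_rep_def unitary_group_def hom_def)
  show "\<rho> x = \<rho>' x"
  proof (rule eq_matI)
    fix i j assume "i < dim_row (\<rho>' x)" "j < dim_col (\<rho>' x)"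
    then have ij: "i < n" "j < n" using c by auto
    show "\<rho> x $$ (i, j) = \<rho>' x $$ (i, j)"
      by (rule continuous_maps_agree_if_dense[where A = "\<alpha> ` carrier G" and R = euclidean and P = P])
        (use \<rho> \<rho>' ij eq x completion_dense in \<open>auto simp: unitary_rep_def\<close>)
  qed (use c in auto)
qed

lemma prof_rep_eqI:
  assumes "unitary_rep P S n \<rho>" "\<And>x. x \<in> carrier G \<Longrightarrow> \<rho> (\<alpha> x) = \<sigma> x"
  shows "prof_rep G P S \<alpha> n \<sigma> = \<rho>"
  unfolding prof_rep_def
  by (rule the_equality) (use assms unitary_rep_of_completion_unique in auto)

text \<open>
  The image of \<open>\<sigma>\<close> is a finite group, and \<open>\<sigma>\<close> is continuous for its discrete topology. So the
  universal property applies to \<open>\<sigma>\<close> with the finite image as the target.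
\<close>

lemma prof_rep_extends:
  assumes \<sigma>: "unitary_rep G T n \<sigma>" and fin: "finite (\<sigma> ` carrier G)"
  shows "unitary_rep P S n (prof_rep G P S \<alpha> n \<sigma>)"
    and "x \<in> carrier G \<Longrightarrow> prof_rep G P S \<alpha> n \<sigma> (\<alpha> x) = \<sigma> x"
proof -
  have \<sigma>hom: "\<sigma> \<in> hom G (unitary_group n)" using \<sigma> by (simp add: unitary_rep_def)
  interpret gh: group_hom G "unitary_group n" \<sigma>
    using \<sigma>hom G group_unitary_group by (simp add: group_hom_def group_hom_axioms_def topological_group_def)
  define F where "F = subgrp (unitary_group n) (\<sigma> ` carrier G)"
  have grpF: "group F"
    unfolding F_def by (rule gh.H.subgroup_imp_group[OF gh.img_is_subgroup])
  have cF: "carrier F = \<sigma> ` carrier G" by (simp add: F_def)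
  have ts: "topspace T = carrier G" using G by (simp add: topological_group_def)
  have op: "openin T {x \<in> carrier G. \<sigma> x = A}" if A: "A \<in> carrier F" for A
    using openin_finite_rep_fibre[OF ts \<sigma> fin] A by (simp add: cF)
  have "continuous_map T (discrete_topology (carrier F)) \<sigma>"
    unfolding continuous_map_def
  proof (intro conjI allI impI)
    show "\<sigma> \<in> topspace T \<rightarrow> topspace (discrete_topology (carrier F))" by (auto simp: cF ts)
    fix U assume "openin (discrete_topology (carrier F)) U"
    then have "openin T (\<Union>A\<in>U. {x \<in> carrier G. \<sigma> x = A})" using op by auto
    moreover have "(\<Union>A\<in>U. {x \<in> carrier G. \<sigma> x = A}) = {x \<in> topspace T. \<sigma> x \<in> U}" by (auto simp: ts)
    ultimately show "openin T {x \<in> topspace T. \<sigma> x \<in> U}" by simp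
  qed
  moreover have "\<sigma> \<in> hom G F" using \<sigma>hom by (auto simp: hom_def F_def)
  ultimately have "continuous_hom G T F (discrete_topology (carrier F)) \<sigma>"
    by (simp add: continuous_hom_def)
  moreover have "profinite_group F (discrete_topology (carrier F))"
    using fin grpF by (intro profinite_group_discrete) (simp_all add: cF)
  ultimately obtain f where f: "continuous_hom P S F (discrete_topology (carrier F)) f"
      "\<And>x. x \<in> carrier G \<Longrightarrow> \<sigma> x = f (\<alpha> x)"
    using profinite_completion_universal[OF G P] by blast
  have tsP: "topspace S = carrier P"
    using topological_grp.topspace[OF completion_topological_grp] .
  have fhom: "f \<in> hom P (unitary_group n)"
  proof -
    have "\<sigma> ` carrier G \<subseteq> carrier (unitary_group n)" using gh.hom_closed by blast
    then show ?thesis using f(1) by (auto simp: continuous_hom_def hom_def F_def Pi_def)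
  qed
  define \<rho> where "\<rho> = restrict f (carrier P)"
  have "unitary_rep P S n \<rho>"
    unfolding unitary_rep_def
  proof (intro conjI allI impI)
    show "1 \<le> n" using \<sigma> by (simp add: unitary_rep_def)
    show "\<rho> \<in> hom P (unitary_group n)"
      using fhom topological_grp.axioms(1)[OF completion_topological_grp]
      by (auto simp: \<rho>_def hom_def group.is_monoid monoid.m_closed)
    show "\<rho> \<in> extensional (carrier P)" by (simp add: \<rho>_def)
    fix i j
    have "continuous_map (discrete_topology (carrier F)) euclidean (\<lambda>A. A $$ (i, j) :: complex)"
      by (simp add: continuous_map_from_discrete_topology)
    from continuous_map_compose[OF _ this] f(1)
    have "continuous_map S euclidean ((\<lambda>A. A $$ (i, j)) \<circ> f)" by (auto simp: continuous_hom_def)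
    then show "continuous_map S euclidean (\<lambda>g. \<rho> g $$ (i, j))"
      by (rule continuous_map_eq) (simp add: \<rho>_def tsP)
  qed
  moreover have \<rho>\<alpha>: "\<rho> (\<alpha> x) = \<sigma> x" if "x \<in> carrier G" for x
    using f(2) that completion_hom by (auto simp: \<rho>_def hom_def)
  ultimately have "prof_rep G P S \<alpha> n \<sigma> = \<rho>" by (rule prof_rep_eqI)
  with \<open>unitary_rep P S n \<rho>\<close> \<rho>\<alpha>
  show "unitary_rep P S n (prof_rep G P S \<alpha> n \<sigma>)"
    "x \<in> carrier G \<Longrightarrow> prof_rep G P S \<alpha> n \<sigma> (\<alpha> x) = \<sigma> x" by simp_all
qed

end

text \<open>
  Conjugation by \<open>h\<close> on \<open>N\<close>, followed by \<open>\<alpha>\<close>, extends to \<open>P\<close> by the universal property. The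
  extensions for \<open>h\<close> and for its inverse are mutually inverse on the dense image of \<open>N\<close>, hence
  everywhere, so they are automorphisms.
\<close>

lemma prof_action_extends_conjugation:
  assumes G: "topological_group G T" and N: "N \<lhd> G"
    and P: "profinite_completion (subgrp G N) (subtopology T N) P S \<alpha>" and h: "h \<in> carrier G"
  shows "prof_action G N P S \<alpha> h \<in> auto P" "continuous_map S S (prof_action G N P S \<alpha> h)"
    and "n \<in> N \<Longrightarrow> prof_action G N P S \<alpha> h (\<alpha> n) = \<alpha> (h \<otimes>\<^bsub>G\<^esub> n \<otimes>\<^bsub>G\<^esub> inv\<^bsub>G\<^esub> h)"
proof -
  interpret G: topological_grp G T by (rule topological_grpI[OF G])
  interpret N: normal N G by fact
  have sN: "subgroup N G" by (rule N.is_subgroup)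
  have NG: "n \<in> carrier G" if "n \<in> N" for n using that N.subset by blast
  have tN: "topological_group (subgrp G N) (subtopology T N)"
    by (rule topological_group_subgrp[OF G sN])
  interpret P: topological_grp P S by (rule completion_topological_grp[OF tN P])
  note dense = completion_dense[OF tN P, simplified] and haus = completion_Hausdorff[OF tN P]
  have \<alpha>hom: "\<alpha> n \<in> carrier P" "\<alpha> (n \<otimes>\<^bsub>G\<^esub> m) = \<alpha> n \<otimes>\<^bsub>P\<^esub> \<alpha> m" if "n \<in> N" "m \<in> N" for n m
    using completion_hom[OF tN P] that by (auto simp: hom_def)
  have ex: "\<exists>\<theta>. \<theta> \<in> hom P P \<and> continuous_map S S \<theta> \<and> (\<forall>n\<in>N. \<theta> (\<alpha> n) = \<alpha> (g \<otimes>\<^bsub>G\<^esub> n \<otimes>\<^bsub>G\<^esub> inv\<^bsub>G\<^esub> g))"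
    if g: "g \<in> carrier G" for g
  proof -
    let ?c = "\<lambda>n. g \<otimes>\<^bsub>G\<^esub> n \<otimes>\<^bsub>G\<^esub> inv\<^bsub>G\<^esub> g"
    have cN: "?c n \<in> N" if "n \<in> N" for n using g that by (rule N.inv_op_closed2)
    have "continuous_map (subtopology T N) T (\<lambda>n. n)"
      by (intro continuous_map_from_subtopology continuous_map_id[unfolded id_def])
    then have "continuous_map (subtopology T N) T ?c"
      using g by (intro G.continuous_map_mult) auto
    then have "continuous_map (subtopology T N) (subtopology T N) ?c"
      using cN by (auto simp: continuous_map_in_subtopology)
    from continuous_map_compose[OF this completion_continuous[OF tN P]]
    have "continuous_map (subtopology T N) S (\<lambda>n. \<alpha> (?c n))" by (simp add: o_def)
    moreover have "(\<lambda>n. \<alpha> (?c n)) \<in> hom (subgrp G N) P"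
    proof (rule homI)
      fix n m assume "n \<in> carrier (subgrp G N)" "m \<in> carrier (subgrp G N)"
      then have nm: "n \<in> N" "m \<in> N" by auto
      show "\<alpha> (?c n) \<in> carrier P" using nm cN \<alpha>hom by blast
      have "inv\<^bsub>G\<^esub> g \<otimes>\<^bsub>G\<^esub> (g \<otimes>\<^bsub>G\<^esub> (m \<otimes>\<^bsub>G\<^esub> inv\<^bsub>G\<^esub> g)) = m \<otimes>\<^bsub>G\<^esub> inv\<^bsub>G\<^esub> g"
        using g nm NG by (simp flip: G.m_assoc)
      then have "?c (n \<otimes>\<^bsub>G\<^esub> m) = ?c n \<otimes>\<^bsub>G\<^esub> ?c m"
        using g nm NG by (simp add: G.m_assoc)
      then show "\<alpha> (?c (n \<otimes>\<^bsub>subgrp G N\<^esub> m)) = \<alpha> (?c n) \<otimes>\<^bsub>P\<^esub> \<alpha> (?c m)"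
        using nm cN \<alpha>hom by simp
    qed
    ultimately have "continuous_hom (subgrp G N) (subtopology T N) P S (\<lambda>n. \<alpha> (?c n))"
      by (simp add: continuous_hom_def)
    from profinite_completion_universal[OF tN P completion_profinite[OF tN P] this]
    show ?thesis by (auto simp: continuous_hom_def)
  qed
  then obtain \<theta> where \<theta>: "\<And>g. g \<in> carrier G \<Longrightarrow> \<theta> g \<in> hom P P"
      "\<And>g. g \<in> carrier G \<Longrightarrow> continuous_map S S (\<theta> g)"
      "\<And>g n. g \<in> carrier G \<Longrightarrow> n \<in> N \<Longrightarrow> \<theta> g (\<alpha> n) = \<alpha> (g \<otimes>\<^bsub>G\<^esub> n \<otimes>\<^bsub>G\<^esub> inv\<^bsub>G\<^esub> g)"
    by metis
  have inverse: "\<theta> g (\<theta> (inv\<^bsub>G\<^esub> g) x) = x" if g: "g \<in> carrier G" and x: "x \<in> carrier P" for g x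
  proof (rule continuous_maps_agree_if_dense[OF haus dense _ _ _ x])
    show "continuous_map S S (\<lambda>x. \<theta> g (\<theta> (inv\<^bsub>G\<^esub> g) x))"
      using continuous_map_compose[OF \<theta>(2) \<theta>(2)] g by (simp add: o_def)
    show "continuous_map S S (\<lambda>x. x)" by (rule continuous_map_id[unfolded id_def])
    fix y assume "y \<in> \<alpha> ` N"
    then obtain n where n: "n \<in> N" "y = \<alpha> n" by blast
    have "inv\<^bsub>G\<^esub> g \<otimes>\<^bsub>G\<^esub> n \<otimes>\<^bsub>G\<^esub> inv\<^bsub>G\<^esub> (inv\<^bsub>G\<^esub> g) \<in> N"
      using g n N.inv_op_closed2[of "inv\<^bsub>G\<^esub> g" n] by simp
    then have "\<theta> g (\<theta> (inv\<^bsub>G\<^esub> g) y)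
        = \<alpha> (g \<otimes>\<^bsub>G\<^esub> (inv\<^bsub>G\<^esub> g \<otimes>\<^bsub>G\<^esub> n \<otimes>\<^bsub>G\<^esub> inv\<^bsub>G\<^esub> (inv\<^bsub>G\<^esub> g)) \<otimes>\<^bsub>G\<^esub> inv\<^bsub>G\<^esub> g)"
      using g n \<theta>(3) by simp
    also have "g \<otimes>\<^bsub>G\<^esub> (inv\<^bsub>G\<^esub> g \<otimes>\<^bsub>G\<^esub> n \<otimes>\<^bsub>G\<^esub> inv\<^bsub>G\<^esub> (inv\<^bsub>G\<^esub> g)) \<otimes>\<^bsub>G\<^esub> inv\<^bsub>G\<^esub> g = n"
      using g NG[OF n(1)] by (simp add: G.m_assoc flip: G.m_assoc[of g "inv\<^bsub>G\<^esub> g"])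
    finally show "\<theta> g (\<theta> (inv\<^bsub>G\<^esub> g) y) = y" using n by simp
  qed
  define \<theta>' where "\<theta>' = restrict (\<theta> h) (carrier P)"
  have \<theta>c: "\<theta> g x \<in> carrier P" if "g \<in> carrier G" "x \<in> carrier P" for g x
    using \<theta>(1)[OF that(1)] that(2) by (auto simp: hom_def)
  have au: "\<theta>' \<in> auto P"
  proof -
    have "bij_betw \<theta>' (carrier P) (carrier P)"
      by (rule bij_betw_byWitness[where f' = "\<theta> (inv\<^bsub>G\<^esub> h)"])
        (use h \<theta>c inverse[of h] inverse[of "inv\<^bsub>G\<^esub> h"] in \<open>auto simp: \<theta>'_def\<close>)
    moreover have "\<theta>' \<in> hom P P" using \<theta>(1)[OF h] by (auto simp: hom_def \<theta>'_def)
    ultimately show ?thesis by (simp add: auto_def Bij_def \<theta>'_def)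
  qed
  have cont: "continuous_map S S \<theta>'"
    by (rule continuous_map_eq[OF \<theta>(2)[OF h]]) (simp add: \<theta>'_def)
  have ext: "\<theta>' (\<alpha> n) = \<alpha> (h \<otimes>\<^bsub>G\<^esub> n \<otimes>\<^bsub>G\<^esub> inv\<^bsub>G\<^esub> h)" if "n \<in> N" for n
    using \<theta>(3)[OF h that] \<alpha>hom(1)[OF that that] by (simp add: \<theta>'_def)
  have "\<theta>'' = \<theta>'" if \<theta>'': "\<theta>'' \<in> auto P" "continuous_map S S \<theta>''"
    and \<theta>''_ext: "\<forall>n\<in>N. \<theta>'' (\<alpha> n) = \<alpha> (h \<otimes>\<^bsub>G\<^esub> n \<otimes>\<^bsub>G\<^esub> inv\<^bsub>G\<^esub> h)" for \<theta>''
  proof (rule extensionalityI[of _ "carrier P"])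
    show "\<theta>'' \<in> extensional (carrier P)" using \<theta>'' by (simp add: auto_def Bij_def)
    show "\<theta>' \<in> extensional (carrier P)" by (simp add: \<theta>'_def)
    fix x assume "x \<in> carrier P"
    moreover have "\<theta>'' y = \<theta>' y" if "y \<in> \<alpha> ` N" for y
      using that \<theta>''_ext ext by auto
    ultimately show "\<theta>'' x = \<theta>' x"
      by (rule continuous_maps_agree_if_dense[OF haus dense \<theta>''(2) cont, rotated])
  qed
  then have "prof_action G N P S \<alpha> h = \<theta>'"
    unfolding prof_action_def using au cont ext by (intro the_equality conjI ballI; blast)
  with au cont ext show "prof_action G N P S \<alpha> h \<in> auto P"
    "continuous_map S S (prof_action G N P S \<alpha> h)"
    "n \<in> N \<Longrightarrow> prof_action G N P S \<alpha> h (\<alpha> n) = \<alpha> (h \<otimes>\<^bsub>G\<^esub> n \<otimes>\<^bsub>G\<^esub> inv\<^bsub>G\<^esub> h)"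
    by simp_all
qed

section \<open>Periodic representations extend to finite quotients\<close>

text \<open>
  The form in which finiteness is transferred between orbits: \<open>g\<close> takes finitely many values because
  it factors through \<open>f\<close>.
\<close>

lemma finite_image_factor:
  assumes "finite (f ` X)" "\<And>x y. x \<in> X \<Longrightarrow> y \<in> X \<Longrightarrow> f x = f y \<Longrightarrow> g x = g y"
  shows "finite (g ` X)"
proof -
  have "g ` X \<subseteq> (\<lambda>z. g (inv_into X f z)) ` f ` X"
  proof
    fix z assume "z \<in> g ` X"
    then obtain x where x: "x \<in> X" "z = g x" by blast
    have "f x \<in> f ` X" using x(1) by simp
    then have "g (inv_into X f (f x)) = g x"
      using x(1) by (intro assms(2) inv_into_into f_inv_into_f)
    then show "z \<in> (\<lambda>z. g (inv_into X f z)) ` f ` X" using x by force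
  qed
  then show ?thesis using assms(1) by (meson finite_imageI finite_subset)
qed

text \<open>
  The projection onto \<open>N\<close> is only continuous, the one onto \<open>H\<close> is also a homomorphism, since \<open>N\<close> is
  normal.
\<close>

lemma semidirect_projections:
  fixes G (structure)
  assumes G: "topological_group G T" and semi: "topological_semidirect G T N H"
  obtains pN pH where "continuous_map T (subtopology T N) pN" "continuous_map T (subtopology T H) pH"
    "\<And>g. g \<in> carrier G \<Longrightarrow> pN g \<in> N \<and> pH g \<in> H \<and> g = pN g \<otimes>\<^bsub>G\<^esub> pH g"
    "\<And>n h. n \<in> N \<Longrightarrow> h \<in> H \<Longrightarrow> pN (n \<otimes>\<^bsub>G\<^esub> h) = n \<and> pH (n \<otimes>\<^bsub>G\<^esub> h) = h"
    "pH \<in> hom G (subgrp G H)"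
proof -
  interpret topological_grp G T by (rule topological_grpI[OF G])
  have N: "N \<lhd> G" and H: "subgroup H G"
    and hm: "homeomorphic_map (prod_topology (subtopology T N) (subtopology T H)) T (\<lambda>(n, h). n \<otimes> h)"
    using semi by (auto simp: topological_semidirect_def)
  interpret N: normal N G by fact
  have NG: "n \<in> carrier G" if "n \<in> N" for n using that N.subset by blast
  have HG: "h \<in> carrier G" if "h \<in> H" for h using that subgroup.subset[OF H] by blast
  obtain p where p: "homeomorphic_maps (prod_topology (subtopology T N) (subtopology T H)) T (\<lambda>(n, h). n \<otimes> h) p"
    using hm by (auto simp: homeomorphic_map_maps)
  then have pc: "continuous_map T (prod_topology (subtopology T N) (subtopology T H)) p"
    and p1: "\<And>n h. n \<in> N \<Longrightarrow> h \<in> H \<Longrightarrow> p (n \<otimes> h) = (n, h)"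
    and p2: "\<And>g. g \<in> carrier G \<Longrightarrow> (\<lambda>(n, h). n \<otimes> h) (p g) = g"
    using NG HG by (auto simp: homeomorphic_maps_def)
  have pm: "p g \<in> N \<times> H" if "g \<in> carrier G" for g
    using continuous_map_image_subset_topspace[OF pc] that by auto
  have dec: "fst (p g) \<in> N \<and> snd (p g) \<in> H \<and> g = fst (p g) \<otimes> snd (p g)" if "g \<in> carrier G" for g
    using pm[OF that] p2[OF that] by (auto simp: case_prod_unfold mem_Times_iff)
  have "(snd \<circ> p) \<in> hom G (subgrp G H)"
  proof (rule homI)
    fix x y assume x: "x \<in> carrier G" and y: "y \<in> carrier G"
    show "(snd \<circ> p) x \<in> carrier (subgrp G H)" using dec[OF x] by simp
    define n h n' h' where d: "n = fst (p x)" "h = snd (p x)" "n' = fst (p y)" "h' = snd (p y)"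
    have m: "n \<in> N" "h \<in> H" "x = n \<otimes> h" "n' \<in> N" "h' \<in> H" "y = n' \<otimes> h'"
      using dec[OF x] dec[OF y] by (auto simp: d)
    note c = NG[OF m(1)] HG[OF m(2)] NG[OF m(4)] HG[OF m(5)]
    have "x \<otimes> y = (n \<otimes> (h \<otimes> n' \<otimes> inv h)) \<otimes> (h \<otimes> h')"
    proof -
      have "inv h \<otimes> (h \<otimes> h') = h'" using c by (simp flip: m_assoc)
      then show ?thesis using c m(3,6) by (simp add: m_assoc)
    qed
    moreover have "n \<otimes> (h \<otimes> n' \<otimes> inv h) \<in> N" using m c by (intro N.m_closed N.inv_op_closed2)
    moreover have "h \<otimes> h' \<in> H" using m by (simp add: subgroup.m_closed[OF H])
    ultimately have "snd (p (x \<otimes> y)) = h \<otimes> h'" using p1 by simp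
    then show "(snd \<circ> p) (x \<otimes>\<^bsub>G\<^esub> y) = (snd \<circ> p) x \<otimes>\<^bsub>subgrp G H\<^esub> (snd \<circ> p) y" by (simp add: d)
  qed
  moreover have "continuous_map T (subtopology T N) (fst \<circ> p)" "continuous_map T (subtopology T H) (snd \<circ> p)"
    using pc continuous_map_compose continuous_map_fst continuous_map_snd by blast+
  ultimately show thesis using dec p1 by (intro that[of "fst \<circ> p" "snd \<circ> p"]) auto
qed

text \<open>
  The group \<open>L\<close> is the product \<open>B H\<close>, where \<open>B\<close> is the intersection of the kernels \<open>A h\<close> of all
  conjugates of \<open>\<sigma>\<close>. Only kernels matter: \<open>A h\<close> depends on the class of the conjugate alone, so
  periodicity leaves finitely many of them, and \<open>B\<close> is open and of finite index in \<open>N\<close>. The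
  subgroup \<open>H\<close> permutes the \<open>A h\<close>, and each \<open>A h\<close> is normal in \<open>N\<close>, so \<open>B\<close> is normal in \<open>G\<close>.
\<close>

lemma open_finite_index_subgroup_of_periodic_rep:
  fixes G (structure)
  assumes G: "topological_group G T" and semi: "topological_semidirect G T N H"
    and c: "c \<in> periodic_finite_dual G T N H" and \<sigma>: "(n, \<sigma>) \<in> c"
  obtains L where "subgroup L G" "openin T L" "finite (rcosets\<^bsub>G\<^esub> L)"
    "\<And>x. x \<in> N \<Longrightarrow> x \<in> L \<Longrightarrow> \<sigma> x = 1\<^sub>m n"
proof -
  interpret topological_grp G T by (rule topological_grpI[OF G])
  have N: "N \<lhd> G" and H: "subgroup H G"
    using semi by (auto simp: topological_semidirect_def)
  interpret N: normal N G by fact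
  have NG: "n \<in> carrier G" if "n \<in> N" for n using that N.subset by blast
  have HG: "h \<in> carrier G" if "h \<in> H" for h using that subgroup.subset[OF H] by blast
  have H1: "\<one> \<in> H" by (rule subgroup.one_closed[OF H])
  have cd: "c \<in> finite_dual (subgrp G N) (subtopology T N)"
    and orb: "finite (orbit (subgrp G H) (conj_class G N) c)"
    using c by (auto simp: periodic_finite_dual_def)
  note cls = finite_dual_class[OF cd \<sigma>]
  have rep: "unitary_rep (subgrp G N) (subtopology T N) n \<sigma>" and fin: "finite (\<sigma> ` N)"
    using cls(1) by (auto simp: finite_irreps_def)
  interpret \<sigma>: group_hom "subgrp G N" "unitary_group n" \<sigma>
    using rep group_unitary_group subgroup_imp_group[OF N.is_subgroup]
    by (simp add: group_hom_def group_hom_axioms_def unitary_rep_def)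
  have \<sigma>c: "\<sigma> x \<in> carrier (unitary_group n)" if "x \<in> N" for x using \<sigma>.hom_closed that by simp
  have \<sigma>m: "\<sigma> (x \<otimes> y) = \<sigma> x * \<sigma> y" if "x \<in> N" "y \<in> N" for x y
    using \<sigma>.hom_mult[of x y] that by simp
  have \<sigma>1: "\<sigma> \<one> = 1\<^sub>m n" using \<sigma>.hom_one by simp
  define s where "s h x = \<sigma> (inv h \<otimes> x \<otimes> h)" for h x
  have sN: "inv h \<otimes> x \<otimes> h \<in> N" if "h \<in> carrier G" "x \<in> N" for h x
    using that N.inv_op_closed1 by blast
  have sm: "s h (x \<otimes> y) = s h x * s h y" if "h \<in> carrier G" "x \<in> N" "y \<in> N" for h x y
  proof -
    have "h \<otimes> (inv h \<otimes> (y \<otimes> h)) = y \<otimes> h" using that NG by (simp flip: m_assoc)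
    then have "inv h \<otimes> (x \<otimes> y) \<otimes> h = (inv h \<otimes> x \<otimes> h) \<otimes> (inv h \<otimes> y \<otimes> h)"
      using that NG by (simp add: m_assoc)
    then show ?thesis unfolding s_def using \<sigma>m sN that by simp
  qed
  define A where "A h = {x \<in> N. s h x = 1\<^sub>m n}" for h
  have "finite (A ` H)"
  proof (rule finite_image_factor)
    have "orbit (subgrp G H) (conj_class G N) c = (\<lambda>h. conj_class G N h c) ` H"
      by (auto simp: orbit_def)
    then show "finite ((\<lambda>h. conj_class G N h c) ` H)" using orb by simp
    fix h h' assume h: "h \<in> H" "h' \<in> H" and eq: "conj_class G N h c = conj_class G N h' c"
    have "conj_rep G N h (n, \<sigma>) \<in> conj_class G N h c"
      using \<sigma> unfolding conj_class_def by (rule imageI)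
    then have "conj_rep G N h (n, \<sigma>) \<in> conj_class G N h' c" by (simp only: eq)
    then obtain m \<tau> where \<tau>: "(m, \<tau>) \<in> c" "conj_rep G N h (n, \<sigma>) = conj_rep G N h' (m, \<tau>)"
      unfolding conj_class_def by auto
    have "s h x = \<tau> (inv h' \<otimes> x \<otimes> h')" if "x \<in> N" for x
      using \<tau>(2) that unfolding conj_rep_def s_def
      by (simp add: restrict_def fun_eq_iff split: if_splits)
    then show "A h = A h'"
      using cls(3)[OF \<tau>(1)] sN[OF HG[OF h(2)]] by (auto simp: A_def s_def)
  qed
  \<comment> \<open>A finite set of representatives turns the intersection over \<open>H\<close> into a finite one.\<close>
  then obtain H0 where H0: "H0 \<subseteq> H" "finite H0" "A ` H = A ` H0"
    by (metis finite_subset_image order_refl)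
  define B where "B = {x \<in> N. \<forall>h \<in> H. s h x = 1\<^sub>m n}"
  have B_eq: "B = {x \<in> N. \<forall>h \<in> H0. s h x = 1\<^sub>m n}"
  proof -
    have "B = {x \<in> N. \<forall>K \<in> A ` H. x \<in> K}" by (auto simp: A_def B_def)
    then show ?thesis unfolding H0(3) by (auto simp: A_def)
  qed
  have s1: "s h \<one> = 1\<^sub>m n" if "h \<in> carrier G" for h using that \<sigma>1 by (simp add: s_def)
  have sinv: "s h (inv x) = 1\<^sub>m n" if "h \<in> carrier G" "x \<in> N" "s h x = 1\<^sub>m n" for h x
  proof -
    have "s h (inv x) \<in> carrier (unitary_group n)" using \<sigma>c sN that by (simp add: s_def)
    then have "s h (inv x) = s h (inv x) * s h x" using that(3) unitary_groupD(1) by fastforce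
    also have "\<dots> = 1\<^sub>m n" using sm[of h "inv x" x] s1 that NG by simp
    finally show ?thesis .
  qed
  have Bsub: "B \<subseteq> N" by (auto simp: B_def)
  have B1: "\<one> \<in> B" using s1 HG by (simp add: B_def)
  have Bm: "x \<otimes> y \<in> B" if "x \<in> B" "y \<in> B" for x y
    using that sm HG by (auto simp: B_def)
  have Bi: "inv x \<in> B" if "x \<in> B" for x
    using that sinv HG by (auto simp: B_def)
  obtain pN pH where pr: "continuous_map T (subtopology T N) pN" "continuous_map T (subtopology T H) pH"
    "\<And>g. g \<in> carrier G \<Longrightarrow> pN g \<in> N \<and> pH g \<in> H \<and> g = pN g \<otimes> pH g"
    "\<And>n h. n \<in> N \<Longrightarrow> h \<in> H \<Longrightarrow> pN (n \<otimes> h) = n \<and> pH (n \<otimes> h) = h"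
    by (rule semidirect_projections[OF G semi]) blast
  have Bconj: "g \<otimes> x \<otimes> inv g \<in> B" if g: "g \<in> carrier G" and x: "x \<in> B" for g x
    unfolding B_def
  proof (intro CollectI conjI ballI)
    have xN: "x \<in> N" using x Bsub by blast
    show "g \<otimes> x \<otimes> inv g \<in> N" using N.inv_op_closed2[OF g xN] .
    fix h assume h: "h \<in> H"
    \<comment> \<open>Conjugation by \<open>inv h \<otimes> g = m \<otimes> k\<close> first moves \<open>x\<close> to \<open>k \<otimes> x \<otimes> inv k\<close>, which \<open>\<sigma>\<close> kills because
      \<open>inv k \<in> H\<close>, and then conjugates by \<open>m \<in> N\<close>, which preserves the kernel of \<open>\<sigma>\<close>.\<close>
    define m k where "m = pN (inv h \<otimes> g)" and "k = pH (inv h \<otimes> g)"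
    have mk: "m \<in> N" "k \<in> H" "inv h \<otimes> g = m \<otimes> k"
      using pr(3)[of "inv h \<otimes> g"] g HG[OF h] by (auto simp: m_def k_def)
    note cs = g HG[OF h] NG[OF mk(1)] HG[OF mk(2)] NG[OF xN]
    have kx: "k \<otimes> x \<otimes> inv k \<in> N" using N.inv_op_closed2[OF HG[OF mk(2)] xN] .
    have "inv k \<in> H" using mk(2) by (rule subgroup.m_inv_closed[OF H])
    then have "s (inv k) x = 1\<^sub>m n" using x by (simp add: B_def)
    then have kx1: "\<sigma> (k \<otimes> x \<otimes> inv k) = 1\<^sub>m n" using cs by (simp add: s_def)
    have "inv h \<otimes> (g \<otimes> x \<otimes> inv g) \<otimes> h = (inv h \<otimes> g) \<otimes> x \<otimes> inv (inv h \<otimes> g)"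
      using cs by (simp add: m_assoc inv_mult_group)
    also have "\<dots> = m \<otimes> (k \<otimes> x \<otimes> inv k) \<otimes> inv m"
      unfolding mk(3) using cs by (simp add: m_assoc inv_mult_group)
    finally have "s h (g \<otimes> x \<otimes> inv g) = \<sigma> m * \<sigma> (k \<otimes> x \<otimes> inv k) * \<sigma> (inv m)"
      unfolding s_def using mk(1) kx \<sigma>m by (simp add: N.m_closed)
    also have "\<dots> = \<sigma> m * \<sigma> (inv m)"
      using kx1 unitary_groupD(1)[OF \<sigma>c[OF mk(1)]] by simp
    also have "\<dots> = 1\<^sub>m n" using \<sigma>m[of m "inv m"] mk(1) cs \<sigma>1 by simp
    finally show "s h (g \<otimes> x \<otimes> inv g) = 1\<^sub>m n" .
  qed
  define L where "L = {g \<in> carrier G. pN g \<in> B}"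
  have LI: "b \<otimes> h \<in> L" if "b \<in> B" "h \<in> H" for b h
    using that pr(4)[of b h] Bsub NG HG by (auto simp: L_def)
  have LE: "\<exists>b\<in>B. \<exists>h\<in>H. g = b \<otimes> h" if "g \<in> L" for g
    using that pr(3)[of g] by (auto simp: L_def)
  have L: "subgroup L G"
  proof (rule subgroupI)
    show "L \<subseteq> carrier G" by (auto simp: L_def)
    show "L \<noteq> {}" using LI[OF B1 H1] by blast
    fix x y assume x: "x \<in> L"
    obtain b h where bh: "b \<in> B" "h \<in> H" "x = b \<otimes> h" using LE[OF x] by blast
    have bG: "b \<in> carrier G" using bh(1) Bsub NG by blast
    note hG = HG[OF bh(2)]
    have "inv x = (inv h \<otimes> inv b \<otimes> inv (inv h)) \<otimes> inv h"
      using bG hG by (simp add: bh(3) inv_mult_group m_assoc)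
    then show "inv x \<in> L"
      using LI Bconj[of "inv h" "inv b"] Bi[OF bh(1)] subgroup.m_inv_closed[OF H bh(2)] hG by simp
    assume y: "y \<in> L"
    obtain b' h' where bh': "b' \<in> B" "h' \<in> H" "y = b' \<otimes> h'" using LE[OF y] by blast
    have b'G: "b' \<in> carrier G" using bh'(1) Bsub NG by blast
    note h'G = HG[OF bh'(2)]
    have "inv h \<otimes> (h \<otimes> h') = h'" using hG h'G by (simp flip: m_assoc)
    then have "x \<otimes> y = (b \<otimes> (h \<otimes> b' \<otimes> inv h)) \<otimes> (h \<otimes> h')"
      using bG hG b'G h'G by (simp add: bh(3) bh'(3) m_assoc)
    then show "x \<otimes> y \<in> L"
      using LI Bm[OF bh(1) Bconj[OF hG bh'(1)]] subgroup.m_closed[OF H bh(2) bh'(2)] by simp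
  qed
  have "openin (subtopology T N) {x \<in> N. s h x = 1\<^sub>m n}" if h: "h \<in> H" for h
  proof -
    have "continuous_map (subtopology T N) T (\<lambda>x. x)"
      by (intro continuous_map_from_subtopology continuous_map_id[unfolded id_def])
    then have "continuous_map (subtopology T N) T (\<lambda>x. inv h \<otimes> x \<otimes> h)"
      using HG[OF h] by (intro continuous_map_mult) auto
    then have "continuous_map (subtopology T N) (subtopology T N) (\<lambda>x. inv h \<otimes> x \<otimes> h)"
      using sN HG[OF h] by (auto simp: continuous_map_in_subtopology)
    moreover have "topspace (subtopology T N) = N" using NG by auto
    moreover have "openin (subtopology T N) {x \<in> carrier (subgrp G N). \<sigma> x = 1\<^sub>m n}"
      by (rule openin_finite_rep_fibre)
        (use rep fin NG \<sigma>1 N.one_closed in \<open>auto intro!: image_eqI[of _ _ \<one>]\<close>)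
    ultimately have "openin (subtopology T N) {x \<in> N. inv h \<otimes> x \<otimes> h \<in> {x \<in> N. \<sigma> x = 1\<^sub>m n}}"
      using openin_continuous_map_preimage by fastforce
    moreover have "{x \<in> N. inv h \<otimes> x \<otimes> h \<in> {x \<in> N. \<sigma> x = 1\<^sub>m n}} = {x \<in> N. s h x = 1\<^sub>m n}"
      using sN HG[OF h] by (auto simp: s_def)
    ultimately show ?thesis by simp
  qed
  then have "openin (subtopology T N) (topspace (subtopology T N) \<inter> (\<Inter>h\<in>H0. {x \<in> N. s h x = 1\<^sub>m n}))"
    using H0(1,2) by (intro openin_Int_Inter openin_topspace) auto
  moreover have "topspace (subtopology T N) \<inter> (\<Inter>h\<in>H0. {x \<in> N. s h x = 1\<^sub>m n}) = B"
    unfolding B_eq using NG by auto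
  ultimately have "openin (subtopology T N) B" by simp
  then have "openin T L"
    unfolding L_def using openin_continuous_map_preimage[OF pr(1)] by fastforce
  moreover have "finite (rcosets L)"
  proof -
    \<comment> \<open>Since \<open>G = H N\<close> and \<open>H \<subseteq> L\<close>, every coset of \<open>L\<close> is represented by an element \<open>x\<close> of \<open>N\<close>. It is
      determined by the values \<open>s h x\<close> for the finitely many \<open>h\<close> in \<open>H0\<close>.\<close>
    have "rcosets L \<subseteq> (\<lambda>x. L #> x) ` N"
    proof
      fix C assume "C \<in> rcosets L"
      then obtain g where g: "g \<in> carrier G" "C = L #> g" by (auto simp: RCOSETS_def)
      define h where "h = pH g"
      have h: "h \<in> H" "g = pN g \<otimes> h" "pN g \<in> N" using pr(3)[OF g(1)] by (auto simp: h_def)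
      define x where "x = inv h \<otimes> pN g \<otimes> h"
      have x: "x \<in> N" unfolding x_def using sN HG h by blast
      have hL: "h \<in> L" using LI[OF B1 h(1)] HG h by simp
      have "g = h \<otimes> x"
        unfolding x_def using h HG[OF h(1)] NG[OF h(3)] by (metis inv_closed m_assoc m_closed r_inv l_one)
      then have "C = (L #> h) #> x"
        using g HG[OF h(1)] NG[OF x] subgroup.subset[OF L] by (simp add: coset_mult_assoc)
      also have "L #> h = L" using HG[OF h(1)] L hL by (simp add: coset_join2)
      finally show "C \<in> (\<lambda>x. L #> x) ` N" using x by blast
    qed
    moreover have "finite ((\<lambda>x. L #> x) ` N)"
    proof (rule finite_image_factor)
      let ?u = "\<lambda>x. \<lambda>h\<in>H0. s h x"
      have "?u ` N \<subseteq> H0 \<rightarrow>\<^sub>E \<sigma> ` N"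
        using sN HG H0(1) by (auto simp: s_def)
      moreover have "finite (H0 \<rightarrow>\<^sub>E \<sigma> ` N)" using H0(2) fin by (simp add: finite_PiE)
      ultimately show "finite (?u ` N)" by (rule finite_subset)
      fix x y assume x: "x \<in> N" and y: "y \<in> N" and eq: "?u x = ?u y"
      have "s h (x \<otimes> inv y) = 1\<^sub>m n" if h: "h \<in> H0" for h
      proof -
        have hG: "h \<in> carrier G" using h H0(1) HG by blast
        have "s h x = s h y" using eq h by (metis restrict_apply')
        then have "s h (x \<otimes> inv y) = s h y * s h (inv y)" using sm[of h x "inv y"] x y hG by simp
        also have "\<dots> = 1\<^sub>m n" using sm[of h y "inv y"] s1 x y hG NG by simp
        finally show ?thesis .
      qed
      then have "x \<otimes> inv y \<in> B" unfolding B_eq using x y by simp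
      then have "x \<otimes> inv y \<in> L" using LI[OF _ H1] NG x y by fastforce
      then have "L #> (x \<otimes> inv y) = L" using NG x y L by (simp add: coset_join2)
      then show "L #> x = L #> y"
        using NG x y subgroup.subset[OF L] by (intro coset_mult_inv1) auto
    qed
    ultimately show ?thesis by (rule finite_subset)
  qed
  moreover have "\<sigma> x = 1\<^sub>m n" if "x \<in> N" "x \<in> L" for x
  proof -
    have "pN x = x" using pr(4)[OF that(1) H1] NG that by simp
    then have "x \<in> B" using that by (simp add: L_def)
    then have "s \<one> x = 1\<^sub>m n" using H1 by (simp add: B_def)
    then show ?thesis using NG that by (simp add: s_def)
  qed
  ultimately show thesis using L that by blast
qed

section \<open>The completion of a semi-direct product\<close>

text \<open>
  The map \<open>\<psi>N\<close> is regarded as a homomorphism to all of \<open>PG\<close>, so that it can be composed with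
  homomorphisms defined on \<open>PG\<close>.
\<close>

locale semidirect_completion =
  fixes G :: "'g monoid" (structure) and T :: "'g topology" and N H :: "'g set"
    and PG :: "'p monoid" and TG :: "'p topology" and \<alpha>G :: "'g \<Rightarrow> 'p"
    and PN :: "'q monoid" and TN :: "'q topology" and \<alpha>N :: "'g \<Rightarrow> 'q"
    and \<psi>N :: "'q \<Rightarrow> 'p"
  assumes tgG: "topological_group G T" and semi: "topological_semidirect G T N H"
    and PG: "profinite_completion G T PG TG \<alpha>G"
    and PN: "profinite_completion (subgrp G N) (subtopology T N) PN TN \<alpha>N"
    and \<psi>N: "continuous_hom PN TN PG TG \<psi>N" and \<psi>N_\<alpha>N: "n \<in> N \<Longrightarrow> \<psi>N (\<alpha>N n) = \<alpha>G n"
begin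

sublocale G: topological_grp G T
  by (rule topological_grpI[OF tgG])

sublocale PG: topological_grp PG TG
  by (rule completion_topological_grp[OF tgG PG])

lemma normal_N: "N \<lhd> G" and subgroup_H: "subgroup H G"
  using semi by (auto simp: topological_semidirect_def)

sublocale N: normal N G by (rule normal_N)

lemma N_carrier: "n \<in> N \<Longrightarrow> n \<in> carrier G"
  using N.subset by blast

lemma H_carrier: "h \<in> H \<Longrightarrow> h \<in> carrier G"
  using subgroup.subset[OF subgroup_H] by blast

lemma tgN: "topological_group (subgrp G N) (subtopology T N)"
  by (rule topological_group_subgrp[OF tgG N.is_subgroup])

sublocale PN: topological_grp PN TN
  by (rule completion_topological_grp[OF tgN PN])

lemmas HausdorffG = completion_Hausdorff[OF tgG PG]

lemma denseN: "TN closure_of (\<alpha>N ` N) = carrier PN"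
  using completion_dense[OF tgN PN] by simp

lemmas denseG = completion_dense[OF tgG PG]

sublocale \<alpha>G: group_hom G PG \<alpha>G
  by (rule completion_group_hom[OF tgG PG])

sublocale \<psi>N: group_hom PN PG \<psi>N
  using \<psi>N by (simp add: group_hom_def group_hom_axioms_def continuous_hom_def PN.is_group PG.is_group)

lemma \<psi>N_continuous: "continuous_map TN TG \<psi>N"
  using \<psi>N by (simp add: continuous_hom_def)

lemma \<alpha>N_carrier: "n \<in> N \<Longrightarrow> \<alpha>N n \<in> carrier PN"
  using completion_hom[OF tgN PN] by (auto simp: hom_def)

text \<open>
  The finite quotient \<open>f\<close> of \<open>G\<close> extends to a homomorphism \<open>f'\<close> on \<open>PG\<close>. If \<open>f' (\<psi>N z) = \<one>\<close>, then
  \<open>\<rho> z = 1\<close>: this holds for \<open>z\<close> in the dense image of \<open>N\<close>, and it is a closed condition on \<open>z\<close> because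
  \<open>f'\<close> has a discrete target.
\<close>

lemma kernel_in_prof_rep_kernel:
  assumes c: "c \<in> periodic_finite_dual G T N H" "(n, \<sigma>) \<in> c"
    and x: "x \<in> carrier PN" "\<psi>N x = \<one>\<^bsub>PG\<^esub>"
  shows "prof_rep (subgrp G N) PN TN \<alpha>N n \<sigma> x = 1\<^sub>m n"
proof -
  have "(n, \<sigma>) \<in> finite_irreps (subgrp G N) (subtopology T N)"
    using c finite_dual_class(1) by (auto simp: periodic_finite_dual_def)
  then have "unitary_rep (subgrp G N) (subtopology T N) n \<sigma>" "finite (\<sigma> ` carrier (subgrp G N))"
    by (auto simp: finite_irreps_def)
  note ext = prof_rep_extends[OF tgN PN this]
  define \<rho> where "\<rho> = prof_rep (subgrp G N) PN TN \<alpha>N n \<sigma>"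
  have \<rho>: "unitary_rep PN TN n \<rho>" and \<rho>\<alpha>: "\<And>m. m \<in> N \<Longrightarrow> \<rho> (\<alpha>N m) = \<sigma> m"
    using ext by (auto simp: \<rho>_def)
  obtain L where L: "subgroup L G" "openin T L" "finite (rcosets L)"
    "\<And>x. x \<in> N \<Longrightarrow> x \<in> L \<Longrightarrow> \<sigma> x = 1\<^sub>m n"
    by (rule open_finite_index_subgroup_of_periodic_rep[OF tgG semi c]) blast
  define F where "F = BijGroup (rcosets L)"
  obtain f where f: "continuous_hom G T F (discrete_topology (carrier F)) f"
    "\<And>g. g \<in> carrier G \<Longrightarrow> f g = \<one>\<^bsub>F\<^esub> \<Longrightarrow> g \<in> L"
    unfolding F_def by (rule G.finite_coset_action[OF L(1-3)]) blast
  have "profinite_group F (discrete_topology (carrier F))"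
    unfolding F_def by (intro profinite_group_discrete group_BijGroup finite_BijGroup L(3))
  then obtain f' where f': "continuous_hom PG TG F (discrete_topology (carrier F)) f'"
    "\<And>x. x \<in> carrier G \<Longrightarrow> f x = f' (\<alpha>G x)"
    using profinite_completion_universal[OF tgG PG _ f(1)] by blast
  interpret f': group_hom PG F f'
    using f'(1) by (simp add: group_hom_def group_hom_axioms_def continuous_hom_def F_def group_BijGroup PG.is_group)
  have cont: "continuous_map TN (discrete_topology (carrier F)) (f' \<circ> \<psi>N)"
    using continuous_map_compose[OF \<psi>N_continuous] f'(1) by (simp add: continuous_hom_def)
  have "f' (\<psi>N x) = \<one>\<^bsub>F\<^esub> \<longrightarrow> \<rho> x $$ (i, j) = 1\<^sub>m n $$ (i, j)" if ij: "i < n" "j < n" for i j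
  proof (rule forall_in_closure_of[of x TN "\<alpha>N ` N"])
    show "x \<in> TN closure_of (\<alpha>N ` N)" using x(1) by (simp add: denseN)
    fix z assume "z \<in> \<alpha>N ` N"
    then obtain m where m: "m \<in> N" "z = \<alpha>N m" by blast
    then show "f' (\<psi>N z) = \<one>\<^bsub>F\<^esub> \<longrightarrow> \<rho> z $$ (i, j) = 1\<^sub>m n $$ (i, j)"
      using f(2)[OF N_carrier[OF m(1)]] f'(2)[OF N_carrier[OF m(1)]] L(4) by (simp add: \<psi>N_\<alpha>N \<rho>\<alpha>)
  next
    have "closedin TN {z \<in> topspace TN. (f' \<circ> \<psi>N) z \<in> carrier F - {\<one>\<^bsub>F\<^esub>}}"
      by (rule closedin_continuous_map_preimage[OF cont]) simp
    moreover have "closedin TN {z \<in> topspace TN. \<rho> z $$ (i, j) \<in> {1\<^sub>m n $$ (i, j)}}"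
      using \<rho> ij by (intro closedin_continuous_map_preimage[of _ euclidean]) (simp_all add: unitary_rep_def)
    ultimately have "closedin TN ({z \<in> topspace TN. (f' \<circ> \<psi>N) z \<in> carrier F - {\<one>\<^bsub>F\<^esub>}}
        \<union> {z \<in> topspace TN. \<rho> z $$ (i, j) \<in> {1\<^sub>m n $$ (i, j)}})"
      by (rule closedin_Un)
    also have "\<dots> = {z \<in> topspace TN. f' (\<psi>N z) = \<one>\<^bsub>F\<^esub> \<longrightarrow> \<rho> z $$ (i, j) = 1\<^sub>m n $$ (i, j)}"
      by auto
    finally show "closedin TN {z \<in> topspace TN. f' (\<psi>N z) = \<one>\<^bsub>F\<^esub> \<longrightarrow> \<rho> z $$ (i, j) = 1\<^sub>m n $$ (i, j)}" .
  qed
  then have "\<rho> x $$ (i, j) = 1\<^sub>m n $$ (i, j)" if "i < n" "j < n" for i j using that x(2) by simp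
  moreover have "\<rho> x \<in> carrier_mat n n"
    using \<rho> x(1) by (auto simp: unitary_rep_def unitary_group_def hom_def)
  ultimately have "\<rho> x = 1\<^sub>m n" by (intro eq_matI) auto
  then show ?thesis by (simp add: \<rho>_def)
qed

text \<open>
  An irreducible representation \<open>\<pi>\<close> of the image of \<open>N\<close> in a finite quotient \<open>F\<close> of \<open>PG\<close>, pulled back
  to \<open>N\<close>. Replacing it by its conjugate under \<open>h\<close> amounts to conjugating by the image of \<open>h\<close> in \<open>F\<close>, so
  there are at most as many conjugates as elements of \<open>F\<close>.
\<close>

lemma periodic_class_of_finite_quotient:
  assumes F: "group F" "finite (carrier F)" and q: "continuous_hom PG TG F (discrete_topology (carrier F)) q"
    and n: "1 \<le> n" and \<pi>: "\<pi> \<in> hom (subgrp F (q ` \<alpha>G ` N)) (unitary_group n)"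
    and irr\<pi>: "irreducible_rep (subgrp F (q ` \<alpha>G ` N)) n \<pi>"
  obtains c \<sigma> where "c \<in> periodic_finite_dual G T N H" "(n, \<sigma>) \<in> c"
    "\<And>x. x \<in> carrier PN \<Longrightarrow> prof_rep (subgrp G N) PN TN \<alpha>N n \<sigma> x = \<pi> (q (\<psi>N x))"
proof -
  interpret q: group_hom PG F q
    using q by (simp add: group_hom_def group_hom_axioms_def continuous_hom_def F PG.is_group)
  define r where "r = (\<lambda>g. q (\<alpha>G g))"
  have rhom: "r \<in> hom G F" using hom_compose[OF \<alpha>G.homh q.homh] by (simp add: r_def o_def)
  interpret r: group_hom G F r
    using rhom by (simp add: group_hom_def group_hom_axioms_def q.H.is_group G.is_group)
  have rcont: "continuous_map T (discrete_topology (carrier F)) r"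
    using continuous_map_compose[OF completion_continuous[OF tgG PG]] q
    by (auto simp: r_def continuous_hom_def o_def)
  have rN: "q ` \<alpha>G ` N = r ` N" by (auto simp: r_def)
  define E where "E = subgrp F (r ` N)"
  have sE: "subgroup (r ` N) F" by (rule r.subgroup_img_is_subgroup[OF N.is_subgroup])
  have cE: "carrier E = r ` N" by (simp add: E_def)
  have grpE: "group E" unfolding E_def by (rule q.H.subgroup_imp_group[OF sE])
  have finE: "finite (carrier E)"
    using F(2) subgroup.subset[OF sE] unfolding cE by (rule finite_subset[rotated])
  have oneE: "\<one>\<^bsub>E\<^esub> = \<one>\<^bsub>F\<^esub>" and multE: "a \<otimes>\<^bsub>E\<^esub> b = a \<otimes>\<^bsub>F\<^esub> b" for a b by (auto simp: E_def)
  have qcont: "continuous_map TN (discrete_topology (carrier F)) (\<lambda>z. q (\<psi>N z))"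
    using continuous_map_compose[OF \<psi>N_continuous] q by (auto simp: continuous_hom_def o_def)
  have qE: "q (\<psi>N z) \<in> r ` N" if z: "z \<in> carrier PN" for z
  proof (rule forall_in_closure_of[of z TN "\<alpha>N ` N"])
    show "z \<in> TN closure_of (\<alpha>N ` N)" using z by (simp add: denseN)
    show "closedin TN {z \<in> topspace TN. q (\<psi>N z) \<in> r ` N}"
      using subgroup.subset[OF sE] by (intro closedin_continuous_map_preimage[OF qcont]) simp
  qed (auto simp: \<psi>N_\<alpha>N r_def)
  note \<pi> = \<pi>[unfolded rN, folded E_def] and irr\<pi> = irr\<pi>[unfolded rN, folded E_def]
  define \<sigma> where "\<sigma> = (\<lambda>m \<in> N. \<pi> (r m))"
  have into_E: "continuous_hom K S E (discrete_topology (carrier E)) f"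
    if "f \<in> hom K F" "continuous_map S (discrete_topology (carrier F)) f" "f ` carrier K \<subseteq> r ` N"
      "topspace S = carrier K" for K :: "'x monoid" and S f
  proof -
    have top: "discrete_topology (carrier E) = subtopology (discrete_topology (carrier F)) (r ` N)"
      using subgroup.subset[OF sE] by (simp add: cE subtopology_discrete_topology Int_absorb1)
    have "continuous_map S (discrete_topology (carrier E)) f"
      unfolding top continuous_map_in_subtopology using that by auto
    moreover have "f \<in> hom K E" using that by (auto simp: hom_def E_def)
    ultimately show ?thesis by (simp add: continuous_hom_def)
  qed
  have "continuous_hom (subgrp G N) (subtopology T N) E (discrete_topology (carrier E)) r"
    using rhom continuous_map_from_subtopology[OF rcont] N_carrier
    by (intro into_E) (auto simp: hom_def)
  from unitary_rep_of_finite_quotient[OF tgN this \<pi> n]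
  have rep\<sigma>: "unitary_rep (subgrp G N) (subtopology T N) n \<sigma>" by (simp add: \<sigma>_def)
  have "continuous_hom PN TN E (discrete_topology (carrier E)) (\<lambda>z. q (\<psi>N z))"
    using hom_compose[OF \<psi>N.homh q.homh] qcont qE
    by (intro into_E) (auto simp: o_def)
  from unitary_rep_of_finite_quotient[OF PN.topological_group this \<pi> n]
  have "unitary_rep PN TN n (\<lambda>z \<in> carrier PN. \<pi> (q (\<psi>N z)))" .
  then have "prof_rep (subgrp G N) PN TN \<alpha>N n \<sigma> = (\<lambda>z \<in> carrier PN. \<pi> (q (\<psi>N z)))"
    by (rule prof_rep_eqI[OF tgN PN]) (simp add: \<alpha>N_carrier \<psi>N_\<alpha>N \<sigma>_def r_def)
  then have val: "prof_rep (subgrp G N) PN TN \<alpha>N n \<sigma> x = \<pi> (q (\<psi>N x))" if "x \<in> carrier PN" for x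
    using that by simp
  have "irreducible_rep (subgrp G N) n \<sigma>"
    using irr\<pi> by (simp add: irreducible_rep_def \<sigma>_def cE)
  moreover have "finite (\<sigma> ` N)"
  proof -
    have "\<sigma> ` N = \<pi> ` carrier E" by (auto simp: \<sigma>_def cE)
    then show ?thesis using finE by simp
  qed
  ultimately have irr: "(n, \<sigma>) \<in> finite_irreps (subgrp G N) (subtopology T N)"
    using rep\<sigma> by (simp add: finite_irreps_def)
  define c where "c = unitary_equivalence (subgrp G N) (subtopology T N) `` {(n, \<sigma>)}"
  have cfd: "c \<in> finite_dual (subgrp G N) (subtopology T N)"
    unfolding c_def finite_dual_def using irr by (rule quotientI)
  have \<sigma>c: "\<sigma> m \<in> carrier_mat n n" if "m \<in> N" for m
    using rep\<sigma> that by (auto simp: unitary_rep_def hom_def unitary_group_def)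
  have "\<sigma> m = 1\<^sub>m n * \<sigma> m * mat_adjoint (1\<^sub>m n)" if "m \<in> N" for m
    using \<sigma>c[OF that] by (simp add: mat_adjoint_one left_mult_one_mat[of _ n n] right_mult_one_mat[of _ n n])
  moreover have "1\<^sub>m n \<in> carrier (unitary_group n)"
    by (rule unitary_groupI) (simp_all add: mat_adjoint_one)
  ultimately have inc: "(n, \<sigma>) \<in> c"
    unfolding c_def unitary_equivalence_def using irr by auto
  have "finite ((\<lambda>h. conj_class G N h c) ` H)"
  proof (rule finite_image_factor[of r])
    show "finite (r ` H)"
      using F(2) H_carrier r.hom_closed by (meson finite_subset image_subsetI)
    fix h h' assume h: "h \<in> H" "h' \<in> H" "r h = r h'"
    have "conj_rep G N h p = conj_rep G N h' p" if p: "p \<in> c" for p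
    proof -
      obtain m \<tau> where p_eq: "p = (m, \<tau>)" by fastforce
      obtain U where U: "\<And>g. g \<in> N \<Longrightarrow> \<tau> g = U * \<sigma> g * mat_adjoint U"
        using p unfolding c_def p_eq unitary_equivalence_def by auto
      have "\<tau> (inv h \<otimes> z \<otimes> h) = \<tau> (inv h' \<otimes> z \<otimes> h')" if z: "z \<in> N" for z
      proof -
        have zN: "inv g \<otimes> z \<otimes> g \<in> N" if "g \<in> H" for g
          using N.inv_op_closed1 H_carrier that z by blast
        have "r (inv h \<otimes> z \<otimes> h) = r (inv h' \<otimes> z \<otimes> h')"
          using h z H_carrier N_carrier by simp
        then have "\<sigma> (inv h \<otimes> z \<otimes> h) = \<sigma> (inv h' \<otimes> z \<otimes> h')"
          using zN h by (simp add: \<sigma>_def)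
        then show ?thesis using U zN h by simp
      qed
      then show ?thesis by (auto simp: p_eq conj_rep_def restrict_def fun_eq_iff)
    qed
    then show "conj_class G N h c = conj_class G N h' c"
      unfolding conj_class_def by (intro image_cong) auto
  qed
  moreover have "orbit (subgrp G H) (conj_class G N) c = (\<lambda>h. conj_class G N h c) ` H"
    by (auto simp: orbit_def)
  ultimately have "c \<in> periodic_finite_dual G T N H"
    using cfd by (simp add: periodic_finite_dual_def)
  with inc val show thesis by (intro that)
qed

text \<open>
  An open subgroup \<open>V\<close> of \<open>PG\<close> that omits \<open>\<psi>N x\<close> gives a finite quotient \<open>q\<close> of \<open>PG\<close> that does not kill
  \<open>\<psi>N x\<close>. The value \<open>q (\<psi>N x)\<close> lies in the image \<open>E\<close> of the dense image of \<open>N\<close>, because \<open>E\<close> is closed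
  in the discrete topology; so an irreducible representation of \<open>E\<close> detects it.
\<close>

lemma prof_rep_detects_non_kernel:
  assumes x: "x \<in> carrier PN" "\<psi>N x \<noteq> \<one>\<^bsub>PG\<^esub>"
  obtains c n \<sigma> where "c \<in> periodic_finite_dual G T N H" "(n, \<sigma>) \<in> c"
    "prof_rep (subgrp G N) PN TN \<alpha>N n \<sigma> x \<noteq> 1\<^sub>m n"
proof -
  define y where "y = \<psi>N x"
  have y: "y \<in> carrier PG" "y \<noteq> \<one>\<^bsub>PG\<^esub>" using x by (auto simp: y_def)
  obtain V where V: "subgroup V PG" "openin TG V" "y \<notin> V"
    by (rule PG.profinite_open_subgroup[OF completion_profinite[OF tgG PG] y]) blast
  have finV: "finite (rcosets\<^bsub>PG\<^esub> V)"
    by (rule PG.finite_index_if_compact[OF completion_compact[OF tgG PG] V(1,2)])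
  define F where "F = BijGroup (rcosets\<^bsub>PG\<^esub> V)"
  obtain q where q: "continuous_hom PG TG F (discrete_topology (carrier F)) q"
    "\<And>g. g \<in> carrier PG \<Longrightarrow> q g = \<one>\<^bsub>F\<^esub> \<Longrightarrow> g \<in> V"
    unfolding F_def by (rule PG.finite_coset_action[OF V(1,2) finV]) blast
  have finF: "finite (carrier F)" unfolding F_def by (rule finite_BijGroup[OF finV])
  interpret q: group_hom PG F q
    using q(1) by (simp add: group_hom_def group_hom_axioms_def continuous_hom_def F_def group_BijGroup PG.is_group)
  have grpF: "group F" by (rule q.H.is_group)
  define E where "E = q ` \<alpha>G ` N"
  have sE: "subgroup E F"
    unfolding E_def by (intro q.subgroup_img_is_subgroup \<alpha>G.subgroup_img_is_subgroup N.is_subgroup)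
  have EF: "E \<subseteq> carrier F" by (rule subgroup.subset[OF sE])
  have "q y \<in> E"
  proof (rule forall_in_closure_of[of x TN "\<alpha>N ` N" "\<lambda>z. q (\<psi>N z) \<in> E", folded y_def])
    show "x \<in> TN closure_of (\<alpha>N ` N)" using x by (simp add: denseN)
    have "continuous_map TN (discrete_topology (carrier F)) (\<lambda>z. q (\<psi>N z))"
      using continuous_map_compose[OF \<psi>N_continuous] q(1) by (auto simp: continuous_hom_def o_def)
    then show "closedin TN {z \<in> topspace TN. q (\<psi>N z) \<in> E}"
      by (rule closedin_continuous_map_preimage) (simp add: EF)
  qed (auto simp: \<psi>N_\<alpha>N E_def)
  moreover have "q y \<noteq> \<one>\<^bsub>F\<^esub>" using q(2)[OF y(1)] V(3) by blast
  ultimately obtain n \<pi> where \<pi>: "1 \<le> n" "\<pi> \<in> hom (subgrp F E) (unitary_group n)"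
      "irreducible_rep (subgrp F E) n \<pi>" "\<pi> (q y) \<noteq> 1\<^sub>m n"
    using finite_group_separating_irrep[of "subgrp F E" "q y"] q.H.subgroup_imp_group[OF sE]
      finite_subset[OF EF finF] by auto
  obtain c \<sigma> where "c \<in> periodic_finite_dual G T N H" "(n, \<sigma>) \<in> c"
    "\<And>x. x \<in> carrier PN \<Longrightarrow> prof_rep (subgrp G N) PN TN \<alpha>N n \<sigma> x = \<pi> (q (\<psi>N x))"
    by (rule periodic_class_of_finite_quotient[OF grpF finF q(1) \<pi>(1) \<pi>(2,3)[unfolded E_def]]) blast
  then show thesis using that x(1) \<pi>(4) by (simp add: y_def)
qed

text \<open>
  The intersection that defines \<open>D\<close> runs over a non-empty family, since it includes the trivial
  representation; over an empty family it would be the whole type.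
\<close>

lemma periodic_kernel_carrier: "periodic_kernel G T N H PN TN \<alpha>N \<subseteq> carrier PN"
proof -
  let ?F = "subgrp PG {\<one>\<^bsub>PG\<^esub>}"
  have F: "group ?F" "finite (carrier ?F)"
    using PG.subgroup_imp_group[OF PG.triv_subgroup] by simp_all
  have q: "continuous_hom PG TG ?F (discrete_topology (carrier ?F)) (\<lambda>_. \<one>\<^bsub>PG\<^esub>)"
    by (auto simp: continuous_hom_def hom_def)
  interpret U: group "unitary_group 1" by (rule group_unitary_group)
  have \<pi>: "(\<lambda>_. 1\<^sub>m 1) \<in> hom (subgrp ?F ((\<lambda>_. \<one>\<^bsub>PG\<^esub>) ` \<alpha>G ` N)) (unitary_group 1)"
    using U.one_closed by (auto simp: hom_def)
  obtain c \<sigma> where "c \<in> periodic_finite_dual G T N H" "(1, \<sigma>) \<in> c"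
    by (rule periodic_class_of_finite_quotient[OF F q order_refl \<pi> irreducible_rep_dim_one]) blast
  then show ?thesis by (force simp: periodic_kernel_def kernel_def)
qed

theorem kernel_eq_periodic_kernel:
  "{x \<in> carrier PN. \<psi>N x = \<one>\<^bsub>PG\<^esub>} = periodic_kernel G T N H PN TN \<alpha>N"
proof
  show "{x \<in> carrier PN. \<psi>N x = \<one>\<^bsub>PG\<^esub>} \<subseteq> periodic_kernel G T N H PN TN \<alpha>N"
    using kernel_in_prof_rep_kernel by (auto simp: periodic_kernel_def kernel_def)
  show "periodic_kernel G T N H PN TN \<alpha>N \<subseteq> {x \<in> carrier PN. \<psi>N x = \<one>\<^bsub>PG\<^esub>}"
  proof
    fix x assume x: "x \<in> periodic_kernel G T N H PN TN \<alpha>N"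
    then have xc: "x \<in> carrier PN" using periodic_kernel_carrier by blast
    show "x \<in> {x \<in> carrier PN. \<psi>N x = \<one>\<^bsub>PG\<^esub>}"
    proof (rule ccontr)
      assume "x \<notin> {x \<in> carrier PN. \<psi>N x = \<one>\<^bsub>PG\<^esub>}"
      then obtain c n \<sigma> where "c \<in> periodic_finite_dual G T N H" "(n, \<sigma>) \<in> c"
          "prof_rep (subgrp G N) PN TN \<alpha>N n \<sigma> x \<noteq> 1\<^sub>m n"
        using prof_rep_detects_non_kernel xc by blast
      then show False using x by (auto simp: periodic_kernel_def kernel_def)
    qed
  qed
qed

text \<open>
  Both sides are continuous in \<open>x\<close> and agree on the dense image of \<open>N\<close>.
\<close>

lemma \<psi>N_prof_action:
  assumes h: "h \<in> carrier G" and x: "x \<in> carrier PN"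
  shows "prof_action G N PN TN \<alpha>N h x \<in> carrier PN"
    and "\<psi>N (prof_action G N PN TN \<alpha>N h x) = \<alpha>G h \<otimes>\<^bsub>PG\<^esub> \<psi>N x \<otimes>\<^bsub>PG\<^esub> inv\<^bsub>PG\<^esub> (\<alpha>G h)"
proof -
  note \<theta> = prof_action_extends_conjugation[OF tgG normal_N PN h]
  show "prof_action G N PN TN \<alpha>N h x \<in> carrier PN"
    using \<theta>(1) x by (auto simp: auto_def hom_def)
  show "\<psi>N (prof_action G N PN TN \<alpha>N h x) = \<alpha>G h \<otimes>\<^bsub>PG\<^esub> \<psi>N x \<otimes>\<^bsub>PG\<^esub> inv\<^bsub>PG\<^esub> (\<alpha>G h)"
  proof (rule continuous_maps_agree_if_dense[OF HausdorffG denseN _ _ _ x])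
    show "continuous_map TN TG (\<lambda>x. \<psi>N (prof_action G N PN TN \<alpha>N h x))"
      using continuous_map_compose[OF \<theta>(2) \<psi>N_continuous] by (simp add: o_def)
    show "continuous_map TN TG (\<lambda>x. \<alpha>G h \<otimes>\<^bsub>PG\<^esub> \<psi>N x \<otimes>\<^bsub>PG\<^esub> inv\<^bsub>PG\<^esub> (\<alpha>G h))"
      using h by (intro PG.continuous_map_mult \<psi>N_continuous) auto
    fix y assume "y \<in> \<alpha>N ` N"
    then obtain m where m: "m \<in> N" "y = \<alpha>N m" by blast
    have "h \<otimes> m \<otimes> inv h \<in> N" using N.inv_op_closed2[OF h m(1)] .
    then show "\<psi>N (prof_action G N PN TN \<alpha>N h y) = \<alpha>G h \<otimes>\<^bsub>PG\<^esub> \<psi>N y \<otimes>\<^bsub>PG\<^esub> inv\<^bsub>PG\<^esub> (\<alpha>G h)"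
      using m h N_carrier by (simp add: \<theta>(3) \<psi>N_\<alpha>N)
  qed
qed

lemma prof_action_image_kernel:
  assumes h: "h \<in> carrier G"
  shows "prof_action G N PN TN \<alpha>N h ` {x \<in> carrier PN. \<psi>N x = \<one>\<^bsub>PG\<^esub>} = {x \<in> carrier PN. \<psi>N x = \<one>\<^bsub>PG\<^esub>}"
proof -
  let ?\<theta> = "prof_action G N PN TN \<alpha>N h"
  have iff: "\<psi>N (?\<theta> x) = \<one>\<^bsub>PG\<^esub> \<longleftrightarrow> \<psi>N x = \<one>\<^bsub>PG\<^esub>" if x: "x \<in> carrier PN" for x
  proof -
    have c: "\<alpha>G h \<in> carrier PG" "\<psi>N x \<in> carrier PG" using h x by auto
    have "\<psi>N x = inv\<^bsub>PG\<^esub> (\<alpha>G h) \<otimes>\<^bsub>PG\<^esub> \<psi>N (?\<theta> x) \<otimes>\<^bsub>PG\<^esub> \<alpha>G h"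
    proof -
      have "inv\<^bsub>PG\<^esub> (\<alpha>G h) \<otimes>\<^bsub>PG\<^esub> (\<alpha>G h \<otimes>\<^bsub>PG\<^esub> \<psi>N x) = \<psi>N x" using c by (simp flip: PG.m_assoc)
      then show ?thesis unfolding \<psi>N_prof_action(2)[OF h x] using c by (simp add: PG.m_assoc)
    qed
    then show ?thesis using \<psi>N_prof_action(2)[OF h x] c by auto
  qed
  have "bij_betw ?\<theta> (carrier PN) (carrier PN)"
    using prof_action_extends_conjugation(1)[OF tgG normal_N PN h] by (simp add: auto_def Bij_def)
  then have img: "?\<theta> ` carrier PN = carrier PN" by (simp add: bij_betw_def)
  show ?thesis
  proof
    show "?\<theta> ` {x \<in> carrier PN. \<psi>N x = \<one>\<^bsub>PG\<^esub>} \<subseteq> {x \<in> carrier PN. \<psi>N x = \<one>\<^bsub>PG\<^esub>}"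
      using iff \<psi>N_prof_action(1)[OF h] by auto
    show "{x \<in> carrier PN. \<psi>N x = \<one>\<^bsub>PG\<^esub>} \<subseteq> ?\<theta> ` {x \<in> carrier PN. \<psi>N x = \<one>\<^bsub>PG\<^esub>}"
    proof
      fix y assume y: "y \<in> {x \<in> carrier PN. \<psi>N x = \<one>\<^bsub>PG\<^esub>}"
      then obtain x where x: "x \<in> carrier PN" "y = ?\<theta> x" using img by blast
      then show "y \<in> ?\<theta> ` {x \<in> carrier PN. \<psi>N x = \<one>\<^bsub>PG\<^esub>}" using y iff[OF x(1)] by blast
    qed
  qed
qed

text \<open>
  The image of \<open>N\<close> is normalised by the dense image of \<open>G\<close>, and \<open>(g, x) \<mapsto> g x g\<inverse>\<close> is jointly
  continuous.
\<close>

lemma closure_image_normal: "TG closure_of (\<alpha>G ` N) \<lhd> PG"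
proof -
  let ?C = "TG closure_of (\<alpha>G ` N)"
  have sub: "subgroup ?C PG"
    by (intro subgroup_closure_of[OF PG.topological_group] \<alpha>G.subgroup_img_is_subgroup N.is_subgroup)
  let ?c = "\<lambda>(g, x). g \<otimes>\<^bsub>PG\<^esub> x \<otimes>\<^bsub>PG\<^esub> inv\<^bsub>PG\<^esub> g"
  have "continuous_map (prod_topology TG TG) TG (\<lambda>p. fst p \<otimes>\<^bsub>PG\<^esub> snd p \<otimes>\<^bsub>PG\<^esub> inv\<^bsub>PG\<^esub> (fst p))"
    by (intro PG.continuous_map_conj continuous_map_fst continuous_map_snd)
  then have cont: "continuous_map (prod_topology TG TG) TG ?c" by (simp add: case_prod_unfold)
  have "?c ` (carrier PG \<times> ?C) = ?c ` (prod_topology TG TG closure_of (\<alpha>G ` carrier G \<times> \<alpha>G ` N))"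
    by (simp add: closure_of_Times denseG)
  also have "\<dots> \<subseteq> TG closure_of (?c ` (\<alpha>G ` carrier G \<times> \<alpha>G ` N))"
    by (rule continuous_map_image_closure_subset[OF cont])
  also have "\<dots> \<subseteq> ?C"
  proof (rule closure_of_mono, clarsimp)
    fix g m assume gm: "g \<in> carrier G" "m \<in> N"
    have "\<alpha>G g \<otimes>\<^bsub>PG\<^esub> \<alpha>G m \<otimes>\<^bsub>PG\<^esub> inv\<^bsub>PG\<^esub> \<alpha>G g = \<alpha>G (g \<otimes> m \<otimes> inv g)"
      using gm N_carrier by simp
    then show "\<alpha>G g \<otimes>\<^bsub>PG\<^esub> \<alpha>G m \<otimes>\<^bsub>PG\<^esub> inv\<^bsub>PG\<^esub> \<alpha>G g \<in> \<alpha>G ` N"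
      using N.inv_op_closed2[OF gm] by blast
  qed
  finally have "g \<otimes>\<^bsub>PG\<^esub> x \<otimes>\<^bsub>PG\<^esub> inv\<^bsub>PG\<^esub> g \<in> ?C" if "g \<in> carrier PG" "x \<in> ?C" for g x
    using that by auto
  then show ?thesis using sub by (auto simp: PG.normal_inv_iff)
qed

text \<open>
  The product of the two closures is compact, hence closed, and it contains the dense image of \<open>G\<close>.
\<close>

lemma closures_generate:
  "(TG closure_of (\<alpha>G ` N)) <#>\<^bsub>PG\<^esub> (TG closure_of (\<alpha>G ` H)) = carrier PG"
proof
  let ?A = "TG closure_of (\<alpha>G ` N)" and ?B = "TG closure_of (\<alpha>G ` H)"
  let ?m = "\<lambda>(x, y). x \<otimes>\<^bsub>PG\<^esub> y"
  have AB: "?A \<subseteq> carrier PG" "?B \<subseteq> carrier PG"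
    using closure_of_subset_topspace[of TG] by simp_all
  have eq: "?A <#>\<^bsub>PG\<^esub> ?B = ?m ` (?A \<times> ?B)" by (auto simp: set_mult_def)
  show "?A <#>\<^bsub>PG\<^esub> ?B \<subseteq> carrier PG" unfolding eq using AB by auto
  have cpt: "compactin TG ?A" "compactin TG ?B"
    using completion_compact[OF tgG PG] by (simp_all add: closedin_compact_space)
  have "continuous_map (prod_topology TG TG) TG ?m"
    using PG.topological_group by (simp add: topological_group_def)
  then have "compactin TG (?A <#>\<^bsub>PG\<^esub> ?B)"
    unfolding eq using cpt by (intro image_compactin[of "prod_topology TG TG"]) (simp_all add: compactin_Times)
  then have cl: "closedin TG (?A <#>\<^bsub>PG\<^esub> ?B)"
    using HausdorffG by (rule compactin_imp_closedin[rotated])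
  have "\<alpha>G ` carrier G \<subseteq> ?A <#>\<^bsub>PG\<^esub> ?B"
  proof
    fix z assume "z \<in> \<alpha>G ` carrier G"
    then obtain g where g: "g \<in> carrier G" "z = \<alpha>G g" by blast
    moreover have "N <#> H = carrier G" using semi by (simp add: topological_semidirect_def)
    ultimately obtain n h where nh: "n \<in> N" "h \<in> H" "g = n \<otimes> h"
      unfolding set_mult_def by blast
    have "\<alpha>G ` N \<subseteq> ?A" "\<alpha>G ` H \<subseteq> ?B"
      using N_carrier H_carrier by (auto intro!: closure_of_subset)
    then have "\<alpha>G n \<in> ?A" "\<alpha>G h \<in> ?B" using nh by auto
    moreover have "z = \<alpha>G n \<otimes>\<^bsub>PG\<^esub> \<alpha>G h" using g nh N_carrier H_carrier by simp
    ultimately show "z \<in> ?A <#>\<^bsub>PG\<^esub> ?B" by (auto simp: set_mult_def)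
  qed
  then have "TG closure_of (\<alpha>G ` carrier G) \<subseteq> ?A <#>\<^bsub>PG\<^esub> ?B" using cl by (rule closure_of_minimal)
  then show "carrier PG \<subseteq> ?A <#>\<^bsub>PG\<^esub> ?B" by (simp add: denseG)
qed

end

theorem theorem2:
  fixes G :: "'g monoid" and T :: "'g topology" and N H :: "'g set"
    and PG :: "'p monoid" and TG :: "'p topology" and \<alpha>G :: "'g \<Rightarrow> 'p"
    and PN :: "'q monoid" and TN :: "'q topology" and \<alpha>N :: "'g \<Rightarrow> 'q"
    and PH :: "'r monoid" and TH :: "'r topology" and \<alpha>H :: "'g \<Rightarrow> 'r"
    and \<psi>N :: "'q \<Rightarrow> 'p" and \<psi>H :: "'r \<Rightarrow> 'p"
    and clN clH :: "'p set" and D :: "'q set" and TQ :: "'q set topology"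
  assumes "locally_compact_group G T"
    and "topological_semidirect G T N H"
    and "profinite_completion G T PG TG \<alpha>G"
    and "profinite_completion (subgrp G N) (subtopology T N) PN TN \<alpha>N"
    and "profinite_completion (subgrp G H) (subtopology T H) PH TH \<alpha>H"
    and "clN = TG closure_of (\<alpha>G ` N)"
    and "clH = TG closure_of (\<alpha>G ` H)"
    and "continuous_hom PN TN (subgrp PG clN) (subtopology TG clN) \<psi>N"
    and "\<forall>n \<in> N. \<psi>N (\<alpha>N n) = \<alpha>G n"
    and "continuous_hom PH TH (subgrp PG clH) (subtopology TG clH) \<psi>H"
    and "\<forall>h \<in> H. \<psi>H (\<alpha>H h) = \<alpha>G h"
    and "D = periodic_kernel G T N H PN TN \<alpha>N"
    and "TQ = quotient_topology PN TN D"
  shows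
    "(kernel PN (subgrp PG clN) \<psi>N = D \<and> D \<lhd> PN \<and>
      (\<forall>x \<in> carrier PN. induced_map \<psi>N (D #>\<^bsub>PN\<^esub> x) = \<psi>N x) \<and>
      topological_iso (PN Mod D) TQ (subgrp PG clN) (subtopology TG clN) (induced_map \<psi>N))
   \<and> topological_iso PH TH (subgrp PG clH) (subtopology TG clH) \<psi>H
   \<and> (\<forall>h \<in> H. prof_action G N PN TN \<alpha>N h ` D = D)
   \<and> (\<exists>\<Phi>. continuous_action_by_automorphisms PH TH (PN Mod D) TQ \<Phi> \<and>
        (\<forall>h \<in> H. \<forall>x \<in> carrier PN.
           \<Phi> (\<alpha>H h) (D #>\<^bsub>PN\<^esub> x) = D #>\<^bsub>PN\<^esub> prof_action G N PN TN \<alpha>N h x) \<and>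
        topological_iso (semidirect_product (PN Mod D) PH \<Phi>) (prod_topology TQ TH) PG TG
          (\<lambda>(C, y). induced_map \<psi>N C \<otimes>\<^bsub>PG\<^esub> \<psi>H y))"
proof -
  have tgG: "topological_group G T" using assms(1) by (simp add: locally_compact_group_def)
  have sub: "clN \<subseteq> carrier PG" "clH \<subseteq> carrier PG"
    using closure_of_subset_topspace[of TG] topological_grp.topspace[OF completion_topological_grp[OF tgG assms(3)]]
    by (auto simp: assms(6,7))
  have \<psi>N: "continuous_hom PN TN PG TG \<psi>N" and \<psi>H: "continuous_hom PH TH PG TG \<psi>H"
    using assms(8,10) sub by (auto simp: continuous_hom_def hom_def continuous_map_in_subtopology)
  interpret semidirect_completion G T N H PG TG \<alpha>G PN TN \<alpha>N \<psi>N
    using tgG assms(2-4,9) \<psi>N by unfold_locales auto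
  have tgH: "topological_group (subgrp G H) (subtopology T H)"
    by (rule topological_group_subgrp[OF tgG subgroup_H])
  interpret PH: topological_grp PH TH by (rule completion_topological_grp[OF tgH assms(5)])
  have cptH: "compact_space TH" and cptN: "compact_space TN"
    using completion_compact[OF tgH assms(5)] completion_compact[OF tgN PN] by simp_all
  have denseH: "TH closure_of (\<alpha>H ` H) = carrier PH" using completion_dense[OF tgH assms(5)] by simp
  have \<alpha>Hc: "\<alpha>H h \<in> carrier PH" if "h \<in> H" for h
    using completion_hom[OF tgH assms(5)] that by (auto simp: hom_def)
  have \<psi>Hcont: "continuous_map TH TG \<psi>H" using \<psi>H by (simp add: continuous_hom_def)
  interpret \<psi>H: group_hom PH PG \<psi>H
    using \<psi>H by (simp add: group_hom_def group_hom_axioms_def continuous_hom_def PH.is_group PG.is_group)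
  have normclN: "clN \<lhd> PG" unfolding assms(6) by (rule closure_image_normal)
  have sclN: "subgroup clN PG" using normclN by (rule normal_imp_subgroup)
  have sclH: "subgroup clH PG"
    unfolding assms(7)
    by (intro subgroup_closure_of[OF PG.topological_group] \<alpha>G.subgroup_img_is_subgroup subgroup_H)
  have tclN: "topological_group (subgrp PG clN) (subtopology TG clN)"
    by (rule topological_group_subgrp[OF PG.topological_group sclN])
  have imgN: "\<psi>N ` carrier PN = clN"
    using compact_image_of_closure[OF cptN HausdorffG \<psi>N_continuous, of "\<alpha>N ` N"] \<alpha>N_carrier
    by (simp add: denseN image_subset_iff image_image \<psi>N_\<alpha>N assms(6) cong: image_cong)
  have imgH: "\<psi>H ` carrier PH = clH"
    using compact_image_of_closure[OF cptH HausdorffG \<psi>Hcont, of "\<alpha>H ` H"] \<alpha>Hc assms(11)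
    by (simp add: denseH image_subset_iff image_image assms(7) cong: image_cong)

  have ker: "kernel PN (subgrp PG clN) \<psi>N = D"
    using kernel_eq_periodic_kernel by (simp add: kernel_def assms(12))
  have D_eq: "D = {x \<in> carrier PN. \<psi>N x = \<one>\<^bsub>PG\<^esub>}"
    using kernel_eq_periodic_kernel assms(12) by simp
  \<comment> \<open>Surjectivity onto \<open>clN\<close> holds because the image of the compact group \<open>PN\<close> is the closure of the
    image of its dense subgroup.\<close>
  note first_iso = compact_first_isomorphism[OF PN.topological_group cptN tclN
      Hausdorff_space_subtopology[OF HausdorffG] assms(8), unfolded ker, simplified imgN, simplified, folded assms(13)]
  have "D \<lhd> PN" and ind: "\<And>x. x \<in> carrier PN \<Longrightarrow> induced_map \<psi>N (D #>\<^bsub>PN\<^esub> x) = \<psi>N x"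
    and isoN: "topological_iso (PN Mod D) TQ (subgrp PG clN) (subtopology TG clN) (induced_map \<psi>N)"
    using first_iso by auto

  obtain pN pH where pr: "continuous_map T (subtopology T H) pH"
    "\<And>n h. n \<in> N \<Longrightarrow> h \<in> H \<Longrightarrow> pN (n \<otimes>\<^bsub>G\<^esub> h) = n \<and> pH (n \<otimes>\<^bsub>G\<^esub> h) = h"
    "pH \<in> hom G (subgrp G H)"
    by (rule semidirect_projections[OF tgG assms(2)]) blast
  have "continuous_hom G T PH TH (\<alpha>H \<circ> pH)"
    using hom_compose[OF pr(3) completion_hom[OF tgH assms(5)]]
      continuous_map_compose[OF pr(1) completion_continuous[OF tgH assms(5)]]
    by (simp add: continuous_hom_def)
  \<comment> \<open>The retraction of \<open>PG\<close> onto \<open>PH\<close> that is induced by the projection of \<open>G\<close> onto \<open>H\<close>.\<close>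
  then obtain p where p: "continuous_hom PG TG PH TH p" "\<And>g. g \<in> carrier G \<Longrightarrow> \<alpha>H (pH g) = p (\<alpha>G g)"
    using profinite_completion_universal[OF tgG assms(3) completion_profinite[OF tgH assms(5)]] by fastforce
  have pcont: "continuous_map TG TH p" using p(1) by (simp add: continuous_hom_def)
  have one_H: "\<one>\<^bsub>G\<^esub> \<in> H" by (rule subgroup.one_closed[OF subgroup_H])
  have p\<psi>H: "p (\<psi>H y) = y" if y: "y \<in> carrier PH" for y
  proof (rule continuous_maps_agree_if_dense[OF completion_Hausdorff[OF tgH assms(5)] denseH _ _ _ y])
    show "continuous_map TH TH (\<lambda>y. p (\<psi>H y))"
      using continuous_map_compose[OF \<psi>Hcont pcont] by (simp add: o_def)
    show "continuous_map TH TH (\<lambda>y. y)" by (rule continuous_map_id[unfolded id_def])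
    fix z assume "z \<in> \<alpha>H ` H"
    then obtain h where h: "h \<in> H" "z = \<alpha>H h" by blast
    have "pH h = h" using pr(2)[OF N.one_closed h(1)] H_carrier[OF h(1)] by simp
    then have "p (\<alpha>G h) = \<alpha>H h" using p(2)[OF H_carrier[OF h(1)]] by simp
    then show "p (\<psi>H z) = z" using h assms(11) by simp
  qed
  have p_clN: "p x = \<one>\<^bsub>PH\<^esub>" if x: "x \<in> clN" for x
  proof (rule forall_in_closure_of_eq[OF x[unfolded assms(6)] completion_Hausdorff[OF tgH assms(5)] pcont])
    fix z assume "z \<in> \<alpha>G ` N"
    then obtain n where n: "n \<in> N" "z = \<alpha>G n" by blast
    have "pH n = \<one>\<^bsub>G\<^esub>" using pr(2)[OF n(1) one_H] N_carrier[OF n(1)] by simp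
    moreover have "\<alpha>H \<one>\<^bsub>G\<^esub> = \<one>\<^bsub>PH\<^esub>"
      using group_hom.hom_one[OF completion_group_hom[OF tgH assms(5)]] by simp
    ultimately show "p z = \<one>\<^bsub>PH\<^esub>" using p(2)[OF N_carrier[OF n(1)]] n(2) by simp
  qed simp
  have injH: "inj_on \<psi>H (carrier PH)" using p\<psi>H by (metis inj_onI)
  have isoH: "topological_iso PH TH (subgrp PG clH) (subtopology TG clH) \<psi>H"
  proof -
    have "\<psi>H \<in> iso PH (subgrp PG clH)"
      using assms(10) injH imgH by (simp add: iso_def bij_betw_def continuous_hom_def)
    moreover have "homeomorphic_map TH (subtopology TG clH) \<psi>H"
      using assms(10) cptH Hausdorff_space_subtopology[OF HausdorffG] imgH injH sub(2)
      by (intro continuous_imp_homeomorphic_map) (auto simp: continuous_hom_def)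
    ultimately show ?thesis by (simp add: topological_iso_def)
  qed
  have int: "clN \<inter> clH = {\<one>\<^bsub>PG\<^esub>}"
  proof
    show "clN \<inter> clH \<subseteq> {\<one>\<^bsub>PG\<^esub>}"
    proof
      fix z assume z: "z \<in> clN \<inter> clH"
      then obtain y where y: "y \<in> carrier PH" "z = \<psi>H y" using imgH by blast
      then have "y = \<one>\<^bsub>PH\<^esub>" using p\<psi>H[OF y(1)] p_clN z by simp
      then show "z \<in> {\<one>\<^bsub>PG\<^esub>}" using y by simp
    qed
    show "{\<one>\<^bsub>PG\<^esub>} \<subseteq> clN \<inter> clH" using subgroup.one_closed[OF sclN] subgroup.one_closed[OF sclH] by simp
  qed

  have q: "quotient_map TN TQ (\<lambda>x. D #>\<^bsub>PN\<^esub> x)" unfolding assms(13) by (rule quotient_map_quotient_topology)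
  have tQ: "topspace TQ = carrier (PN Mod D)"
    using quotient_imp_surjective_map[OF q] by (auto simp: carrier_FactGroup)
  have cptQ: "compact_space TQ"
    using image_compactin[OF cptN[unfolded compact_space_def] quotient_imp_continuous_map[OF q]]
    unfolding compact_space_def quotient_imp_surjective_map[OF q] .
  have grpQ: "group (PN Mod D)" using \<open>D \<lhd> PN\<close> by (rule normal.factorgroup_is_group)
  have gen: "clN <#>\<^bsub>PG\<^esub> clH = carrier PG" unfolding assms(6,7) by (rule closures_generate)
  obtain \<Phi> where \<Phi>: "continuous_action_by_automorphisms PH TH (PN Mod D) TQ \<Phi>"
    "\<And>y C. y \<in> carrier PH \<Longrightarrow> C \<in> carrier (PN Mod D) \<Longrightarrow> \<Phi> y C \<in> carrier (PN Mod D)"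
    "\<And>y C. y \<in> carrier PH \<Longrightarrow> C \<in> carrier (PN Mod D) \<Longrightarrow>
      induced_map \<psi>N (\<Phi> y C) = \<psi>H y \<otimes>\<^bsub>PG\<^esub> induced_map \<psi>N C \<otimes>\<^bsub>PG\<^esub> inv\<^bsub>PG\<^esub> (\<psi>H y)"
    "topological_iso (semidirect_product (PN Mod D) PH \<Phi>) (prod_topology TQ TH) PG TG
      (\<lambda>(C, y). induced_map \<psi>N C \<otimes>\<^bsub>PG\<^esub> \<psi>H y)"
    by (rule semidirect_product_of_complements[OF PG.topological_group HausdorffG normclN sclH gen int
        cptQ grpQ tQ cptH PH.is_group PH.topspace isoN isoH]) blast
  have coset: "D #>\<^bsub>PN\<^esub> x \<in> carrier (PN Mod D)" if "x \<in> carrier PN" for x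
    using that by (auto simp: carrier_FactGroup)
  have "\<Phi> (\<alpha>H h) (D #>\<^bsub>PN\<^esub> x) = D #>\<^bsub>PN\<^esub> prof_action G N PN TN \<alpha>N h x"
    if h: "h \<in> H" and x: "x \<in> carrier PN" for h x
  proof -
    note \<theta> = \<psi>N_prof_action[OF H_carrier[OF h] x]
    have "inj_on (induced_map \<psi>N) (carrier (PN Mod D))"
      using isoN by (simp add: topological_iso_def iso_def bij_betw_def)
    moreover have "induced_map \<psi>N (\<Phi> (\<alpha>H h) (D #>\<^bsub>PN\<^esub> x)) = induced_map \<psi>N (D #>\<^bsub>PN\<^esub> prof_action G N PN TN \<alpha>N h x)"
      using h assms(11) by (simp add: \<Phi>(3)[OF \<alpha>Hc[OF h] coset[OF x]] ind[OF x] ind[OF \<theta>(1)] \<theta>(2))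
    ultimately show ?thesis
      using \<Phi>(2)[OF \<alpha>Hc[OF h] coset[OF x]] coset[OF \<theta>(1)] by (rule inj_onD)
  qed
  moreover have "\<forall>h \<in> H. prof_action G N PN TN \<alpha>N h ` D = D"
    using prof_action_image_kernel H_carrier unfolding D_eq by blast
  ultimately show ?thesis
    using ker \<open>D \<lhd> PN\<close> ind isoN isoH \<Phi>(1,4) by blast
qed

end
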